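(* (Local uncertainty inequality for the MFrWT, $\theta>N/2$) Let $\psi$ be an admissible wavelet (with respect to $\boldsymbol\alpha,\lambda$) and let $\theta>\frac N2$. Then for every measurable subset $K$ of $\mathbb{R}^N$ there exists a constant $A_\theta$ such that for all $f\in L^2(\mathbb{R}^N)$ $$\int_K|(\mathfrak F_{\boldsymbol\alpha,\lambda}f)(\boldsymbol\eta)|^2\,d\boldsymbol\eta\ \le\ \frac{|c(\boldsymbol\alpha_\lambda)|^2}{C_{\boldsymbol\alpha,\lambda}}\,A_\theta\,\frac{|\sin\boldsymbol\alpha|_m}{(\lambda^2)^N}\,|K|\int_{\mathbb{R}^N_0}\|(W_\psi^{\boldsymbol\alpha,\lambda}f)(\boldsymbol a,\cdot)\|^{2-\frac N\theta}_{L^2(\mathbb{R}^N)}\ \big\|\,\|\cdot\|^\theta(W_\psi^{\boldsymbol\alpha,\lambda}f)(\boldsymbol a,\cdot)\big\|^{\frac N\theta}_{L^2(\mathbb{R}^N)}\,\frac{d\boldsymbol a}{|\boldsymbol a|_m^2},$$ where $|K|$ is the Lebesgue measure of $K$ and $C_{\boldsymbol\alpha,\lambda}=(2\pi)^N\int_{\mathbb{R}^N_0}|(\mathfrak F_{\boldsymbol\alpha,\lambda}\psi)(\boldsymbol u)|^2\frac{d\boldsymbol u}{|\boldsymbol u|_m}$.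
   Context: $N\ge1$ is an integer, $\lambda\in\mathbb{R}\setminus\{0\}$, $\boldsymbol\alpha=(\alpha_1,\dots,\alpha_N)$ with $\alpha_k\in(-\pi,\pi)\setminus\{0\}$. $\|\cdot\|$ is the Euclidean norm on $\mathbb{R}^N$. For $\boldsymbol x\in\mathbb{R}^N$, $|\boldsymbol x|_m=|x_1x_2\cdots x_N|$ and $\mathbb{R}^N_0=\{\boldsymbol x\in\mathbb{R}^N:|\boldsymbol x|_m\ne0\}$; $\sin\boldsymbol\alpha=(\sin\alpha_1,\dots,\sin\alpha_N)$. Products and quotients of vectors are componentwise. Put $a(\alpha_k)=\tfrac12\cot\alpha_k$, $c(\alpha_k)=\sqrt{1-i\cot\alpha_k}$, $c(\boldsymbol\alpha_\lambda)=c(\alpha_1)\cdots c(\alpha_N)$, $e_{\boldsymbol\alpha,\pm\lambda^2}(\boldsymbol x)=e^{\pm i\lambda^2\sum_{k=1}^N a(\alpha_k)x_k^2}$. The multidimensional fractional Fourier transform (MFrFT) is $(\mathfrak F_{\boldsymbol\alpha,\lambda}f)(\boldsymbol\xi)=\int_{\mathbb{R}^N}f(\boldsymbol x)K_{\boldsymbol\alpha,\lambda}(\boldsymbol x,\boldsymbol\xi)\,d\boldsymbol x$ (extended to $L^2(\mathbb{R}^N)$ as usual), with kernel $K_{\boldsymbol\alpha,\lambda}(\boldsymbol x,\boldsymbol\xi)=\frac{c(\boldsymbol\alpha_\lambda)}{(\sqrt{2\pi})^N}e_{\boldsymbol\alpha,\lambda^2}(\boldsymbol x)e_{\boldsymbol\alpha,\lambda^2}(\boldsymbol\xi)e^{-i\lambda^2\sum_{k=1}^N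 x_k\xi_k\csc\alpha_k}$. An admissible wavelet is a non-zero $\psi\in L^2(\mathbb{R}^N)$ with $\int_{\mathbb{R}^N_0}|(\mathfrak F_{\boldsymbol\alpha,\lambda}\psi)(\boldsymbol u)|^2\frac{d\boldsymbol u}{|\boldsymbol u|_m}<\infty$. The multidimensional fractional wavelet transform (MFrWT) of $f\in L^2(\mathbb{R}^N)$ is, for $\boldsymbol a\in\mathbb{R}^N_0$, $\boldsymbol b\in\mathbb{R}^N$, $(W_\psi^{\boldsymbol\alpha,\lambda}f)(\boldsymbol a,\boldsymbol b)=\int_{\mathbb{R}^N}f(\boldsymbol t)\overline{\boldsymbol\Psi_{\boldsymbol\alpha,\lambda,\boldsymbol a,\boldsymbol b}(\boldsymbol t)}\,d\boldsymbol t$, where $\boldsymbol\Psi_{\boldsymbol\alpha,\lambda,\boldsymbol a,\boldsymbol b}(\boldsymbol t)=\overline{c(\boldsymbol\alpha_\lambda)}\,e_{\boldsymbol\alpha,\lambda^2}(\boldsymbol b)\,e_{\boldsymbol\alpha,-\lambda^2}(\boldsymbol t)\frac{1}{\sqrt{|\boldsymbol a|_m}}\tilde\psi\!\left(\frac{\boldsymbol t-\boldsymbol b}{\boldsymbol a}\right)$ and $\tilde\psi=\psi\,e_{\boldsymbol\alpha,\lambda^2}$. In $\|\,\|\cdot\|^\theta(W_\psi^{\boldsymbol\alpha,\lambda}f)(\boldsymbol a,\cdot)\|_{L^2(\mathbb{R}^N)}$ the norm is that of $\boldsymbol b\mapsto\|\boldsymbol b\|^\theta(W_\psi^{\boldsymbol\alpha,\lambda}f)(\boldsymbol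 a,\boldsymbol b)$. *)

theory Defs
  imports "HOL-Analysis.Analysis"
begin

text \<open>
  \<open>\<real>\<^sup>N\<close> is rendered as \<^typ>\<open>real ^ 'n\<close> with \<open>N = CARD('n)\<close>.  Functions on \<open>\<real>\<^sup>N\<close> are
  representatives of their almost-everywhere classes; measurability is Lebesgue measurability.
\<close>

subsection \<open>Vectors\<close>

definition mod_prod :: "real ^ 'n \<Rightarrow> real" where
  "mod_prod x = \<bar>\<Prod>k\<in>UNIV. x $ k\<bar>"

definition nonzero_coords :: "(real ^ 'n) set" where
  "nonzero_coords = {x. mod_prod x \<noteq> 0}"

definition sin_vec :: "real ^ 'n \<Rightarrow> real ^ 'n" where
  "sin_vec \<alpha> = (\<chi> k. sin (\<alpha> $ k))"

definition vec_divide :: "real ^ 'n \<Rightarrow> real ^ 'n \<Rightarrow> real ^ 'n" where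
  "vec_divide x y = (\<chi> k. x $ k / y $ k)"

subsection \<open>The space \<open>L\<^sup>2\<close>\<close>

definition L2_fun :: "(real ^ 'n \<Rightarrow> complex) \<Rightarrow> bool" where
  "L2_fun f \<longleftrightarrow> f \<in> borel_measurable lebesgue \<and> integrable lebesgue (\<lambda>x. (cmod (f x))\<^sup>2)"

text \<open>
  Real powers on the extended nonnegative reals.  The exponent is meant to be positive:
  then \<open>0\<close> is sent to \<open>0\<close> and \<open>\<infinity>\<close> to \<open>\<infinity>\<close>.
\<close>

definition ennreal_powr :: "ennreal \<Rightarrow> real \<Rightarrow> ennreal" where
  "ennreal_powr x p = (if x = \<infinity> then \<infinity> else ennreal (enn2real x powr p))"

text \<open>The \<open>L\<^sup>2\<close> norm, with value \<open>\<infinity>\<close> when the function is not square integrable.\<close>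

definition L2_norm :: "(real ^ 'n \<Rightarrow> complex) \<Rightarrow> ennreal" where
  "L2_norm f = ennreal_powr (\<integral>\<^sup>+ x. ennreal ((cmod (f x))\<^sup>2) \<partial>lebesgue) (1 / 2)"

subsection \<open>The multidimensional fractional Fourier transform\<close>

definition frft_a :: "real \<Rightarrow> real" where
  "frft_a t = cot t / 2"

definition frft_c :: "real \<Rightarrow> complex" where
  "frft_c t = csqrt (1 - \<i> * complex_of_real (cot t))"

definition frft_c_prod :: "real ^ 'n \<Rightarrow> complex" where
  "frft_c_prod \<alpha> = (\<Prod>k\<in>UNIV. frft_c (\<alpha> $ k))"

text \<open>\<open>chirp \<alpha> s\<close> is \<open>e\<^bsub>\<alpha>,s\<^esub>\<close>; it is used with \<open>s = \<lambda>\<^sup>2\<close> and \<open>s = -\<lambda>\<^sup>2\<close>.\<close>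

definition chirp :: "real ^ 'n \<Rightarrow> real \<Rightarrow> real ^ 'n \<Rightarrow> complex" where
  "chirp \<alpha> s x = exp (\<i> * complex_of_real (s * (\<Sum>k\<in>UNIV. frft_a (\<alpha> $ k) * (x $ k)\<^sup>2)))"

definition frft_kernel :: "real ^ 'n \<Rightarrow> real \<Rightarrow> real ^ 'n \<Rightarrow> real ^ 'n \<Rightarrow> complex" where
  "frft_kernel \<alpha> l x \<xi> =
     frft_c_prod \<alpha> / complex_of_real (sqrt (2 * pi) ^ CARD('n)) * chirp \<alpha> (l\<^sup>2) x * chirp \<alpha> (l\<^sup>2) \<xi> *
     exp (- \<i> * complex_of_real (l\<^sup>2 * (\<Sum>k\<in>UNIV. x $ k * \<xi> $ k / sin (\<alpha> $ k))))"

definition frft_integral ::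
    "real ^ 'n \<Rightarrow> real \<Rightarrow> (real ^ 'n \<Rightarrow> complex) \<Rightarrow> real ^ 'n \<Rightarrow> complex" where
  "frft_integral \<alpha> l f \<xi> = (\<integral>x. f x * frft_kernel \<alpha> l x \<xi> \<partial>lebesgue)"

text \<open>
  The extension to \<open>L\<^sup>2\<close> by density and continuity: \<open>g\<close> is a transform of \<open>f\<close> if it is the
  \<open>L\<^sup>2\<close> limit of the integral transforms of functions in \<open>L\<^sup>1 \<inter> L\<^sup>2\<close> tending to \<open>f\<close> in \<open>L\<^sup>2\<close>.
  By Plancherel such a \<open>g\<close> exists and is unique almost everywhere, so \<open>mfrft\<close> picks a representative.
\<close>

definition is_mfrft ::
    "real ^ 'n \<Rightarrow> real \<Rightarrow> (real ^ 'n \<Rightarrow> complex) \<Rightarrow> (real ^ 'n \<Rightarrow> complex) \<Rightarrow> bool" where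
  "is_mfrft \<alpha> l f g \<longleftrightarrow> L2_fun g \<and>
     (\<exists>h. (\<forall>n::nat. integrable lebesgue (h n) \<and> L2_fun (h n)) \<and>
          (\<lambda>n. L2_norm (\<lambda>x. h n x - f x)) \<longlonglongrightarrow> 0 \<and>
          (\<lambda>n. L2_norm (\<lambda>\<xi>. frft_integral \<alpha> l (h n) \<xi> - g \<xi>)) \<longlonglongrightarrow> 0)"

definition mfrft :: "real ^ 'n \<Rightarrow> real \<Rightarrow> (real ^ 'n \<Rightarrow> complex) \<Rightarrow> real ^ 'n \<Rightarrow> complex" where
  "mfrft \<alpha> l f = (SOME g. is_mfrft \<alpha> l f g)"

subsection \<open>The multidimensional fractional wavelet transform\<close>

definition wavelet_integral :: "real ^ 'n \<Rightarrow> real \<Rightarrow> (real ^ 'n \<Rightarrow> complex) \<Rightarrow> ennreal" where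
  "wavelet_integral \<alpha> l \<psi> =
     (\<integral>\<^sup>+ u\<in>nonzero_coords. ennreal ((cmod (mfrft \<alpha> l \<psi> u))\<^sup>2 / mod_prod u) \<partial>lebesgue)"

definition admissible_wavelet :: "real ^ 'n \<Rightarrow> real \<Rightarrow> (real ^ 'n \<Rightarrow> complex) \<Rightarrow> bool" where
  "admissible_wavelet \<alpha> l \<psi> \<longleftrightarrow>
     L2_fun \<psi> \<and> \<not> (AE x in lebesgue. \<psi> x = 0) \<and> wavelet_integral \<alpha> l \<psi> < \<infinity>"

definition wavelet_const :: "real ^ 'n \<Rightarrow> real \<Rightarrow> (real ^ 'n \<Rightarrow> complex) \<Rightarrow> ennreal" where
  "wavelet_const \<alpha> l \<psi> = ennreal ((2 * pi) ^ CARD('n)) * wavelet_integral \<alpha> l \<psi>"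

definition wavelet_tilde ::
    "real ^ 'n \<Rightarrow> real \<Rightarrow> (real ^ 'n \<Rightarrow> complex) \<Rightarrow> real ^ 'n \<Rightarrow> complex" where
  "wavelet_tilde \<alpha> l \<psi> t = \<psi> t * chirp \<alpha> (l\<^sup>2) t"

definition daughter_wavelet ::
    "real ^ 'n \<Rightarrow> real \<Rightarrow> (real ^ 'n \<Rightarrow> complex) \<Rightarrow> real ^ 'n \<Rightarrow> real ^ 'n \<Rightarrow> real ^ 'n \<Rightarrow> complex" where
  "daughter_wavelet \<alpha> l \<psi> a b t =
     cnj (frft_c_prod \<alpha>) * chirp \<alpha> (l\<^sup>2) b * chirp \<alpha> (- (l\<^sup>2)) t *
     complex_of_real (1 / sqrt (mod_prod a)) * wavelet_tilde \<alpha> l \<psi> (vec_divide (t - b) a)"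

definition mfrwt ::
    "real ^ 'n \<Rightarrow> real \<Rightarrow> (real ^ 'n \<Rightarrow> complex) \<Rightarrow> (real ^ 'n \<Rightarrow> complex) \<Rightarrow>
     real ^ 'n \<Rightarrow> real ^ 'n \<Rightarrow> complex" where
  "mfrwt \<alpha> l \<psi> f a b = (\<integral>t. f t * cnj (daughter_wavelet \<alpha> l \<psi> a b t) \<partial>lebesgue)"

end

theory Submission
  imports Defs "HOL-Probability.Characteristic_Functions"
begin

text \<open>
  For a fixed scale \<open>a\<close> the wavelet transform \<open>W a\<close> of \<open>f\<close> is, up to chirps, a convolution, and so its
  transform at \<open>\<eta>\<close> is a constant times \<open>|a|\<^sup>1\<^sup>/\<^sup>2\<close> times \<open>mfrft f \<eta>\<close> times the conjugate of
  \<open>mfrft \<psi> (a * \<eta>)\<close>, up to unimodular factors.  A Fourier transform is bounded by an \<open>L\<^sup>1\<close> norm, which gives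
  \<open>|a| |mfrft f \<eta>|\<^sup>2 |mfrft \<psi> (a * \<eta>)|\<^sup>2 \<le> const * \<parallel>W a\<parallel>\<^sub>1\<^sup>2\<close> for almost every \<open>\<eta>\<close>
  (\<open>mfrft_product_le_mfrwt\<close>).  Since \<open>2 * \<theta> > N\<close>, Cauchy-Schwarz against an integrable weight,
  optimised over dilations of that weight, bounds \<open>\<parallel>W a\<parallel>\<^sub>1\<^sup>2\<close> by the product of powers of
  the plain and the weighted \<open>L\<^sup>2\<close> norm in the statement (\<open>L1_le_L2_weighted\<close>).  Integrate over \<open>K\<close>
  in \<open>\<eta>\<close> and over \<open>da / |a|\<^sup>2\<close>.  Because \<open>da / |a|\<close> is invariant under dilation, the integral over \<open>a\<close> on
  the left is the wavelet integral of \<open>\<psi>\<close> for almost every \<open>\<eta>\<close> (\<open>wavelet_integral_dilate\<close>), and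
  dividing by it gives the claim.  It is not zero because the transform is injective.  The resulting constant
  does not depend on \<open>K\<close>.

  The transforms are defined by density, so what is needed of the \<open>L\<^sup>2\<close> theory of the Fourier
  transform is developed first, from Gaussians and the multiplication formula
  \<open>\<integral> fourier h * k = \<integral> h * fourier k\<close>.  Four facts suffice: the bound
  \<open>\<parallel>fourier h\<parallel>\<^sub>2\<^sup>2 \<le> (2 * pi) ^ N * \<parallel>h\<parallel>\<^sub>2\<^sup>2\<close> (\<open>sq_norm_fourier_le\<close>), existence
  (\<open>l2_fourier_exists\<close>), injectivity (\<open>l2_fourier_inject\<close>), and the bound of a product of two transforms by the
  \<open>L\<^sup>1\<close> norm of a convolution (\<open>l2_fourier_convolution_bound\<close>).  The last two rest on
  \<open>smoothing_bound_imp_AE_bound\<close>: a function whose Gaussian averages are bounded by \<open>M\<close> is bounded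
  by \<open>M\<close> almost everywhere.
\<close>

section \<open>Gaussians and their Fourier transforms\<close>

text \<open>
  The classical transform is normalised without a constant in front, so that
  \<open>fourier\<close> and its reflection compose to \<open>(2 * pi) ^ N\<close> times the identity.
\<close>

definition fourier :: "('a::euclidean_space \<Rightarrow> complex) \<Rightarrow> 'a \<Rightarrow> complex" where
  "fourier h \<omega> = (\<integral>x. h x * cis (- (x \<bullet> \<omega>)) \<partial>lborel)"

definition gauss :: "real \<Rightarrow> 'a::euclidean_space \<Rightarrow> real" where
  "gauss s x = exp (- (s * norm x)\<^sup>2 / 2)"

text \<open>
  The Fourier transform of \<open>gauss s\<close>.  Its total mass is \<open>(2 * pi) ^ N\<close> for every \<open>s\<close>, and it
  concentrates at the origin as \<open>s\<close> tends to \<open>0\<close>: up to that factor it is an approximate identity.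
\<close>

definition gauss_dual :: "real \<Rightarrow> 'a::euclidean_space \<Rightarrow> real" where
  "gauss_dual s x = (sqrt (2 * pi) / s) ^ DIM('a) * gauss (1 / s) x"

lemma borel_measurable_cis [measurable]: "cis \<in> borel_measurable borel"
  by (intro borel_measurable_continuous_onI continuous_intros)

lemma borel_measurable_cnj [measurable]: "cnj \<in> borel_measurable borel"
  by (intro borel_measurable_continuous_onI continuous_intros)

lemma borel_measurable_gauss [measurable]: "gauss s \<in> borel_measurable borel"
  unfolding gauss_def[abs_def] by measurable

lemma borel_measurable_gauss_dual [measurable]: "gauss_dual s \<in> borel_measurable borel"
  unfolding gauss_dual_def[abs_def] by measurable

lemma gauss_pos: "gauss s x > 0"
  by (simp add: gauss_def)

lemma gauss_dual_pos: "s > 0 \<Longrightarrow> gauss_dual s x > 0"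
  by (simp add: gauss_dual_def gauss_pos)

lemma abs_gauss [simp]: "\<bar>gauss s x\<bar> = gauss s x"
  using gauss_pos[of s x] by simp

lemma abs_gauss_dual [simp]: "s > 0 \<Longrightarrow> \<bar>gauss_dual s x\<bar> = gauss_dual s x"
  using gauss_dual_pos[of s x] by simp

lemma gauss_nonneg [simp]: "0 \<le> gauss s x"
  using gauss_pos[of s x] by simp

lemma gauss_dual_nonneg [simp]: "s > 0 \<Longrightarrow> 0 \<le> gauss_dual s x"
  using gauss_dual_pos[of s x] by simp

lemma gauss_le_1: "gauss s x \<le> 1"
  by (simp add: gauss_def)

lemma gauss_dual_le:
  fixes x :: "'a::euclidean_space"
  shows "s > 0 \<Longrightarrow> gauss_dual s x \<le> (sqrt (2 * pi) / s) ^ DIM('a)"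
  using gauss_le_1[of "1 / s" x] unfolding gauss_dual_def by (intro mult_left_le) auto

lemma gauss_real_integrable:
  assumes "s > 0"
  shows "integrable lborel (\<lambda>t::real. exp (- (s * t)\<^sup>2 / 2))"
proof -
  have "integrable lborel (\<lambda>t. std_normal_density (0 + s * t))"
    using assms by (intro lborel_integrable_real_affine integrable_normal_density) auto
  then have "integrable lborel (\<lambda>t. sqrt (2 * pi) * std_normal_density (0 + s * t))"
    by (rule integrable_mult_right)
  then show ?thesis
    by (simp add: std_normal_density_def)
qed

text \<open>
  In one dimension this is the known characteristic function of the standard normal
  distribution, after the substitution \<open>x = s * t\<close>.
\<close>

lemma fourier_gauss_real:
  assumes "s > 0"
  shows "(\<integral>t. complex_of_real (exp (- (s * t)\<^sup>2 / 2)) * cis (- (t * u)) \<partial>lborel)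
    = complex_of_real (sqrt (2 * pi) / s * exp (- (u / s)\<^sup>2 / 2))"
proof -
  have "complex_of_real (exp (- ((- u / s)\<^sup>2) / 2)) = char std_normal_distribution (- u / s)"
    by (simp add: char_std_normal_distribution)
  also have "\<dots> = (\<integral>x. std_normal_density x *\<^sub>R iexp ((- u / s) * x) \<partial>lborel)"
    unfolding char_def by (subst integral_density) (auto simp: normal_density_nonneg)
  also have "\<dots> = \<bar>s\<bar> *\<^sub>R (\<integral>t. std_normal_density (0 + s * t) *\<^sub>R iexp ((- u / s) * (0 + s * t)) \<partial>lborel)"
    using assms by (intro lborel_integral_real_affine) auto
  also have "\<dots> = s *\<^sub>R (\<integral>t. complex_of_real (1 / sqrt (2 * pi)) * (complex_of_real (exp (- (s * t)\<^sup>2 / 2)) * cis (- (t * u))) \<partial>lborel)"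
    using assms
    by (intro arg_cong2[where f=scaleR] Bochner_Integration.integral_cong refl)
       (auto simp: std_normal_density_def scaleR_conv_of_real cis_conv_exp mult_ac)
  also have "\<dots> = complex_of_real (s / sqrt (2 * pi)) * (\<integral>t. complex_of_real (exp (- (s * t)\<^sup>2 / 2)) * cis (- (t * u)) \<partial>lborel)"
    by (subst integral_mult_right_zero) (simp add: scaleR_conv_of_real)
  finally show ?thesis
    using assms by (simp add: field_simps)
qed

lemma
  fixes f :: "'a::euclidean_space \<Rightarrow> real \<Rightarrow> complex"
  assumes "\<And>b. b \<in> Basis \<Longrightarrow> integrable lborel (f b)"
  shows lborel_integrable_prod_coords: "integrable lborel (\<lambda>x::'a. \<Prod>b\<in>Basis. f b (x \<bullet> b))"
    and lborel_integral_prod_coords: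
      "(\<integral>x. (\<Prod>b\<in>Basis. f b (x \<bullet> b)) \<partial>(lborel :: 'a measure)) = (\<Prod>b\<in>Basis. \<integral>t. f b t \<partial>lborel)"
proof -
  interpret product_sigma_finite "\<lambda>_::'a. lborel :: real measure"
    by standard
  have [measurable]: "\<And>b. b \<in> Basis \<Longrightarrow> f b \<in> borel_measurable borel"
    using assms by (auto dest: borel_measurable_integrable)
  have *: "(\<Prod>b\<in>Basis. f b ((\<Sum>b\<in>Basis. x b *\<^sub>R b) \<bullet> b)) = (\<Prod>b\<in>Basis. f b (x b))" for x :: "'a \<Rightarrow> real"
    by (intro prod.cong refl) simp
  have L: "(lborel :: 'a measure) = distr (\<Pi>\<^sub>M b\<in>Basis. lborel) borel (\<lambda>f. \<Sum>b\<in>Basis. f b *\<^sub>R b)"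
    by (rule lborel_eq)
  show "integrable lborel (\<lambda>x::'a. \<Prod>b\<in>Basis. f b (x \<bullet> b))"
    by (subst L, subst integrable_distr_eq) (auto simp: * intro!: product_integrable_prod assms)
  show "(\<integral>x. (\<Prod>b\<in>Basis. f b (x \<bullet> b)) \<partial>(lborel :: 'a measure)) = (\<Prod>b\<in>Basis. \<integral>t. f b t \<partial>lborel)"
    by (subst L, subst integral_distr) (auto simp: * intro!: product_integral_prod assms)
qed

lemma gauss_prod_coords:
  fixes x :: "'a::euclidean_space"
  shows "gauss s x = (\<Prod>b\<in>Basis. exp (- (s * (x \<bullet> b))\<^sup>2 / 2))"
proof -
  have "(norm x)\<^sup>2 = (\<Sum>b\<in>Basis. (x \<bullet> b)\<^sup>2)"
    by (subst power2_norm_eq_inner, subst euclidean_inner) (simp add: power2_eq_square)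
  then have "- (s * norm x)\<^sup>2 / 2 = (\<Sum>b\<in>Basis. - (s * (x \<bullet> b))\<^sup>2 / 2)"
    by (simp add: power_mult_distrib sum_distrib_left sum_divide_distrib sum_negf)
  then show ?thesis
    by (simp add: gauss_def exp_sum)
qed

lemma cis_sum: "finite A \<Longrightarrow> cis (sum f A) = (\<Prod>a\<in>A. cis (f a))"
  by (induction A rule: finite_induct) (auto simp flip: cis_mult)

lemma
  fixes \<omega> :: "'a::euclidean_space"
  assumes "s > 0"
  shows gauss_integrable: "integrable lborel (gauss s :: 'a \<Rightarrow> real)"
    and fourier_gauss: "fourier (\<lambda>x. complex_of_real (gauss s x)) \<omega> = complex_of_real (gauss_dual s \<omega>)"
proof -
  have real_int: "integrable lborel (\<lambda>t::real. complex_of_real (exp (- (s * t)\<^sup>2 / 2)))"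
    using gauss_real_integrable[OF assms] by (rule integrable_of_real)
  then have "integrable lborel (\<lambda>x::'a. complex_of_real (gauss s x))"
    unfolding gauss_prod_coords of_real_prod by (rule lborel_integrable_prod_coords)
  then show "integrable lborel (gauss s :: 'a \<Rightarrow> real)"
    by (simp only: complex_of_real_integrable_eq)
  have "integrable lborel (\<lambda>t::real. complex_of_real (exp (- (s * t)\<^sup>2 / 2)) * cis (- (t * u)))" for u
    by (rule Bochner_Integration.integrable_bound[OF real_int]) (auto simp: norm_mult)
  then have "(\<integral>x. (\<Prod>b\<in>Basis. complex_of_real (exp (- (s * (x \<bullet> b))\<^sup>2 / 2)) * cis (- ((x \<bullet> b) * (\<omega> \<bullet> b)))) \<partial>(lborel::'a measure))
     = (\<Prod>b\<in>Basis. \<integral>t. complex_of_real (exp (- (s * t)\<^sup>2 / 2)) * cis (- (t * (\<omega> \<bullet> b))) \<partial>lborel)"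
    by (intro lborel_integral_prod_coords[where f = "\<lambda>b t. complex_of_real (exp (- (s * t)\<^sup>2 / 2)) * cis (- (t * (\<omega> \<bullet> b)))"])
  also have "\<dots> = complex_of_real (\<Prod>b\<in>Basis. sqrt (2 * pi) / s * exp (- (1 / s * (\<omega> \<bullet> b))\<^sup>2 / 2))"
    by (subst fourier_gauss_real[OF assms]) simp
  also have "\<dots> = complex_of_real (gauss_dual s \<omega>)"
    by (simp only: gauss_dual_def gauss_prod_coords prod.distrib prod_constant)
  finally have "(\<integral>x. (\<Prod>b\<in>Basis. complex_of_real (exp (- (s * (x \<bullet> b))\<^sup>2 / 2)) * cis (- ((x \<bullet> b) * (\<omega> \<bullet> b)))) \<partial>(lborel::'a measure))
     = complex_of_real (gauss_dual s \<omega>)" .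
  moreover have "complex_of_real (gauss s x) * cis (- (x \<bullet> \<omega>)) =
    (\<Prod>b\<in>Basis. complex_of_real (exp (- (s * (x \<bullet> b))\<^sup>2 / 2)) * cis (- ((x \<bullet> b) * (\<omega> \<bullet> b))))" for x
    by (simp add: prod.distrib gauss_prod_coords euclidean_inner[of x \<omega>] flip: cis_sum sum_negf)
  ultimately show "fourier (\<lambda>x. complex_of_real (gauss s x)) \<omega> = complex_of_real (gauss_dual s \<omega>)"
    by (simp add: fourier_def)
qed

lemma gauss_integral:
  assumes "s > 0"
  shows "(\<integral>x. gauss s x \<partial>(lborel::'a::euclidean_space measure)) = (sqrt (2 * pi) / s) ^ DIM('a)"
proof -
  have "complex_of_real (\<integral>x. gauss s x \<partial>(lborel::'a measure)) = fourier (\<lambda>x::'a. complex_of_real (gauss s x)) 0"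
    by (simp add: fourier_def flip: integral_complex_of_real)
  also have "\<dots> = complex_of_real ((sqrt (2 * pi) / s) ^ DIM('a))"
    using assms by (simp only: fourier_gauss) (simp add: gauss_dual_def gauss_def)
  finally show ?thesis
    by (simp only: of_real_eq_iff)
qed

lemma
  assumes "s > 0"
  shows gauss_dual_integrable: "integrable lborel (gauss_dual s :: 'a::euclidean_space \<Rightarrow> real)"
    and gauss_dual_integral: "(\<integral>x. gauss_dual s x \<partial>(lborel::'a measure)) = (2 * pi) ^ DIM('a)"
    and nn_integral_gauss_dual: "(\<integral>\<^sup>+x. ennreal (gauss_dual s x) \<partial>(lborel::'a measure)) = ennreal ((2 * pi) ^ DIM('a))"
proof -
  show 1: "integrable lborel (gauss_dual s :: 'a \<Rightarrow> real)"
    unfolding gauss_dual_def[abs_def] using assms by (intro integrable_mult_right gauss_integrable) auto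
  have "(sqrt (2 * pi) / s) ^ DIM('a) * (sqrt (2 * pi) / (1 / s)) ^ DIM('a) = (2 * pi) ^ DIM('a)"
    using assms by (subst power_mult_distrib[symmetric]) simp
  then show 2: "(\<integral>x. gauss_dual s x \<partial>(lborel::'a measure)) = (2 * pi) ^ DIM('a)"
    unfolding gauss_dual_def using assms by (simp add: gauss_integral)
  show "(\<integral>\<^sup>+x. ennreal (gauss_dual s x) \<partial>(lborel::'a measure)) = ennreal ((2 * pi) ^ DIM('a))"
    using 1 2 gauss_dual_pos[OF assms] by (subst nn_integral_eq_integral) (auto intro: less_imp_le)
qed

section \<open>The Fourier transform of integrable functions\<close>

text \<open>
  The squared norm is kept as an extended real, and without requiring measurability, so that it
  can be written down for any function before its finiteness is known.
\<close>

definition sq_norm :: "('a::euclidean_space \<Rightarrow> complex) \<Rightarrow> ennreal" where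
  "sq_norm f = (\<integral>\<^sup>+x. ennreal ((cmod (f x))\<^sup>2) \<partial>lborel)"

lemma norm_integral_le_nn_integral:
  fixes f :: "_ \<Rightarrow> 'b::{banach, second_countable_topology}"
  shows "ennreal (norm (\<integral>x. f x \<partial>M)) \<le> (\<integral>\<^sup>+x. ennreal (norm (f x)) \<partial>M)"
  by (cases "integrable M f") (auto simp: integral_norm_bound_ennreal not_integrable_integral_eq)

lemma nn_integral_lborel_affine:
  fixes f :: "'a::euclidean_space \<Rightarrow> ennreal"
  assumes [measurable]: "f \<in> borel_measurable borel" and "c \<noteq> 0"
  shows "(\<integral>\<^sup>+x. f x \<partial>lborel) = ennreal (\<bar>c\<bar> ^ DIM('a)) * (\<integral>\<^sup>+x. f (t + c *\<^sub>R x) \<partial>lborel)"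
  by (subst lborel_affine[OF \<open>c \<noteq> 0\<close>, of t])
     (simp add: nn_integral_density nn_integral_distr nn_integral_cmult)

lemma integral_lborel_affine:
  fixes f :: "'a::euclidean_space \<Rightarrow> 'b::{banach, second_countable_topology}"
  assumes [measurable]: "f \<in> borel_measurable borel" and "c \<noteq> 0"
  shows "(\<integral>x. f x \<partial>lborel) = \<bar>c\<bar> ^ DIM('a) *\<^sub>R (\<integral>x. f (t + c *\<^sub>R x) \<partial>lborel)"
  by (subst lborel_affine[OF \<open>c \<noteq> 0\<close>, of t])
     (simp add: integral_density integral_distr)

lemma nn_integral_lborel_shift:
  fixes f :: "'a::euclidean_space \<Rightarrow> ennreal"
  assumes "f \<in> borel_measurable borel"
  shows "(\<integral>\<^sup>+x. f (x - t) \<partial>lborel) = (\<integral>\<^sup>+x. f x \<partial>lborel)"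
    and "(\<integral>\<^sup>+x. f (t - x) \<partial>lborel) = (\<integral>\<^sup>+x. f x \<partial>lborel)"
  using nn_integral_lborel_affine[OF assms, of 1 "- t"] nn_integral_lborel_affine[OF assms, of "-1" t]
  by simp_all

lemma AE_lborel_shift:
  fixes t :: "'a::euclidean_space"
  assumes "AE x in lborel. P x"
  shows "AE x in lborel. P (x - t)"
proof -
  obtain N where N: "{x. \<not> P x} \<subseteq> N" "N \<in> null_sets lborel"
    using assms(1) by (auto simp: eventually_ae_filter)
  then have [measurable]: "N \<in> sets borel" by auto
  have "(\<integral>\<^sup>+x. indicator N (x - t) \<partial>(lborel::'a measure)) = 0"
    using N by (subst nn_integral_lborel_shift(1)) auto
  then have "AE x in lborel. indicator N (x - t) = (0::ennreal)"
    by (subst (asm) nn_integral_0_iff_AE) auto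
  then show ?thesis
    using N(1) by (auto elim!: eventually_mono simp: indicator_def split: if_splits)
qed

lemma borel_measurable_fourier [measurable]:
  assumes [measurable]: "h \<in> borel_measurable borel"
  shows "fourier h \<in> borel_measurable borel"
  unfolding fourier_def[abs_def] by measurable

lemma cmod_fourier_le: "cmod (fourier h \<omega>) \<le> (\<integral>x. cmod (h x) \<partial>lborel)"
  unfolding fourier_def using integral_norm_bound[of lborel "\<lambda>x. h x * cis (- (x \<bullet> \<omega>))"]
  by (simp add: norm_mult)

lemma fourier_modulate:
  "fourier (\<lambda>x. h x * cis (x \<bullet> \<eta>)) \<omega> = fourier h (\<omega> - \<eta>)"
  unfolding fourier_def
  by (intro Bochner_Integration.integral_cong refl) (simp add: inner_diff_right cis_mult mult.assoc)

lemma integrable_bounded_mult: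
  fixes f g :: "'a \<Rightarrow> complex"
  assumes "integrable M f" "g \<in> borel_measurable M" "\<And>x. cmod (g x) \<le> B"
  shows "integrable M (\<lambda>x. f x * g x)"
proof (rule Bochner_Integration.integrable_bound)
  show "integrable M (\<lambda>x. B * cmod (f x))"
    using assms(1) by (intro integrable_mult_right integrable_norm)
  show "AE x in M. norm (f x * g x) \<le> norm (B * cmod (f x))"
  proof (intro AE_I2)
    fix x
    have "0 \<le> B" using assms(3)[of x] norm_ge_zero order_trans by blast
    then show "norm (f x * g x) \<le> norm (B * cmod (f x))"
      using mult_right_mono[OF assms(3)[of x], of "cmod (f x)"] by (simp add: norm_mult abs_mult mult.commute)
  qed
qed (use assms in auto)

text \<open>
  The multiplication formula, a direct consequence of Fubini.  It replaces Fourier inversion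
  in what follows: instead of inverting a transform, pair it with an integrable \<open>k\<close> whose own
  transform is known.
\<close>

lemma fourier_multiplication:
  fixes h k :: "'a::euclidean_space \<Rightarrow> complex"
  assumes h: "integrable lborel h" and k: "integrable lborel k"
  shows "(\<integral>\<omega>. fourier h \<omega> * k \<omega> \<partial>lborel) = (\<integral>x. h x * fourier k x \<partial>lborel)"
proof -
  have [measurable]: "h \<in> borel_measurable borel" "k \<in> borel_measurable borel"
    using h k by auto
  have "integrable (lborel \<Otimes>\<^sub>M lborel) (\<lambda>(x, \<omega>). h x * k \<omega> * cis (- (x \<bullet> \<omega>)))"
  proof (rule lborel_pair.Fubini_integrable)
    show "AE x in lborel. integrable lborel (\<lambda>\<omega>. case (x, \<omega>) of (x, \<omega>) \<Rightarrow> h x * k \<omega> * cis (- (x \<bullet> \<omega>)))"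
      using k by (intro AE_I2) (simp, intro integrable_bounded_mult[where B=1] integrable_mult_right, auto)
  qed (use h k in \<open>auto simp: norm_mult\<close>)
  then have "(\<integral>\<omega>. (\<integral>x. h x * k \<omega> * cis (- (x \<bullet> \<omega>)) \<partial>lborel) \<partial>lborel)
      = (\<integral>x. (\<integral>\<omega>. h x * k \<omega> * cis (- (x \<bullet> \<omega>)) \<partial>lborel) \<partial>lborel)"
    by (rule lborel_pair.Fubini_integral)
  moreover have "(\<integral>x. h x * k \<omega> * cis (- (x \<bullet> \<omega>)) \<partial>lborel) = fourier h \<omega> * k \<omega>" for \<omega>
    unfolding fourier_def integral_mult_left_zero[symmetric]
    by (intro Bochner_Integration.integral_cong) (auto simp: mult_ac)
  moreover have "(\<integral>\<omega>. h x * k \<omega> * cis (- (x \<bullet> \<omega>)) \<partial>lborel) = h x * fourier k x" for x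
    unfolding fourier_def integral_mult_right_zero[symmetric]
    by (intro Bochner_Integration.integral_cong) (auto simp: mult_ac inner_commute)
  ultimately show ?thesis by simp
qed

lemma integrable_gauss_complex: "s > 0 \<Longrightarrow> integrable lborel (\<lambda>x. complex_of_real (gauss s x))"
  by (simp add: gauss_integrable complex_of_real_integrable_eq)

lemma ennreal_distrib_right_real:
  fixes a b c :: real
  assumes "0 \<le> a" "0 \<le> b" "0 \<le> c"
  shows "ennreal ((a + b) * c) = ennreal a * ennreal c + ennreal b * ennreal c"
  using assms by (simp add: distrib_right ennreal_mult)

text \<open>
  The half of Plancherel that is needed, regularised by a Gaussian so that all integrals converge
  absolutely.  Applying the multiplication formula twice turns the left-hand side into
  \<open>\<integral>\<integral> h x * cnj (h y) * gauss_dual s (y - x)\<close>.  The kernel is positive with mass \<open>(2 * pi) ^ N\<close>, so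
  \<open>|h x| * |h y| \<le> (|h x|\<^sup>2 + |h y|\<^sup>2) / 2\<close> bounds this uniformly in \<open>s\<close>.
\<close>

lemma sq_norm_fourier_gauss_le:
  fixes h :: "'a::euclidean_space \<Rightarrow> complex"
  assumes h: "integrable lborel h" and s: "s > 0"
  shows "(\<integral>\<^sup>+\<omega>. ennreal ((cmod (fourier h \<omega>))\<^sup>2 * gauss s \<omega>) \<partial>lborel)
    \<le> ennreal ((2 * pi) ^ DIM('a)) * sq_norm h"
proof -
  let ?C = "ennreal ((2 * pi) ^ DIM('a))"
  have split: "ennreal (((cmod (h x))\<^sup>2 / 2 + (cmod (h y))\<^sup>2 / 2) * gauss_dual s (y - x))
      = ennreal ((cmod (h x))\<^sup>2 / 2) * ennreal (gauss_dual s (y - x))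
        + ennreal ((cmod (h y))\<^sup>2 / 2) * ennreal (gauss_dual s (y - x))" for x y
    using gauss_dual_pos[OF s, of "y - x"] by (intro ennreal_distrib_right_real) auto
  have [measurable]: "h \<in> borel_measurable borel"
    using h by auto
  define k where "k \<omega> = cnj (fourier h \<omega>) * complex_of_real (gauss s \<omega>)" for \<omega>
  have [measurable]: "k \<in> borel_measurable borel"
    unfolding k_def[abs_def] by measurable
  have "integrable lborel (\<lambda>\<omega>. complex_of_real (gauss s \<omega>) * cnj (fourier h \<omega>))"
    using integrable_gauss_complex[OF s] cmod_fourier_le[of h]
    by (intro integrable_bounded_mult[where B="\<integral>x. cmod (h x) \<partial>lborel"]) auto
  then have k: "integrable lborel k"
    unfolding k_def by (simp add: mult.commute)
  have kf: "fourier k x = cnj (\<integral>y. h y * complex_of_real (gauss_dual s (y - x)) \<partial>lborel)" for x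
  proof -
    have "fourier k x = cnj (\<integral>\<omega>. fourier h \<omega> * (complex_of_real (gauss s \<omega>) * cis (\<omega> \<bullet> x)) \<partial>lborel)"
      unfolding fourier_def[of k] k_def Bochner_Integration.integral_cnj[symmetric]
      by (intro Bochner_Integration.integral_cong) (auto simp: cis_cnj mult_ac)
    also have "(\<integral>\<omega>. fourier h \<omega> * (complex_of_real (gauss s \<omega>) * cis (\<omega> \<bullet> x)) \<partial>lborel)
      = (\<integral>y. h y * fourier (\<lambda>\<omega>. complex_of_real (gauss s \<omega>) * cis (\<omega> \<bullet> x)) y \<partial>lborel)"
      using integrable_gauss_complex[OF s]
      by (intro fourier_multiplication h integrable_bounded_mult[where B=1]) auto
    finally show ?thesis
      by (simp add: fourier_modulate fourier_gauss[OF s])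
  qed
  have fk: "fourier h \<omega> * k \<omega> = complex_of_real ((cmod (fourier h \<omega>))\<^sup>2 * gauss s \<omega>)" for \<omega>
    unfolding k_def of_real_mult complex_norm_square by (simp add: mult.assoc)
  have "(\<integral>\<omega>. fourier h \<omega> * k \<omega> \<partial>lborel) = complex_of_real (\<integral>\<omega>. (cmod (fourier h \<omega>))\<^sup>2 * gauss s \<omega> \<partial>lborel)"
    unfolding fk by (rule integral_complex_of_real)
  moreover have int: "integrable lborel (\<lambda>\<omega>. fourier h \<omega> * k \<omega>)"
    using integrable_bounded_mult[OF k, of "fourier h" "\<integral>x. cmod (h x) \<partial>lborel"] cmod_fourier_le[of h]
    by (simp add: mult.commute)
  moreover have "integrable lborel (\<lambda>\<omega>. (cmod (fourier h \<omega>))\<^sup>2 * gauss s \<omega>)"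
    using int by (simp only: fk complex_of_real_integrable_eq)
  ultimately have "(\<integral>\<^sup>+\<omega>. ennreal ((cmod (fourier h \<omega>))\<^sup>2 * gauss s \<omega>) \<partial>lborel)
      = ennreal (cmod (\<integral>\<omega>. fourier h \<omega> * k \<omega> \<partial>lborel))"
    by (subst nn_integral_eq_integral)
       (auto simp: gauss_pos less_imp_le abs_of_nonneg)
  also have "\<dots> = ennreal (cmod (\<integral>x. h x * fourier k x \<partial>lborel))"
    by (simp add: fourier_multiplication[OF h k])
  also have "\<dots> \<le> (\<integral>\<^sup>+x. ennreal (cmod (h x * fourier k x)) \<partial>lborel)"
    by (rule norm_integral_le_nn_integral)
  also have "\<dots> \<le> (\<integral>\<^sup>+x. (\<integral>\<^sup>+y. ennreal (((cmod (h x))\<^sup>2 / 2 + (cmod (h y))\<^sup>2 / 2) * gauss_dual s (y - x)) \<partial>lborel) \<partial>lborel)"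
  proof (rule nn_integral_mono)
    fix x
    have "ennreal (cmod (h x * fourier k x)) = ennreal (cmod (h x)) * ennreal (cmod (\<integral>y. h y * complex_of_real (gauss_dual s (y - x)) \<partial>lborel))"
      by (simp add: kf norm_mult ennreal_mult)
    also have "\<dots> \<le> ennreal (cmod (h x)) * (\<integral>\<^sup>+y. ennreal (cmod (h y * complex_of_real (gauss_dual s (y - x)))) \<partial>lborel)"
      by (intro mult_left_mono norm_integral_le_nn_integral) auto
    also have "\<dots> = (\<integral>\<^sup>+y. ennreal (cmod (h x)) * ennreal (cmod (h y * complex_of_real (gauss_dual s (y - x)))) \<partial>lborel)"
      by (rule nn_integral_cmult[symmetric]) measurable
    also have "\<dots> \<le> (\<integral>\<^sup>+y. ennreal (((cmod (h x))\<^sup>2 / 2 + (cmod (h y))\<^sup>2 / 2) * gauss_dual s (y - x)) \<partial>lborel)"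
    proof (rule nn_integral_mono)
      fix y
      have "cmod (h x) * cmod (h y) \<le> (cmod (h x))\<^sup>2 / 2 + (cmod (h y))\<^sup>2 / 2"
        using sum_squares_bound[of "cmod (h x)" "cmod (h y)"] by simp
      then show "ennreal (cmod (h x)) * ennreal (cmod (h y * complex_of_real (gauss_dual s (y - x))))
        \<le> ennreal (((cmod (h x))\<^sup>2 / 2 + (cmod (h y))\<^sup>2 / 2) * gauss_dual s (y - x))"
        using gauss_dual_pos[OF s, of "y - x"]
        by (subst ennreal_mult[symmetric]) (auto simp: norm_mult mult.assoc[symmetric] intro!: ennreal_leI mult_right_mono)
    qed
    finally show "ennreal (cmod (h x * fourier k x)) \<le>
      (\<integral>\<^sup>+y. ennreal (((cmod (h x))\<^sup>2 / 2 + (cmod (h y))\<^sup>2 / 2) * gauss_dual s (y - x)) \<partial>lborel)" .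
  qed
  also have "\<dots> = (\<integral>\<^sup>+x. (\<integral>\<^sup>+y. ennreal ((cmod (h x))\<^sup>2 / 2) * ennreal (gauss_dual s (y - x)) \<partial>lborel) \<partial>lborel)
      + (\<integral>\<^sup>+x. (\<integral>\<^sup>+y. ennreal ((cmod (h y))\<^sup>2 / 2) * ennreal (gauss_dual s (y - x)) \<partial>lborel) \<partial>lborel)"
    by (simp only: split) (subst nn_integral_add[symmetric], measurable, subst nn_integral_add[symmetric], measurable)
  also have "(\<integral>\<^sup>+x. (\<integral>\<^sup>+y. ennreal ((cmod (h x))\<^sup>2 / 2) * ennreal (gauss_dual s (y - x)) \<partial>lborel) \<partial>lborel)
    = (\<integral>\<^sup>+x. ennreal ((cmod (h x))\<^sup>2 / 2) * ?C \<partial>lborel)"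
    by (simp add: nn_integral_cmult nn_integral_lborel_shift(1)[where f="\<lambda>x. ennreal (gauss_dual s x)"] nn_integral_gauss_dual[OF s])
  also have "(\<integral>\<^sup>+x. (\<integral>\<^sup>+y. ennreal ((cmod (h y))\<^sup>2 / 2) * ennreal (gauss_dual s (y - x)) \<partial>lborel) \<partial>lborel)
    = (\<integral>\<^sup>+y. (\<integral>\<^sup>+x. ennreal ((cmod (h y))\<^sup>2 / 2) * ennreal (gauss_dual s (y - x)) \<partial>lborel) \<partial>lborel)"
    by (rule lborel_pair.Fubini') measurable
  also have "\<dots> = (\<integral>\<^sup>+y. ennreal ((cmod (h y))\<^sup>2 / 2) * ?C \<partial>lborel)"
    by (simp add: nn_integral_cmult nn_integral_lborel_shift(2)[where f="\<lambda>x. ennreal (gauss_dual s x)"] nn_integral_gauss_dual[OF s])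
  also have "(\<integral>\<^sup>+x. ennreal ((cmod (h x))\<^sup>2 / 2) * ?C \<partial>lborel) + (\<integral>\<^sup>+y. ennreal ((cmod (h y))\<^sup>2 / 2) * ?C \<partial>lborel)
    = (\<integral>\<^sup>+x. ?C * ennreal ((cmod (h x))\<^sup>2) \<partial>lborel)"
    by (subst nn_integral_add[symmetric])
       (auto intro!: nn_integral_cong simp: mult.commute simp flip: distrib_left ennreal_plus)
  also have "\<dots> = ?C * sq_norm h"
    unfolding sq_norm_def by (rule nn_integral_cmult) measurable
  finally show ?thesis .
qed

text \<open>
  Let the Gaussian of the preceding lemma widen to the constant \<open>1\<close> and apply Fatou.
\<close>

lemma sq_norm_fourier_le:
  fixes h :: "'a::euclidean_space \<Rightarrow> complex"
  assumes h: "integrable lborel h"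
  shows "sq_norm (fourier h) \<le> ennreal ((2 * pi) ^ DIM('a)) * sq_norm h"
proof -
  have [measurable]: "h \<in> borel_measurable borel"
    using h by auto
  let ?f = "\<lambda>n \<omega>. ennreal ((cmod (fourier h \<omega>))\<^sup>2 * gauss (1 / real (Suc n)) \<omega>)"
  have lim: "(\<lambda>n. ?f n \<omega>) \<longlonglongrightarrow> ennreal ((cmod (fourier h \<omega>))\<^sup>2)" for \<omega>
  proof -
    have "(\<lambda>n. (cmod (fourier h \<omega>))\<^sup>2 * exp (- (1 / real (Suc n) * norm \<omega>)\<^sup>2 / 2)) \<longlonglongrightarrow>
       (cmod (fourier h \<omega>))\<^sup>2 * exp (- (0 * norm \<omega>)\<^sup>2 / 2)"
      by (intro tendsto_intros LIMSEQ_Suc[OF lim_1_over_n]) auto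
    then show ?thesis
      by (intro tendsto_ennrealI) (simp add: gauss_def)
  qed
  have "sq_norm (fourier h) = (\<integral>\<^sup>+\<omega>. liminf (\<lambda>n. ?f n \<omega>) \<partial>lborel)"
    unfolding sq_norm_def by (intro nn_integral_cong lim_imp_Liminf[OF _ lim, symmetric]) simp
  also have "\<dots> \<le> liminf (\<lambda>n. \<integral>\<^sup>+\<omega>. ?f n \<omega> \<partial>lborel)"
    by (rule nn_integral_liminf) measurable
  also have "\<dots> \<le> ennreal ((2 * pi) ^ DIM('a)) * sq_norm h"
    by (intro Liminf_le always_eventually allI sq_norm_fourier_gauss_le h) auto
  finally show ?thesis .
qed

section \<open>Gaussian smoothing as an approximate identity\<close>

lemma gauss_dual_rescale:
  fixes z :: "'a::euclidean_space"
  assumes "s > 0"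
  shows "s ^ DIM('a) * gauss_dual s (s *\<^sub>R z) = gauss_dual 1 z"
  using assms by (simp add: gauss_dual_def gauss_def power_divide)

text \<open>
  After the substitution \<open>\<eta> = x - s n * z\<close> the kernel no longer depends on \<open>n\<close>, and dominated
  convergence applies.
\<close>

lemma gauss_dual_smoothing_tendsto:
  fixes \<psi> :: "'a::euclidean_space \<Rightarrow> complex"
  assumes cont: "continuous_on UNIV \<psi>" and bound: "\<And>x. cmod (\<psi> x) \<le> B"
    and s: "\<And>n. s n > 0" "s \<longlonglongrightarrow> 0"
  shows "(\<lambda>n. \<integral>\<eta>. \<psi> \<eta> * complex_of_real (gauss_dual (s n) (x - \<eta>)) \<partial>lborel)
    \<longlonglongrightarrow> \<psi> x * complex_of_real ((2 * pi) ^ DIM('a))"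
proof -
  have [measurable]: "\<psi> \<in> borel_measurable borel"
    using cont by (rule borel_measurable_continuous_onI)
  have eq: "(\<integral>\<eta>. \<psi> \<eta> * complex_of_real (gauss_dual t (x - \<eta>)) \<partial>lborel)
      = (\<integral>z. \<psi> (x - t *\<^sub>R z) * complex_of_real (gauss_dual 1 z) \<partial>lborel)" if "t > 0" for t
  proof -
    have "(\<integral>\<eta>. \<psi> \<eta> * complex_of_real (gauss_dual t (x - \<eta>)) \<partial>lborel)
      = t ^ DIM('a) *\<^sub>R (\<integral>z. \<psi> (x - t *\<^sub>R z) * complex_of_real (gauss_dual t (t *\<^sub>R z)) \<partial>lborel)"
      using that by (subst integral_lborel_affine[where c="- t" and t=x]) auto
    also have "\<dots> = (\<integral>z. \<psi> (x - t *\<^sub>R z) * complex_of_real (t ^ DIM('a) * gauss_dual t (t *\<^sub>R z)) \<partial>lborel)"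
      by (subst integral_scaleR_right[symmetric])
         (auto simp: scaleR_conv_of_real mult_ac intro!: Bochner_Integration.integral_cong)
    finally show ?thesis
      by (simp only: gauss_dual_rescale[OF that])
  qed
  have "(\<lambda>n. \<integral>z. \<psi> (x - s n *\<^sub>R z) * complex_of_real (gauss_dual 1 z) \<partial>lborel)
      \<longlonglongrightarrow> (\<integral>z. \<psi> x * complex_of_real (gauss_dual 1 z) \<partial>(lborel :: 'a measure))"
  proof (rule integral_dominated_convergence)
    show "integrable lborel (\<lambda>z::'a. B * gauss_dual 1 z)"
      by (intro integrable_mult_right gauss_dual_integrable) auto
    show "AE z in lborel. (\<lambda>n. \<psi> (x - s n *\<^sub>R z) * complex_of_real (gauss_dual 1 z))
        \<longlonglongrightarrow> \<psi> x * complex_of_real (gauss_dual 1 z)"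
    proof (intro AE_I2 tendsto_mult_right)
      fix z :: 'a
      have "(\<lambda>n. x - s n *\<^sub>R z) \<longlonglongrightarrow> x - 0 *\<^sub>R z"
        by (intro tendsto_intros s)
      moreover have "isCont \<psi> x"
        using cont by (simp add: continuous_on_eq_continuous_at)
      ultimately show "(\<lambda>n. \<psi> (x - s n *\<^sub>R z)) \<longlonglongrightarrow> \<psi> x"
        by (auto intro: isCont_tendsto_compose)
    qed
    show "AE z in lborel. cmod (\<psi> (x - s n *\<^sub>R z) * complex_of_real (gauss_dual 1 z)) \<le> B * gauss_dual 1 z" for n
      using bound by (intro AE_I2) (auto simp: norm_mult intro!: mult_right_mono)
  qed measurable
  also have "(\<integral>z. \<psi> x * complex_of_real (gauss_dual 1 z) \<partial>(lborel :: 'a measure)) = \<psi> x * complex_of_real ((2 * pi) ^ DIM('a))"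
    by (subst integral_mult_right_zero, subst integral_complex_of_real) (simp add: gauss_dual_integral)
  finally show ?thesis
    using s by (simp add: eq)
qed

text \<open>
  Smoothing is moved from \<open>H\<close> to the test function by Fubini; as the width shrinks, the smoothed
  test function returns to a multiple of \<open>\<psi>\<close>.
\<close>

lemma smoothing_bound_imp_test_bound:
  fixes H \<psi> :: "'a::euclidean_space \<Rightarrow> complex"
  assumes H: "integrable lborel H"
    and le: "\<And>s \<eta>. s > 0 \<Longrightarrow> cmod (\<integral>x. H x * complex_of_real (gauss_dual s (x - \<eta>)) \<partial>lborel) \<le> M * (2 * pi) ^ DIM('a)"
    and cont: "continuous_on UNIV \<psi>" and bound: "\<And>x. cmod (\<psi> x) \<le> B" and \<psi>: "integrable lborel \<psi>"
  shows "cmod (\<integral>x. H x * \<psi> x \<partial>lborel) \<le> M * (\<integral>x. cmod (\<psi> x) \<partial>lborel)"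
proof -
  let ?C = "(2 * pi) ^ DIM('a)"
  have [measurable]: "H \<in> borel_measurable borel" "\<psi> \<in> borel_measurable borel"
    using H \<psi> by auto
  define s :: "nat \<Rightarrow> real" where "s n = 1 / real (Suc n)" for n
  have s: "\<And>n. s n > 0" "s \<longlonglongrightarrow> 0"
    unfolding s_def using LIMSEQ_Suc[OF lim_1_over_n] by auto
  have B: "0 \<le> B"
    using bound[of 0] norm_ge_zero order_trans by blast
  define S where "S n x = (\<integral>\<eta>. \<psi> \<eta> * complex_of_real (gauss_dual (s n) (x - \<eta>)) \<partial>lborel)" for n x
  have [measurable]: "S n \<in> borel_measurable borel" for n
    unfolding S_def[abs_def] by measurable
  have S_le: "cmod (S n x) \<le> B * ?C" for n x
  proof -
    have "ennreal (cmod (S n x)) \<le> (\<integral>\<^sup>+\<eta>. ennreal (cmod (\<psi> \<eta> * complex_of_real (gauss_dual (s n) (x - \<eta>)))) \<partial>lborel)"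
      unfolding S_def by (rule norm_integral_le_nn_integral)
    also have "\<dots> \<le> (\<integral>\<^sup>+\<eta>. ennreal B * ennreal (gauss_dual (s n) (x - \<eta>)) \<partial>lborel)"
      using s(1) bound B
      by (intro nn_integral_mono)
         (auto simp: norm_mult ennreal_mult[symmetric] intro!: ennreal_leI mult_right_mono)
    also have "\<dots> = ennreal (B * ?C)"
      using B by (simp add: nn_integral_cmult nn_integral_lborel_shift(2)[where f="\<lambda>x. ennreal (gauss_dual (s n) x)"]
          nn_integral_gauss_dual[OF s(1)] ennreal_mult)
    finally show ?thesis
      using B by (simp add: ennreal_le_iff)
  qed
  have lim: "(\<lambda>n. \<integral>x. H x * S n x \<partial>lborel) \<longlonglongrightarrow> (\<integral>x. H x * (\<psi> x * complex_of_real ?C) \<partial>lborel)"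
  proof (rule integral_dominated_convergence)
    show "integrable lborel (\<lambda>x. cmod (H x) * (B * ?C))"
      using H by (intro integrable_mult_left integrable_norm)
    show "AE x in lborel. (\<lambda>n. H x * S n x) \<longlonglongrightarrow> H x * (\<psi> x * complex_of_real ?C)"
      unfolding S_def by (intro AE_I2 tendsto_mult_left gauss_dual_smoothing_tendsto[OF cont bound s])
    show "AE x in lborel. norm (H x * S n x) \<le> cmod (H x) * (B * ?C)" for n
      unfolding norm_mult by (intro AE_I2 mult_left_mono S_le) auto
  qed measurable
  have "cmod (\<integral>x. H x * S n x \<partial>lborel) \<le> M * ?C * (\<integral>x. cmod (\<psi> x) \<partial>lborel)" for n
  proof -
    have gd_le: "gauss_dual (s n) z \<le> (sqrt (2 * pi) / s n) ^ DIM('a)" for z :: 'a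
      using s(1) by (rule gauss_dual_le)
    have "integrable (lborel \<Otimes>\<^sub>M lborel) (\<lambda>(x, \<eta>). H x * (\<psi> \<eta> * complex_of_real (gauss_dual (s n) (x - \<eta>))))"
    proof (rule lborel_pair.Fubini_integrable)
      have int: "integrable lborel (\<lambda>\<eta>. \<psi> \<eta> * complex_of_real (gauss_dual (s n) (x - \<eta>)))" for x
        using s(1) gd_le
        by (intro integrable_bounded_mult[OF \<psi>, where B="(sqrt (2 * pi) / s n) ^ DIM('a)"]) auto
      then show "AE x in lborel. integrable lborel (\<lambda>\<eta>. case (x, \<eta>) of (x, \<eta>) \<Rightarrow> H x * (\<psi> \<eta> * complex_of_real (gauss_dual (s n) (x - \<eta>))))"
        by (intro AE_I2) auto
      have "integrable lborel (\<lambda>x. cmod (H x) * (\<integral>\<eta>. cmod (\<psi> \<eta>) * gauss_dual (s n) (x - \<eta>) \<partial>lborel))"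
      proof (rule Bochner_Integration.integrable_bound)
        show "integrable lborel (\<lambda>x. cmod (H x) * ((sqrt (2 * pi) / s n) ^ DIM('a) * (\<integral>\<eta>. cmod (\<psi> \<eta>) \<partial>lborel)))"
          using H by (intro integrable_mult_left integrable_norm)
        show "AE x in lborel. norm (cmod (H x) * (\<integral>\<eta>. cmod (\<psi> \<eta>) * gauss_dual (s n) (x - \<eta>) \<partial>lborel))
          \<le> norm (cmod (H x) * ((sqrt (2 * pi) / s n) ^ DIM('a) * (\<integral>\<eta>. cmod (\<psi> \<eta>) \<partial>lborel)))"
        proof (intro AE_I2)
          fix x
          have "(\<integral>\<eta>. cmod (\<psi> \<eta>) * gauss_dual (s n) (x - \<eta>) \<partial>lborel)
            \<le> (\<integral>\<eta>. (sqrt (2 * pi) / s n) ^ DIM('a) * cmod (\<psi> \<eta>) \<partial>lborel)"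
            using int[of x, THEN integrable_norm] \<psi> gd_le s(1)[of n]
            by (intro integral_mono)
               (auto simp: norm_mult mult.commute[of "cmod _"] intro!: mult_right_mono)
          moreover have "0 \<le> (\<integral>\<eta>. cmod (\<psi> \<eta>) * gauss_dual (s n) (x - \<eta>) \<partial>lborel)"
            using s(1)[of n] by (intro Bochner_Integration.integral_nonneg) auto
          ultimately show "norm (cmod (H x) * (\<integral>\<eta>. cmod (\<psi> \<eta>) * gauss_dual (s n) (x - \<eta>) \<partial>lborel))
          \<le> norm (cmod (H x) * ((sqrt (2 * pi) / s n) ^ DIM('a) * (\<integral>\<eta>. cmod (\<psi> \<eta>) \<partial>lborel)))"
            using s(1)[of n] by (simp add: abs_mult mult_left_mono)
        qed
      qed measurable
      then show "integrable lborel (\<lambda>x. \<integral>\<eta>. norm (case (x, \<eta>) of (x, \<eta>) \<Rightarrow> H x * (\<psi> \<eta> * complex_of_real (gauss_dual (s n) (x - \<eta>)))) \<partial>lborel)"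
        using s(1)[of n] by (simp add: norm_mult)
    qed measurable
    then have "(\<integral>\<eta>. (\<integral>x. H x * (\<psi> \<eta> * complex_of_real (gauss_dual (s n) (x - \<eta>))) \<partial>lborel) \<partial>lborel)
       = (\<integral>x. (\<integral>\<eta>. H x * (\<psi> \<eta> * complex_of_real (gauss_dual (s n) (x - \<eta>))) \<partial>lborel) \<partial>lborel)"
      by (rule lborel_pair.Fubini_integral)
    then have "(\<integral>x. H x * S n x \<partial>lborel)
       = (\<integral>\<eta>. \<psi> \<eta> * (\<integral>x. H x * complex_of_real (gauss_dual (s n) (x - \<eta>)) \<partial>lborel) \<partial>lborel)"
      unfolding S_def by (simp add: mult.left_commute[of "H _"] flip: integral_mult_right_zero)
    also have "cmod \<dots> \<le> (\<integral>\<eta>. cmod (\<psi> \<eta> * (\<integral>x. H x * complex_of_real (gauss_dual (s n) (x - \<eta>)) \<partial>lborel)) \<partial>lborel)"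
      by (rule integral_norm_bound)
    also have "\<dots> \<le> (\<integral>\<eta>. M * ?C * cmod (\<psi> \<eta>) \<partial>lborel)"
    proof (intro integral_mono)
      show "integrable lborel (\<lambda>\<eta>. cmod (\<psi> \<eta> * (\<integral>x. H x * complex_of_real (gauss_dual (s n) (x - \<eta>)) \<partial>lborel)))"
        using le[OF s(1)[of n]] by (intro integrable_norm integrable_bounded_mult[OF \<psi>]) auto
      show "integrable lborel (\<lambda>\<eta>. M * ?C * cmod (\<psi> \<eta>))"
        using \<psi> by auto
      show "cmod (\<psi> \<eta> * (\<integral>x. H x * complex_of_real (gauss_dual (s n) (x - \<eta>)) \<partial>lborel)) \<le> M * ?C * cmod (\<psi> \<eta>)" for \<eta>
        using mult_right_mono[OF le[OF s(1)[of n], of \<eta>], of "cmod (\<psi> \<eta>)"] by (simp add: norm_mult mult.commute)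
    qed
    finally show ?thesis by simp
  qed
  then have "cmod (\<integral>x. H x * (\<psi> x * complex_of_real ?C) \<partial>lborel) \<le> M * ?C * (\<integral>x. cmod (\<psi> x) \<partial>lborel)"
    by (intro tendsto_upperbound[OF tendsto_norm[OF lim]]) auto
  moreover have "(\<integral>x. H x * (\<psi> x * complex_of_real ?C) \<partial>lborel) = (\<integral>x. H x * \<psi> x \<partial>lborel) * complex_of_real ?C"
    unfolding mult.assoc[symmetric] by (rule integral_mult_left_zero)
  moreover have "?C > 0" by simp
  ultimately show ?thesis
    by (simp add: norm_mult mult.commute mult.left_commute[of M] norm_power del: of_real_power of_real_mult)
qed

text \<open>
  An approximate identity detects essential suprema.  This avoids differentiation of integrals:
  where \<open>|H| > M\<close>, test against the phase of \<open>cnj H\<close>.  That phase is measurable only, but it is an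
  almost everywhere limit of continuous functions, which can be clamped to the unit disc and damped
  by a Gaussian without losing continuity.
\<close>

lemma smoothing_bound_imp_AE_bound:
  fixes H :: "'a::euclidean_space \<Rightarrow> complex"
  assumes H: "integrable lborel H"
    and le: "\<And>s \<eta>. s > 0 \<Longrightarrow> cmod (\<integral>x. H x * complex_of_real (gauss_dual s (x - \<eta>)) \<partial>lborel) \<le> M * (2 * pi) ^ DIM('a)"
  shows "AE x in lborel. cmod (H x) \<le> M"
proof -
  have [measurable]: "H \<in> borel_measurable borel"
    using H by auto
  have "0 \<le> M * (2 * pi) ^ DIM('a)"
    using le[of 1 0] norm_ge_zero order_trans zero_less_one by blast
  then have M: "0 \<le> M"
    using zero_less_power[of "2 * pi" "DIM('a)"] by (meson mult_neg_pos not_le pi_gt_zero zero_less_mult_iff zero_less_numeral)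
  define \<psi>0 where "\<psi>0 x = (if cmod (H x) > M then sgn (cnj (H x)) else 0)" for x
  have [measurable]: "\<psi>0 \<in> borel_measurable borel"
    unfolding \<psi>0_def[abs_def] sgn_div_norm by measurable
  have "\<psi>0 \<in> borel_measurable lebesgue"
    by (rule measurable_completion) measurable
  then have "\<psi>0 measurable_on UNIV"
    by (intro lebesgue_measurable_imp_measurable_on) auto
  then obtain N g where N: "negligible N" and cont: "\<And>n. continuous_on UNIV (g n)"
    and lim: "\<And>x. x \<notin> N \<Longrightarrow> (\<lambda>n. g n x) \<longlonglongrightarrow> \<psi>0 x"
    unfolding measurable_on_def by auto
  have AE_N: "AE x in lborel. x \<notin> N"
    using AE_not_in[of N lebesgue] N by (simp add: negligible_iff_null_sets AE_completion_iff)
  \<comment> \<open>The radial retraction onto the closed unit disc.\<close>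
  define clamp :: "complex \<Rightarrow> complex" where "clamp z = z / complex_of_real (max 1 (cmod z))" for z
  have clamp_cont: "continuous_on UNIV clamp"
    unfolding clamp_def[abs_def] by (intro continuous_intros) auto
  have clamp_le: "cmod (clamp z) \<le> 1" for z
    by (auto simp: clamp_def norm_divide divide_le_eq_1 max_def)
  have clamp_id: "clamp z = z" if "cmod z \<le> 1" for z
    using that unfolding clamp_def by (simp add: max_absorb1)
  define \<psi> where "\<psi> n x = clamp (g n x) * complex_of_real (gauss 1 x)" for n x
  have \<psi>_cont: "continuous_on UNIV (\<psi> n)" for n
    unfolding \<psi>_def gauss_def
    by (intro continuous_intros continuous_on_compose2[OF clamp_cont] cont) auto
  have [measurable]: "\<psi> n \<in> borel_measurable borel" for n
    using \<psi>_cont by (rule borel_measurable_continuous_onI)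
  have \<psi>_le: "cmod (\<psi> n x) \<le> gauss 1 x" for n x
    using mult_right_mono[OF clamp_le, of "gauss 1 x" "g n x"]
    by (simp add: \<psi>_def norm_mult)
  have \<psi>_le_1: "cmod (\<psi> n x) \<le> 1" for n x
    by (rule order_trans[OF \<psi>_le gauss_le_1])
  have \<psi>_int: "integrable lborel (\<psi> n)" for n
    by (rule Bochner_Integration.integrable_bound[OF gauss_integrable[of 1]])
       (use \<psi>_le order_trans[OF _ abs_ge_self] in auto)
  have test: "cmod (\<integral>x. H x * \<psi> n x \<partial>lborel) \<le> M * (\<integral>x. cmod (\<psi> n x) \<partial>lborel)" for n
    by (rule smoothing_bound_imp_test_bound[OF H le \<psi>_cont _ \<psi>_int, where B=1])
       (auto intro: \<psi>_le_1)
  define \<phi> where "\<phi> x = \<psi>0 x * complex_of_real (gauss 1 x)" for x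
  have \<psi>_lim: "(\<lambda>n. \<psi> n x) \<longlonglongrightarrow> \<phi> x" if "x \<notin> N" for x
  proof -
    have "isCont clamp (\<psi>0 x)"
      using clamp_cont by (simp add: continuous_on_eq_continuous_at)
    then have "(\<lambda>n. clamp (g n x)) \<longlonglongrightarrow> clamp (\<psi>0 x)"
      using lim[OF that] by (rule isCont_tendsto_compose)
    moreover have "clamp (\<psi>0 x) = \<psi>0 x"
      by (rule clamp_id) (simp add: \<psi>0_def norm_sgn)
    ultimately show ?thesis
      unfolding \<psi>_def \<phi>_def by (intro tendsto_mult_right) simp
  qed
  have [measurable]: "\<phi> \<in> borel_measurable borel"
    unfolding \<phi>_def[abs_def] by measurable
  have "(\<lambda>n. \<integral>x. H x * \<psi> n x \<partial>lborel) \<longlonglongrightarrow> (\<integral>x. H x * \<phi> x \<partial>lborel)"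
  proof (rule integral_dominated_convergence[where w="\<lambda>x. cmod (H x)"])
    show "AE x in lborel. (\<lambda>n. H x * \<psi> n x) \<longlonglongrightarrow> H x * \<phi> x"
      using AE_N by eventually_elim (intro tendsto_mult_left \<psi>_lim)
    show "AE x in lborel. norm (H x * \<psi> n x) \<le> cmod (H x)" for n
      using \<psi>_le_1 by (intro AE_I2) (auto simp: norm_mult intro!: mult_left_le)
  qed (use H in auto)
  moreover have "(\<lambda>n. \<integral>x. cmod (\<psi> n x) \<partial>lborel) \<longlonglongrightarrow> (\<integral>x. cmod (\<phi> x) \<partial>lborel)"
  proof (rule integral_dominated_convergence[where w="gauss 1"])
    show "AE x in lborel. (\<lambda>n. cmod (\<psi> n x)) \<longlonglongrightarrow> cmod (\<phi> x)"
      using AE_N by eventually_elim (intro tendsto_norm \<psi>_lim)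
  qed (use gauss_integrable[of 1] \<psi>_le in auto)
  ultimately have "cmod (\<integral>x. H x * \<phi> x \<partial>lborel) \<le> M * (\<integral>x. cmod (\<phi> x) \<partial>lborel)"
    using test by (intro tendsto_le[OF _ tendsto_mult_left tendsto_norm]) (auto intro: always_eventually)
  also have "(\<integral>x. H x * \<phi> x \<partial>lborel) = complex_of_real (\<integral>x. (if cmod (H x) > M then cmod (H x) * gauss 1 x else 0) \<partial>lborel)"
    unfolding integral_complex_of_real[symmetric]
  proof (intro Bochner_Integration.integral_cong refl)
    fix x
    have "H x * sgn (cnj (H x)) = complex_of_real (cmod (H x))"
      by (cases "H x = 0") (simp_all add: sgn_eq complex_norm_square[symmetric] power2_eq_square)
    then show "H x * \<phi> x = complex_of_real (if cmod (H x) > M then cmod (H x) * gauss 1 x else 0)"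
      by (simp add: \<phi>_def \<psi>0_def mult.assoc[symmetric])
  qed
  also have "(\<integral>x. cmod (\<phi> x) \<partial>lborel) = (\<integral>x. (if cmod (H x) > M then gauss 1 x else 0) \<partial>lborel)"
    using M by (intro Bochner_Integration.integral_cong) (auto simp: \<phi>_def \<psi>0_def norm_mult norm_sgn gauss_pos abs_of_pos)
  finally have le: "(\<integral>x. (if cmod (H x) > M then cmod (H x) * gauss 1 x else 0) \<partial>lborel)
    \<le> (\<integral>x. M * (if cmod (H x) > M then gauss 1 x else 0) \<partial>lborel)"
    by simp
  have int1: "integrable lborel (\<lambda>x. if cmod (H x) > M then cmod (H x) * gauss 1 x else 0)"
    by (rule Bochner_Integration.integrable_bound[OF integrable_norm[OF H]])
       (auto simp: abs_mult gauss_le_1 intro!: AE_I2 mult_left_le)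
  have int2: "integrable lborel (\<lambda>x. M * (if cmod (H x) > M then gauss 1 x else 0))"
    by (rule integrable_mult_right, rule Bochner_Integration.integrable_bound[OF gauss_integrable[of 1]]) auto
  let ?d = "\<lambda>x. (if cmod (H x) > M then cmod (H x) * gauss 1 x else 0) - M * (if cmod (H x) > M then gauss 1 x else 0)"
  have nonneg: "0 \<le> ?d x" for x
    using mult_right_mono[of M "cmod (H x)" "gauss 1 x"] gauss_pos[of 1 x] by auto
  have "(\<integral>x. ?d x \<partial>lborel) \<le> 0"
    using le by (subst Bochner_Integration.integral_diff[OF int1 int2]) simp
  moreover have "(\<integral>x. ?d x \<partial>lborel) \<ge> 0"
    using nonneg by (intro Bochner_Integration.integral_nonneg)
  ultimately have "(\<integral>x. ?d x \<partial>lborel) = 0"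
    by simp
  then have "AE x in lborel. ?d x = 0"
    using nonneg by (subst (asm) integral_nonneg_eq_0_iff_AE[OF Bochner_Integration.integrable_diff[OF int1 int2]]) auto
  then show ?thesis
  proof eventually_elim
    case (elim x)
    then show ?case
      using gauss_pos[of 1 x] by (auto split: if_splits)
  qed
qed

section \<open>The Fourier transform on square integrable functions\<close>

definition sq_integrable :: "('a::euclidean_space \<Rightarrow> complex) \<Rightarrow> bool" where
  "sq_integrable f \<longleftrightarrow> f \<in> borel_measurable borel \<and> sq_norm f < \<infinity>"

definition l2norm :: "('a::euclidean_space \<Rightarrow> complex) \<Rightarrow> real" where
  "l2norm f = sqrt (enn2real (sq_norm f))"

text \<open>
  The extension by density, as a relation: \<open>G\<close> is determined by \<open>F\<close> only almost everywhere.
  The approximating sequence is part of the definition because the properties below are transferred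
  along it.
\<close>

definition l2_fourier :: "('a::euclidean_space \<Rightarrow> complex) \<Rightarrow> ('a \<Rightarrow> complex) \<Rightarrow> bool" where
  "l2_fourier F G \<longleftrightarrow> sq_integrable F \<and> sq_integrable G \<and>
    (\<exists>h. (\<forall>n::nat. integrable lborel (h n) \<and> sq_integrable (h n)) \<and>
      (\<lambda>n. sq_norm (\<lambda>x. h n x - F x)) \<longlonglongrightarrow> 0 \<and>
      (\<lambda>n. sq_norm (\<lambda>\<omega>. fourier (h n) \<omega> - G \<omega>)) \<longlonglongrightarrow> 0)"

lemma sq_norm_diff_le:
  assumes [measurable]: "f \<in> borel_measurable borel" "g \<in> borel_measurable borel"
  shows "sq_norm (\<lambda>x. f x - g x) \<le> 2 * sq_norm f + 2 * sq_norm g"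
proof -
  have "(cmod (f x - g x))\<^sup>2 \<le> 2 * (cmod (f x))\<^sup>2 + 2 * (cmod (g x))\<^sup>2" for x
  proof -
    have "(cmod (f x - g x))\<^sup>2 \<le> (cmod (f x) + cmod (g x))\<^sup>2"
      by (intro power_mono norm_triangle_ineq4) simp
    also have "\<dots> \<le> 2 * (cmod (f x))\<^sup>2 + 2 * (cmod (g x))\<^sup>2"
      using sum_squares_bound[of "cmod (f x)" "cmod (g x)"] by (simp add: power2_sum)
    finally show ?thesis .
  qed
  then have "ennreal ((cmod (f x - g x))\<^sup>2) \<le> 2 * ennreal ((cmod (f x))\<^sup>2) + 2 * ennreal ((cmod (g x))\<^sup>2)" for x
    using ennreal_leI[of "(cmod (f x - g x))\<^sup>2" "2 * (cmod (f x))\<^sup>2 + 2 * (cmod (g x))\<^sup>2"]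
    by (simp add: ennreal_mult)
  then have "sq_norm (\<lambda>x. f x - g x) \<le> (\<integral>\<^sup>+x. 2 * ennreal ((cmod (f x))\<^sup>2) + 2 * ennreal ((cmod (g x))\<^sup>2) \<partial>lborel)"
    unfolding sq_norm_def by (intro nn_integral_mono)
  also have "\<dots> = 2 * sq_norm f + 2 * sq_norm g"
    unfolding sq_norm_def by (subst nn_integral_add) (auto simp: nn_integral_cmult)
  finally show ?thesis .
qed

lemma sq_integrable_diff:
  assumes "sq_integrable f" "sq_integrable g"
  shows "sq_integrable (\<lambda>x. f x - g x)"
proof -
  have "2 * sq_norm f + 2 * sq_norm g < \<infinity>"
    using assms by (auto simp: sq_integrable_def ennreal_mult_less_top)
  then show ?thesis
    using assms le_less_trans[OF sq_norm_diff_le[of f g]] by (auto simp: sq_integrable_def)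
qed

lemma sq_norm_eq_l2norm: "sq_integrable f \<Longrightarrow> sq_norm f = ennreal ((l2norm f)\<^sup>2)"
  by (simp add: sq_integrable_def l2norm_def)

lemma l2norm_nonneg: "0 \<le> l2norm f"
  by (simp add: l2norm_def)

lemma l2norm_tendsto_0:
  assumes "(\<lambda>n. sq_norm (f n)) \<longlonglongrightarrow> 0"
  shows "(\<lambda>n. l2norm (f n)) \<longlonglongrightarrow> 0"
proof -
  have "(\<lambda>n. enn2real (sq_norm (f n))) \<longlonglongrightarrow> 0"
    using assms by (intro tendsto_enn2real) simp_all
  then show ?thesis
    unfolding l2norm_def using tendsto_real_sqrt by fastforce
qed

lemma ennreal_power2_le_imp_le:
  assumes "x\<^sup>2 \<le> (ennreal r)\<^sup>2"
  shows "x \<le> ennreal r"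
proof (cases x)
  case top
  then show ?thesis
    using assms by (auto simp: power2_eq_square top_unique ennreal_mult_eq_top_iff)
next
  case (real p)
  have "(ennreal r)\<^sup>2 = ennreal ((max 0 r)\<^sup>2)"
    by (cases "0 \<le> r") (auto simp: ennreal_power ennreal_neg)
  with assms real have "p\<^sup>2 \<le> (max 0 r)\<^sup>2"
    by (simp add: ennreal_power)
  then have "p \<le> max 0 r"
    by (rule power2_le_imp_le) simp
  then show ?thesis
    using real by (auto simp: max_def ennreal_leI split: if_splits)
qed

lemma Cauchy_Schwarz_l2norm:
  assumes f: "sq_integrable f" and g: "sq_integrable g"
  shows "(\<integral>\<^sup>+x. ennreal (cmod (f x * g x)) \<partial>lborel) \<le> ennreal (l2norm f * l2norm g)"
proof -
  have [measurable]: "f \<in> borel_measurable borel" "g \<in> borel_measurable borel"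
    using f g by (auto simp: sq_integrable_def)
  have "(\<integral>\<^sup>+x. ennreal (cmod (f x)) * ennreal (cmod (g x)) \<partial>lborel)\<^sup>2 \<le> sq_norm f * sq_norm g"
    using Cauchy_Schwarz_nn_integral[of "\<lambda>x. ennreal (cmod (f x))" lborel "\<lambda>x. ennreal (cmod (g x))"]
    by (simp add: sq_norm_def ennreal_power)
  also have "\<dots> = (ennreal (l2norm f * l2norm g))\<^sup>2"
    by (simp add: sq_norm_eq_l2norm[OF f] sq_norm_eq_l2norm[OF g] ennreal_power ennreal_mult power_mult_distrib
        l2norm_nonneg)
  finally have "(\<integral>\<^sup>+x. ennreal (cmod (f x)) * ennreal (cmod (g x)) \<partial>lborel) \<le> ennreal (l2norm f * l2norm g)"
    by (rule ennreal_power2_le_imp_le)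
  then show ?thesis
    by (simp add: norm_mult ennreal_mult)
qed

lemma integrable_mult_sq_integrable:
  assumes f: "sq_integrable f" and g: "sq_integrable g"
  shows "integrable lborel (\<lambda>x. f x * g x)"
  using f g le_less_trans[OF Cauchy_Schwarz_l2norm[OF f g]]
  by (intro integrableI_bounded) (auto simp: sq_integrable_def)

text \<open>
  Splitting \<open>f' g' - f g\<close> as \<open>(f' - f)(g' - g) + (f' - f) g + f (g' - g)\<close> makes products of
  \<open>L\<^sup>2\<close>-convergent sequences converge in \<open>L\<^sup>1\<close>, with a bound that is invariant under translating
  and reflecting the second factor.
\<close>

lemma mult_diff_l2norm_le:
  assumes f: "sq_integrable f" "sq_integrable f'" and g: "sq_integrable g" "sq_integrable g'"
  shows "(\<integral>\<^sup>+x. ennreal (cmod (f' x * g' x - f x * g x)) \<partial>lborel)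
    \<le> ennreal (l2norm (\<lambda>x. f' x - f x) * l2norm (\<lambda>x. g' x - g x) + l2norm (\<lambda>x. f' x - f x) * l2norm g
        + l2norm f * l2norm (\<lambda>x. g' x - g x))"
proof -
  have [measurable]: "f \<in> borel_measurable borel" "g \<in> borel_measurable borel"
    "f' \<in> borel_measurable borel" "g' \<in> borel_measurable borel"
    using f g by (auto simp: sq_integrable_def)
  let ?a = "\<lambda>x. f' x - f x" and ?b = "\<lambda>x. g' x - g x"
  have ab: "sq_integrable ?a" "sq_integrable ?b"
    using f g by (auto intro: sq_integrable_diff)
  have "cmod (f' x * g' x - f x * g x) \<le> cmod (?a x * ?b x) + cmod (?a x * g x) + cmod (f x * ?b x)" for x
  proof -
    have "f' x * g' x - f x * g x = ?a x * ?b x + ?a x * g x + f x * ?b x"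
      by (simp add: algebra_simps)
    then show ?thesis
      by (metis add_right_mono norm_triangle_ineq order_trans)
  qed
  then have "(\<integral>\<^sup>+x. ennreal (cmod (f' x * g' x - f x * g x)) \<partial>lborel)
    \<le> (\<integral>\<^sup>+x. ennreal (cmod (?a x * ?b x)) + ennreal (cmod (?a x * g x)) + ennreal (cmod (f x * ?b x)) \<partial>lborel)"
    by (intro nn_integral_mono) (simp flip: ennreal_plus)
  also have "\<dots> = (\<integral>\<^sup>+x. ennreal (cmod (?a x * ?b x)) \<partial>lborel) + (\<integral>\<^sup>+x. ennreal (cmod (?a x * g x)) \<partial>lborel)
     + (\<integral>\<^sup>+x. ennreal (cmod (f x * ?b x)) \<partial>lborel)"
    by (subst nn_integral_add, measurable, subst nn_integral_add, measurable)
  also have "\<dots> \<le> ennreal (l2norm ?a * l2norm ?b) + ennreal (l2norm ?a * l2norm g) + ennreal (l2norm f * l2norm ?b)"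
    by (intro add_mono Cauchy_Schwarz_l2norm ab f g)
  finally show ?thesis
    by (simp add: l2norm_nonneg)
qed

lemma pairing_tendsto:
  assumes f: "sq_integrable f" "\<And>n. sq_integrable (f' n)" and g: "sq_integrable g" "\<And>n. sq_integrable (g' n)"
    and lim: "(\<lambda>n. sq_norm (\<lambda>x. f' n x - f x)) \<longlonglongrightarrow> 0" "(\<lambda>n. sq_norm (\<lambda>x. g' n x - g x)) \<longlonglongrightarrow> 0"
    and k: "k \<in> borel_measurable borel" "\<And>x. cmod (k x) \<le> B"
  shows "(\<lambda>n. \<integral>x. f' n x * g' n x * k x \<partial>lborel) \<longlonglongrightarrow> (\<integral>x. f x * g x * k x \<partial>lborel)"
proof -
  let ?e = "\<lambda>n. l2norm (\<lambda>x. f' n x - f x) * l2norm (\<lambda>x. g' n x - g x) + l2norm (\<lambda>x. f' n x - f x) * l2norm g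
        + l2norm f * l2norm (\<lambda>x. g' n x - g x)"
  have "?e \<longlonglongrightarrow> 0 * 0 + 0 * l2norm g + l2norm f * 0"
    by (intro tendsto_intros l2norm_tendsto_0 lim)
  then have e: "(\<lambda>n. B * ?e n) \<longlonglongrightarrow> 0"
    by (auto intro: tendsto_mult_right_zero)
  have e_nonneg: "0 \<le> ?e n" for n
    by (simp add: l2norm_nonneg)
  have B: "0 \<le> B" using k(2)[of 0] norm_ge_zero order_trans by blast
  have int: "integrable lborel (\<lambda>x. f x * g x * k x)" "integrable lborel (\<lambda>x. f' n x * g' n x * k x)" for n
    using f g k by (auto intro!: integrable_bounded_mult[OF integrable_mult_sq_integrable, where B=B])
  have "norm ((\<integral>x. f' n x * g' n x * k x \<partial>lborel) - (\<integral>x. f x * g x * k x \<partial>lborel)) \<le> B * ?e n" for n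
  proof -
    have [measurable]: "f \<in> borel_measurable borel" "g \<in> borel_measurable borel"
      "f' n \<in> borel_measurable borel" "g' n \<in> borel_measurable borel"
      using f g by (auto simp: sq_integrable_def)
    have "ennreal (norm ((\<integral>x. f' n x * g' n x * k x \<partial>lborel) - (\<integral>x. f x * g x * k x \<partial>lborel)))
      = ennreal (norm (\<integral>x. (f' n x * g' n x - f x * g x) * k x \<partial>lborel))"
      by (simp add: left_diff_distrib int)
    also have "\<dots> \<le> (\<integral>\<^sup>+x. ennreal (norm ((f' n x * g' n x - f x * g x) * k x)) \<partial>lborel)"
      by (rule norm_integral_le_nn_integral)
    also have "\<dots> \<le> (\<integral>\<^sup>+x. ennreal B * ennreal (cmod (f' n x * g' n x - f x * g x)) \<partial>lborel)"
    proof (intro nn_integral_mono)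
      fix x
      let ?u = "f' n x * g' n x - f x * g x"
      have "cmod (?u * k x) \<le> B * cmod ?u"
        using mult_left_mono[OF k(2)[of x], of "cmod ?u"] by (simp only: norm_mult mult.commute[of B]) simp
      then have "ennreal (cmod (?u * k x)) \<le> ennreal (B * cmod ?u)"
        by (rule ennreal_leI)
      then show "ennreal (cmod (?u * k x)) \<le> ennreal B * ennreal (cmod ?u)"
        using B by (simp only: ennreal_mult norm_ge_zero)
    qed
    also have "\<dots> \<le> ennreal B * ennreal (?e n)"
      by (subst nn_integral_cmult) (auto intro!: mult_left_mono mult_diff_l2norm_le f g)
    also have "\<dots> = ennreal (B * ?e n)"
      using B e_nonneg by (simp only: ennreal_mult)
    finally show ?thesis
      using B e_nonneg by (simp only: ennreal_le_iff mult_nonneg_nonneg)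
  qed
  then show ?thesis
    by (intro LIM_zero_cancel[OF Lim_null_comparison[OF always_eventually e]] allI)
qed

lemma fourier_translate:
  assumes [measurable]: "h \<in> borel_measurable borel"
  shows "fourier (\<lambda>x. h (x - t)) \<omega> = cis (- (t \<bullet> \<omega>)) * fourier h \<omega>"
proof -
  have "cis (- ((t + x) \<bullet> \<omega>)) = cis (- (t \<bullet> \<omega>)) * cis (- (x \<bullet> \<omega>))" for x
    by (simp add: cis_mult inner_add_left)
  then have "fourier (\<lambda>x. h (x - t)) \<omega> = (\<integral>x. cis (- (t \<bullet> \<omega>)) * (h x * cis (- (x \<bullet> \<omega>))) \<partial>lborel)"
    unfolding fourier_def
    by (subst integral_lborel_affine[where c=1 and t=t]) (auto simp: mult_ac simp del: minus_add_distrib)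
  then show ?thesis
    by (simp add: fourier_def)
qed

lemma
  fixes F P :: "'a::euclidean_space \<Rightarrow> complex"
  assumes F: "integrable lborel F" and P: "integrable lborel P"
  shows integrable_convolution: "integrable lborel (\<lambda>b. \<integral>t. F t * P (b - t) \<partial>lborel)"
    and fourier_convolution: "fourier (\<lambda>b. \<integral>t. F t * P (b - t) \<partial>lborel) \<omega> = fourier F \<omega> * fourier P \<omega>"
proof -
  have [measurable]: "F \<in> borel_measurable borel" "P \<in> borel_measurable borel"
    using F P by auto
  have P_shift: "integrable lborel (\<lambda>b. P (b - t))" for t
    using P by (auto simp: integrable_iff_bounded nn_integral_lborel_shift(1)[where f="\<lambda>x. ennreal (cmod (P x))"])
  have P_int: "(\<integral>b. cmod (P (b - t)) \<partial>lborel) = (\<integral>b. cmod (P b) \<partial>lborel)" for t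
    by (subst (2) integral_lborel_affine[where c=1 and t="- t"]) auto
  have prod: "integrable (lborel \<Otimes>\<^sub>M lborel) (\<lambda>(t, b). F t * P (b - t) * cis (b \<bullet> u))" for u
  proof (rule lborel_pair.Fubini_integrable)
    show "AE t in lborel. integrable lborel (\<lambda>b. case (t, b) of (t, b) \<Rightarrow> F t * P (b - t) * cis (b \<bullet> u))"
      using P_shift by (intro AE_I2) (simp, intro integrable_bounded_mult[where B=1] integrable_mult_right, auto)
    show "integrable lborel (\<lambda>t. \<integral>b. norm (case (t, b) of (t, b) \<Rightarrow> F t * P (b - t) * cis (b \<bullet> u)) \<partial>lborel)"
      using F by (simp add: norm_mult P_int)
  qed measurable
  show "integrable lborel (\<lambda>b. \<integral>t. F t * P (b - t) \<partial>lborel)"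
    using lborel_pair.integrable_snd[OF prod[of 0]] by simp
  have "fourier (\<lambda>b. \<integral>t. F t * P (b - t) \<partial>lborel) \<omega> = (\<integral>b. (\<integral>t. F t * P (b - t) * cis (b \<bullet> (- \<omega>)) \<partial>lborel) \<partial>lborel)"
    by (simp add: fourier_def)
  also have "\<dots> = (\<integral>t. (\<integral>b. F t * P (b - t) * cis (b \<bullet> (- \<omega>)) \<partial>lborel) \<partial>lborel)"
    by (rule lborel_pair.Fubini_integral[OF prod])
  also have "\<dots> = (\<integral>t. F t * fourier (\<lambda>b. P (b - t)) \<omega> \<partial>lborel)"
    by (simp add: fourier_def mult.assoc)
  also have "\<dots> = (\<integral>t. F t * cis (- (t \<bullet> \<omega>)) * fourier P \<omega> \<partial>lborel)"
    by (simp add: fourier_translate mult.assoc)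
  also have "\<dots> = fourier F \<omega> * fourier P \<omega>"
    by (simp add: fourier_def)
  finally show "fourier (\<lambda>b. \<integral>t. F t * P (b - t) \<partial>lborel) \<omega> = fourier F \<omega> * fourier P \<omega>" .
qed

lemma sq_norm_reflect_shift:
  assumes [measurable]: "f \<in> borel_measurable borel"
  shows "sq_norm (\<lambda>x. f (b - x)) = sq_norm f"
  unfolding sq_norm_def
  by (rule nn_integral_lborel_shift(2)[where f="\<lambda>x. ennreal ((cmod (f x))\<^sup>2)"]) measurable

lemma sq_integrable_fourier:
  assumes "integrable lborel h" "sq_integrable h"
  shows "sq_integrable (fourier h)"
proof -
  have [measurable]: "h \<in> borel_measurable borel" using assms by auto
  have "sq_norm (fourier h) \<le> ennreal ((2 * pi) ^ DIM('a)) * sq_norm h"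
    by (rule sq_norm_fourier_le) fact
  also have "\<dots> < \<infinity>"
    using assms(2) by (auto simp: sq_integrable_def ennreal_mult_less_top)
  finally show ?thesis
    unfolding sq_integrable_def by auto
qed

lemma fourier_gauss_dual:
  fixes \<omega> :: "'a::euclidean_space"
  assumes "s > 0"
  shows "fourier (\<lambda>x. complex_of_real (gauss_dual s x)) \<omega>
    = complex_of_real ((sqrt (2 * pi) / s) ^ DIM('a) * gauss_dual (1 / s) \<omega>)"
proof -
  have "fourier (\<lambda>x. complex_of_real (gauss_dual s x)) \<omega>
    = complex_of_real ((sqrt (2 * pi) / s) ^ DIM('a)) * fourier (\<lambda>x. complex_of_real (gauss (1 / s) x)) \<omega>"
    unfolding fourier_def gauss_dual_def of_real_mult mult.assoc by (rule integral_mult_right_zero)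
  then show ?thesis
    using assms by (simp add: fourier_gauss)
qed

text \<open>
  The product \<open>G * Q\<close> is the Fourier transform of the convolution of \<open>F\<close> and \<open>P\<close>, hence bounded by
  the \<open>L\<^sup>1\<close> norm of that convolution.  The convolution of two square integrable functions need not
  be integrable, so the identity is only used after pairing both sides with a Gaussian \<open>\<phi>\<close>.  For
  the approximations in \<open>L\<^sup>1\<close> the pairing is exact; on one side the products of the transforms converge in
  \<open>L\<^sup>1\<close>, on the other the convolutions converge uniformly.  In the limit the smoothings of
  \<open>G * Q\<close> are bounded by the \<open>L\<^sup>1\<close> norm, which suffices.
\<close>

theorem l2_fourier_convolution_bound:
  fixes F P :: "'a::euclidean_space \<Rightarrow> complex"
  assumes FG: "l2_fourier F G" and PQ: "l2_fourier P Q"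
  shows "AE \<omega> in lborel. ennreal (cmod (G \<omega> * Q \<omega>)) \<le> (\<integral>\<^sup>+b. ennreal (cmod (\<integral>t. F t * P (b - t) \<partial>lborel)) \<partial>lborel)"
proof -
  let ?C = "(2 * pi) ^ DIM('a)"
  obtain f where F: "sq_integrable F" and G: "sq_integrable G"
    and f: "\<And>n. integrable lborel (f n)" "\<And>n. sq_integrable (f n)"
    and F_lim: "(\<lambda>n. sq_norm (\<lambda>x. f n x - F x)) \<longlonglongrightarrow> 0"
    and G_lim: "(\<lambda>n. sq_norm (\<lambda>\<omega>. fourier (f n) \<omega> - G \<omega>)) \<longlonglongrightarrow> 0"
    using FG by (auto simp: l2_fourier_def)
  obtain p where P: "sq_integrable P" and Q: "sq_integrable Q"
    and p: "\<And>n. integrable lborel (p n)" "\<And>n. sq_integrable (p n)"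
    and P_lim: "(\<lambda>n. sq_norm (\<lambda>x. p n x - P x)) \<longlonglongrightarrow> 0"
    and Q_lim: "(\<lambda>n. sq_norm (\<lambda>\<omega>. fourier (p n) \<omega> - Q \<omega>)) \<longlonglongrightarrow> 0"
    using PQ by (auto simp: l2_fourier_def)
  have [measurable]: "F \<in> borel_measurable borel" "P \<in> borel_measurable borel"
    "f n \<in> borel_measurable borel" "p n \<in> borel_measurable borel" for n
    using F P f p by (auto simp: sq_integrable_def)
  define V where "V n b = (\<integral>t. f n t * p n (b - t) \<partial>lborel)" for n b
  define W where "W b = (\<integral>t. F t * P (b - t) \<partial>lborel)" for b
  have [measurable]: "W \<in> borel_measurable borel" "V n \<in> borel_measurable borel" for n
    unfolding W_def[abs_def] V_def[abs_def] by measurable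
  show ?thesis
  proof (cases "(\<integral>\<^sup>+b. ennreal (cmod (W b)) \<partial>lborel) = \<infinity>")
    case True
    then show ?thesis by (simp add: W_def)
  next
    case False
    then have W: "integrable lborel W"
      by (intro integrableI_bounded) (auto simp: top.not_eq_extremum)
    define e where "e n = l2norm (\<lambda>x. f n x - F x) * l2norm (\<lambda>x. p n x - P x) + l2norm (\<lambda>x. f n x - F x) * l2norm P
        + l2norm F * l2norm (\<lambda>x. p n x - P x)" for n
    have "e \<longlonglongrightarrow> 0 * 0 + 0 * l2norm P + l2norm F * 0"
      unfolding e_def by (intro tendsto_intros l2norm_tendsto_0 F_lim P_lim)
    then have e: "e \<longlonglongrightarrow> 0" by simp
    have e_nonneg: "0 \<le> e n" for n
      by (simp add: e_def l2norm_nonneg)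
    have V_W: "cmod (V n b - W b) \<le> e n" for n b
    proof -
      have 1: "sq_integrable (\<lambda>t. P (b - t))" "sq_integrable (\<lambda>t. p n (b - t))"
        using P p(2) by (auto simp: sq_integrable_def sq_norm_reflect_shift)
      have 2: "l2norm (\<lambda>t. P (b - t)) = l2norm P" "l2norm (\<lambda>t. p n (b - t) - P (b - t)) = l2norm (\<lambda>x. p n x - P x)"
        unfolding l2norm_def by (simp_all add: sq_norm_reflect_shift[of P] sq_norm_reflect_shift[of "\<lambda>x. p n x - P x"])
      have "V n b - W b = (\<integral>t. f n t * p n (b - t) - F t * P (b - t) \<partial>lborel)"
        unfolding V_def W_def using F f(2) 1 by (simp add: integrable_mult_sq_integrable)
      then have "ennreal (cmod (V n b - W b)) \<le> (\<integral>\<^sup>+t. ennreal (cmod (f n t * p n (b - t) - F t * P (b - t))) \<partial>lborel)"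
        using norm_integral_le_nn_integral by metis
      also have "\<dots> \<le> ennreal (e n)"
        using mult_diff_l2norm_le[OF F f(2)[of n] 1] by (simp add: 2 e_def)
      finally show ?thesis
        using e_nonneg by simp
    qed
    define M where "M = (\<integral>b. cmod (W b) \<partial>lborel)"
    have "AE \<omega> in lborel. cmod (G \<omega> * Q \<omega>) \<le> M"
    proof (rule smoothing_bound_imp_AE_bound)
      show "integrable lborel (\<lambda>\<omega>. G \<omega> * Q \<omega>)"
        by (rule integrable_mult_sq_integrable[OF G Q])
      fix s :: real and \<eta> :: 'a
      assume s: "s > 0"
      define \<phi> where "\<phi> \<omega> = complex_of_real (gauss_dual s (\<omega> - \<eta>))" for \<omega> :: 'a
      have [measurable]: "\<phi> \<in> borel_measurable borel"
        unfolding \<phi>_def[abs_def] by measurable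
      have \<phi>_norm: "(\<integral>\<^sup>+\<omega>. ennreal (cmod (\<phi> \<omega>)) \<partial>lborel) = ennreal ?C"
        using s nn_integral_lborel_shift(1)[where f="\<lambda>x::'a. ennreal (gauss_dual s x)" and t=\<eta>]
        by (simp add: \<phi>_def nn_integral_gauss_dual)
      then have \<phi>: "integrable lborel \<phi>"
        by (intro integrableI_bounded) auto
      have \<phi>_le: "cmod (\<phi> \<omega>) \<le> (sqrt (2 * pi) / s) ^ DIM('a)" for \<omega>
        using gauss_dual_le[OF s] s by (simp add: \<phi>_def)
      have \<phi>_int: "(\<integral>\<omega>. cmod (\<phi> \<omega>) \<partial>lborel) = ?C"
        using nn_integral_eq_integral[OF integrable_norm[OF \<phi>]] \<phi>_norm by simp
      have \<phi>_fourier_le: "cmod (fourier \<phi> x) \<le> ?C" for x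
        using cmod_fourier_le[of \<phi> x] by (simp add: \<phi>_int)
      have "fourier \<phi> = (\<lambda>x. complex_of_real ((sqrt (2 * pi) / s) ^ DIM('a) * gauss_dual (1 / s) x) * cis (- (\<eta> \<bullet> x)))"
        unfolding \<phi>_def using fourier_translate[where h="\<lambda>x. complex_of_real (gauss_dual s x)" and t=\<eta>]
        by (simp add: fun_eq_iff mult.commute fourier_gauss_dual[OF s])
      moreover have "integrable lborel (\<lambda>x. complex_of_real ((sqrt (2 * pi) / s) ^ DIM('a) * gauss_dual (1 / s) x) * cis (- (\<eta> \<bullet> x)))"
        using s by (intro integrable_bounded_mult[where B=1] integrable_of_real integrable_mult_right gauss_dual_integrable) auto
      ultimately have \<phi>_fourier: "integrable lborel (fourier \<phi>)"
        by (simp only:)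
      have V: "(\<integral>\<omega>. fourier (f n) \<omega> * fourier (p n) \<omega> * \<phi> \<omega> \<partial>lborel) = (\<integral>x. V n x * fourier \<phi> x \<partial>lborel)" for n
        using fourier_multiplication[OF integrable_convolution[OF f(1)[of n] p(1)[of n]] \<phi>]
        by (simp add: fourier_convolution[OF f(1) p(1)] V_def)
      have "(\<lambda>n. \<integral>\<omega>. fourier (f n) \<omega> * fourier (p n) \<omega> * \<phi> \<omega> \<partial>lborel) \<longlonglongrightarrow> (\<integral>\<omega>. G \<omega> * Q \<omega> * \<phi> \<omega> \<partial>lborel)"
        by (rule pairing_tendsto[OF G _ Q _ G_lim Q_lim _ \<phi>_le]) (auto intro: sq_integrable_fourier f p)
      moreover have "(\<lambda>n. \<integral>x. V n x * fourier \<phi> x \<partial>lborel) \<longlonglongrightarrow> (\<integral>x. W x * fourier \<phi> x \<partial>lborel)"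
      proof -
        let ?D = "\<integral>x. cmod (fourier \<phi> x) \<partial>lborel"
        have "norm ((\<integral>x. V n x * fourier \<phi> x \<partial>lborel) - (\<integral>x. W x * fourier \<phi> x \<partial>lborel)) \<le> e n * ?D" for n
        proof -
          have "integrable lborel (V n)"
            unfolding V_def[abs_def] by (rule integrable_convolution[OF f(1) p(1)])
          then have int: "integrable lborel (\<lambda>x. V n x * fourier \<phi> x)" "integrable lborel (\<lambda>x. W x * fourier \<phi> x)"
            using W \<phi>_fourier_le by (auto intro!: integrable_bounded_mult)
          have "norm ((\<integral>x. V n x * fourier \<phi> x \<partial>lborel) - (\<integral>x. W x * fourier \<phi> x \<partial>lborel))
            = norm (\<integral>x. (V n x - W x) * fourier \<phi> x \<partial>lborel)"
            by (simp add: left_diff_distrib int)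
          also have "\<dots> \<le> (\<integral>x. cmod ((V n x - W x) * fourier \<phi> x) \<partial>lborel)"
            by (rule integral_norm_bound)
          also have "\<dots> \<le> (\<integral>x. e n * cmod (fourier \<phi> x) \<partial>lborel)"
          proof (intro integral_mono integrable_norm integrable_mult_right)
            show "integrable lborel (\<lambda>x. (V n x - W x) * fourier \<phi> x)"
              unfolding left_diff_distrib by (rule Bochner_Integration.integrable_diff[OF int])
            show "integrable lborel (fourier \<phi>)"
              by (rule \<phi>_fourier)
            show "cmod ((V n x - W x) * fourier \<phi> x) \<le> e n * cmod (fourier \<phi> x)" for x
              unfolding norm_mult by (intro mult_right_mono V_W) simp
          qed
          finally show ?thesis by simp
        qed
        moreover have D0: "(\<lambda>n. e n * ?D) \<longlonglongrightarrow> 0"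
          using e by (rule tendsto_mult_left_zero)
        ultimately show ?thesis
          by (intro LIM_zero_cancel[OF Lim_null_comparison[OF always_eventually D0]] allI)
      qed
      ultimately have "(\<integral>\<omega>. G \<omega> * Q \<omega> * \<phi> \<omega> \<partial>lborel) = (\<integral>x. W x * fourier \<phi> x \<partial>lborel)"
        unfolding V by (rule LIMSEQ_unique)
      also have "cmod \<dots> \<le> (\<integral>x. cmod (W x * fourier \<phi> x) \<partial>lborel)"
        by (rule integral_norm_bound)
      also have "\<dots> \<le> (\<integral>x. cmod (W x) * ?C \<partial>lborel)"
        using W \<phi>_fourier_le
        by (intro integral_mono integrable_norm integrable_bounded_mult)
           (auto simp: norm_mult intro!: mult_left_mono)
      also have "\<dots> = M * ?C"
        by (simp add: M_def)
      finally show "cmod (\<integral>\<omega>. G \<omega> * Q \<omega> * complex_of_real (gauss_dual s (\<omega> - \<eta>)) \<partial>lborel) \<le> M * ?C"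
        by (simp only: \<phi>_def)
    qed
    moreover have "ennreal M = (\<integral>\<^sup>+b. ennreal (cmod (W b)) \<partial>lborel)"
      unfolding M_def using W by (subst nn_integral_eq_integral) auto
    ultimately show ?thesis
      by (auto simp: W_def[symmetric] intro: ennreal_leI elim!: eventually_mono simp flip: \<open>ennreal M = _\<close>)
  qed
qed

lemma gauss_mult_shift:
  fixes x \<eta> :: "'a::euclidean_space"
  shows "gauss 1 x * gauss t (x - \<eta>) = exp (- (t\<^sup>2 / (1 + t\<^sup>2) * (norm \<eta>)\<^sup>2) / 2)
    * gauss (sqrt (1 + t\<^sup>2)) (x - (t\<^sup>2 / (1 + t\<^sup>2)) *\<^sub>R \<eta>)"
proof -
  have halves: "- a / 2 + - b / 2 = - c / 2 + - d / 2" if "a + b = c + d" for a b c d :: real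
    using that by simp
  have pos: "1 + t\<^sup>2 > 0" by (simp add: add_pos_nonneg)
  let ?c = "t\<^sup>2 / (1 + t\<^sup>2)"
  have c: "(1 + t\<^sup>2) * ?c = t\<^sup>2"
    using pos by simp
  have sq: "(norm (x - r *\<^sub>R \<eta>))\<^sup>2 = (norm x)\<^sup>2 - 2 * r * (x \<bullet> \<eta>) + r\<^sup>2 * (norm \<eta>)\<^sup>2" for r
    unfolding power2_norm_eq_inner by (simp add: inner_diff_left inner_diff_right inner_commute power2_eq_square algebra_simps)
  have "(1 + t\<^sup>2) * (norm (x - ?c *\<^sub>R \<eta>))\<^sup>2
     = (1 + t\<^sup>2) * (norm x)\<^sup>2 - 2 * ((1 + t\<^sup>2) * ?c) * (x \<bullet> \<eta>) + ((1 + t\<^sup>2) * ?c) * ?c * (norm \<eta>)\<^sup>2"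
    unfolding sq by (simp only: power2_eq_square algebra_simps)
  also have "\<dots> = (norm x)\<^sup>2 + t\<^sup>2 * (norm (x - 1 *\<^sub>R \<eta>))\<^sup>2 - (t\<^sup>2 - t\<^sup>2 * ?c) * (norm \<eta>)\<^sup>2"
    unfolding c sq by (simp only: algebra_simps) simp
  also have "t\<^sup>2 - t\<^sup>2 * ?c = ?c"
    using pos by (simp add: field_simps power2_eq_square)
  finally have "(norm x)\<^sup>2 + t\<^sup>2 * (norm (x - \<eta>))\<^sup>2 = ?c * (norm \<eta>)\<^sup>2 + (1 + t\<^sup>2) * (norm (x - ?c *\<^sub>R \<eta>))\<^sup>2"
    by simp
  moreover have "(sqrt (1 + t\<^sup>2))\<^sup>2 = 1 + t\<^sup>2"
    using pos by simp
  ultimately show ?thesis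
    unfolding gauss_def exp_add[symmetric] power_mult_distrib
    by (intro arg_cong[where f=exp] halves) simp
qed

text \<open>
  If the transform vanishes, the multiplication formula with modulated Gaussians shows that all
  Gaussian smoothings of \<open>F\<close> vanish.  Damping \<open>F\<close> by a Gaussian makes it integrable, and by
  completing the square its smoothings are multiples of those of \<open>F\<close>.
\<close>

theorem l2_fourier_inject:
  fixes F G :: "'a::euclidean_space \<Rightarrow> complex"
  assumes FG: "l2_fourier F G" and G0: "AE \<omega> in lborel. G \<omega> = 0"
  shows "AE x in lborel. F x = 0"
proof -
  obtain f where F: "sq_integrable F" and G: "sq_integrable G"
    and f: "\<And>n. integrable lborel (f n)" "\<And>n. sq_integrable (f n)"
    and F_lim: "(\<lambda>n. sq_norm (\<lambda>x. f n x - F x)) \<longlonglongrightarrow> 0"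
    and G_lim: "(\<lambda>n. sq_norm (\<lambda>\<omega>. fourier (f n) \<omega> - G \<omega>)) \<longlonglongrightarrow> 0"
    using FG by (auto simp: l2_fourier_def)
  have [measurable]: "F \<in> borel_measurable borel" "G \<in> borel_measurable borel"
    using F G by (auto simp: sq_integrable_def)
  have gauss_sq: "sq_integrable (\<lambda>x::'a. complex_of_real (c * gauss s (x - t)))" if "s > 0" for s t c
  proof -
    have "sq_norm (\<lambda>x::'a. complex_of_real (c * gauss s (x - t))) \<le> (\<integral>\<^sup>+x. ennreal (c\<^sup>2) * ennreal (gauss s (x - t)) \<partial>(lborel::'a measure))"
      unfolding sq_norm_def
      by (intro nn_integral_mono)
         (auto simp: power_mult_distrib norm_mult power2_eq_square[of "gauss _ _"] gauss_le_1 simp flip: ennreal_mult intro!: ennreal_leI mult_left_mono mult_left_le)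
    also have "\<dots> = ennreal (c\<^sup>2) * (\<integral>\<^sup>+x. ennreal (gauss s x) \<partial>(lborel::'a measure))"
      by (simp add: nn_integral_cmult nn_integral_lborel_shift(1)[where f="\<lambda>x. ennreal (gauss s x)"])
    also have "\<dots> < \<infinity>"
      using gauss_integrable[OF that, where 'a='a] by (auto simp: integrable_iff_bounded ennreal_mult_less_top)
    finally show ?thesis
      by (simp add: sq_integrable_def)
  qed
  have pull: "F * complex_of_real a * complex_of_real b = complex_of_real c * (F * complex_of_real d)"
    if "a * b = c * d" for F a b c d
    using arg_cong[OF that, of complex_of_real] by (simp add: mult_ac)
  have zero: "(\<integral>x. F x * complex_of_real (gauss_dual s (x - \<eta>)) \<partial>lborel) = 0" if s: "s > 0" for s \<eta>
  proof -
    let ?k = "\<lambda>\<omega>::'a. complex_of_real (gauss s \<omega>)"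
    have k: "sq_integrable ?k"
      using gauss_sq[OF s, of 1 0] by simp
    have d: "sq_integrable (\<lambda>x. complex_of_real (gauss_dual s (x - \<eta>)))"
      using gauss_sq[of "1 / s" "(sqrt (2 * pi) / s) ^ DIM('a)" \<eta>] s by (simp add: gauss_dual_def)
    have eq: "(\<integral>\<omega>. fourier (f n) \<omega> * ?k \<omega> * cis (\<omega> \<bullet> \<eta>) \<partial>lborel) = (\<integral>x. f n x * complex_of_real (gauss_dual s (x - \<eta>)) * 1 \<partial>lborel)" for n
    proof -
      have "integrable lborel (\<lambda>\<omega>. ?k \<omega> * cis (\<omega> \<bullet> \<eta>))"
        using integrable_gauss_complex[OF s] by (intro integrable_bounded_mult[where B=1]) auto
      from fourier_multiplication[OF f(1)[of n] this] show ?thesis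
        by (simp add: fourier_modulate fourier_gauss[OF s] mult.assoc)
    qed
    have "(\<lambda>n. \<integral>\<omega>. fourier (f n) \<omega> * ?k \<omega> * cis (\<omega> \<bullet> \<eta>) \<partial>lborel) \<longlonglongrightarrow> (\<integral>\<omega>. G \<omega> * ?k \<omega> * cis (\<omega> \<bullet> \<eta>) \<partial>lborel)"
      by (rule pairing_tendsto[OF G _ k k G_lim, where B=1]) (auto intro: sq_integrable_fourier f simp: sq_norm_def)
    moreover have "(\<lambda>n. \<integral>x. f n x * complex_of_real (gauss_dual s (x - \<eta>)) * 1 \<partial>lborel) \<longlonglongrightarrow> (\<integral>x. F x * complex_of_real (gauss_dual s (x - \<eta>)) * 1 \<partial>lborel)"
      by (rule pairing_tendsto[OF F f(2) d d F_lim, where B=1]) (auto simp: sq_norm_def)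
    ultimately have "(\<integral>\<omega>. G \<omega> * ?k \<omega> * cis (\<omega> \<bullet> \<eta>) \<partial>lborel) = (\<integral>x. F x * complex_of_real (gauss_dual s (x - \<eta>)) * 1 \<partial>lborel)"
      unfolding eq by (rule LIMSEQ_unique)
    moreover have "(\<integral>\<omega>. G \<omega> * ?k \<omega> * cis (\<omega> \<bullet> \<eta>) \<partial>lborel) = 0"
      using G0 by (intro integral_eq_zero_AE) (auto elim!: eventually_mono)
    ultimately show ?thesis by simp
  qed
  have "AE x in lborel. cmod (F x * complex_of_real (gauss 1 x)) \<le> 0"
  proof (rule smoothing_bound_imp_AE_bound)
    show "integrable lborel (\<lambda>x. F x * complex_of_real (gauss 1 x))"
      using F gauss_sq[of 1 1 0] by (intro integrable_mult_sq_integrable) auto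
    fix s :: real and \<eta> :: 'a
    assume s: "s > 0"
    let ?t = "1 / s"
    \<comment> \<open>The product of the damping and the smoothing Gaussian is a smoothing Gaussian of width ?r.\<close>
    let ?r = "1 / sqrt (1 + ?t\<^sup>2)"
    have r: "?r > 0"
      by (simp add: add_pos_nonneg)
    let ?\<eta> = "(?t\<^sup>2 / (1 + ?t\<^sup>2)) *\<^sub>R \<eta>"
    let ?c = "(sqrt (2 * pi) / s) ^ DIM('a) * exp (- (?t\<^sup>2 / (1 + ?t\<^sup>2) * (norm \<eta>)\<^sup>2) / 2) / (sqrt (2 * pi) / ?r) ^ DIM('a)"
    have nz: "(sqrt (2 * pi) / ?r) ^ DIM('a) \<noteq> 0"
      using r by simp
    have "gauss 1 x * gauss_dual s (x - \<eta>) = ?c * gauss_dual ?r (x - ?\<eta>)" for x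
    proof -
      have "gauss 1 x * gauss_dual s (x - \<eta>) = (sqrt (2 * pi) / s) ^ DIM('a) * (gauss 1 x * gauss ?t (x - \<eta>))"
        by (simp only: gauss_dual_def mult_ac)
      also have "\<dots> = ?c * ((sqrt (2 * pi) / ?r) ^ DIM('a) * gauss (1 / ?r) (x - ?\<eta>))"
        unfolding gauss_mult_shift using nz by (simp only: times_divide_eq_left times_divide_eq_right mult.assoc[symmetric] nonzero_mult_div_cancel_right nonzero_eq_divide_eq) (simp add: mult_ac)
      finally show ?thesis
        by (simp only: gauss_dual_def)
    qed
    then have "F x * complex_of_real (gauss 1 x) * complex_of_real (gauss_dual s (x - \<eta>))
        = complex_of_real ?c * (F x * complex_of_real (gauss_dual ?r (x - ?\<eta>)))" for x
      by (rule pull)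
    then have "(\<integral>x. F x * complex_of_real (gauss 1 x) * complex_of_real (gauss_dual s (x - \<eta>)) \<partial>lborel)
       = complex_of_real ?c * (\<integral>x. F x * complex_of_real (gauss_dual ?r (x - ?\<eta>)) \<partial>lborel)"
      by (simp only: integral_mult_right_zero)
    then show "cmod (\<integral>x. F x * complex_of_real (gauss 1 x) * complex_of_real (gauss_dual s (x - \<eta>)) \<partial>lborel) \<le> 0 * (2 * pi) ^ DIM('a)"
      by (simp only: zero[OF r]) simp
  qed
  then show ?thesis
    using gauss_pos[where 'a='a and s=1] by (auto elim!: eventually_mono simp: less_le)
qed

section \<open>Completeness and existence of the transform\<close>

lemma fast_Cauchy_imp_limit:
  fixes u :: "nat \<Rightarrow> 'b::banach"
  assumes step: "\<And>k. norm (u (Suc k) - u k) \<le> r / 2 ^ k"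
  shows "convergent u" and "norm (lim u - u n) \<le> 2 * r / 2 ^ n"
proof -
  have "0 \<le> r"
    using order_trans[OF norm_ge_zero step[of 0]] by simp
  have tele: "norm (u (n + j) - u n) \<le> 2 * r / 2 ^ n - 2 * r / 2 ^ (n + j)" for n j
  proof (induction j)
    case (Suc j)
    have "norm (u (n + Suc j) - u n) \<le> norm (u (Suc (n + j)) - u (n + j)) + norm (u (n + j) - u n)"
      using norm_triangle_ineq[of "u (Suc (n + j)) - u (n + j)" "u (n + j) - u n"] by simp
    also have "\<dots> \<le> r / 2 ^ (n + j) + (2 * r / 2 ^ n - 2 * r / 2 ^ (n + j))"
      by (intro add_mono step Suc)
    also have "\<dots> = 2 * r / 2 ^ n - 2 * r / 2 ^ (n + Suc j)"
      by (simp add: field_simps)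
    finally show ?case .
  qed simp
  have tail: "norm (u m - u n) \<le> 2 * r / 2 ^ n" if nm: "n \<le> m" for m n
  proof -
    obtain j where m: "m = n + j"
      using le_Suc_ex[OF nm] by blast
    have "0 \<le> 2 * r / 2 ^ (n + j)"
      using \<open>0 \<le> r\<close> by simp
    then show ?thesis
      unfolding m using tele[of n j] by linarith
  qed
  have "(\<lambda>n. 2 * r * (1 / 2) ^ n) \<longlonglongrightarrow> 2 * r * 0"
    by (intro tendsto_intros LIMSEQ_power_zero) simp
  then have lim0: "(\<lambda>n. 2 * r / 2 ^ n) \<longlonglongrightarrow> 0"
    by (simp add: power_one_over)
  have "Cauchy u"
  proof (rule metric_CauchyI)
    fix e :: real assume "0 < e"
    then have "eventually (\<lambda>n. 2 * r / 2 ^ n < e / 2) sequentially"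
      using order_tendstoD(2)[OF lim0, of "e / 2"] by simp
    then obtain N where N: "2 * r / 2 ^ N < e / 2"
      by (auto simp: eventually_sequentially)
    have "dist (u m) (u n) < e" if "N \<le> m" "N \<le> n" for m n
      using dist_triangle_half_l[of "u m" "u N" e "u n"] tail[OF that(1)] tail[OF that(2)] N
      by (simp add: dist_norm norm_minus_commute)
    then show "\<exists>M. \<forall>m\<ge>M. \<forall>n\<ge>M. dist (u m) (u n) < e"
      by blast
  qed
  then show conv: "convergent u"
    by (rule Cauchy_convergent)
  have "(\<lambda>m. norm (u m - u n)) \<longlonglongrightarrow> norm (lim u - u n)"
    by (intro tendsto_intros) (use conv in \<open>simp add: convergent_LIMSEQ_iff\<close>)
  then show "norm (lim u - u n) \<le> 2 * r / 2 ^ n"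
    by (rule Lim_bounded) (use tail in auto)
qed

text \<open>
  Completeness of \<open>L\<^sup>2\<close> along a geometrically convergent sequence.  Weighting the squared increments
  by \<open>4 ^ n\<close> keeps their sum \<open>S\<close> integrable, and where \<open>S\<close> is finite it dominates the pointwise speed
  of convergence: \<open>|u n - g|\<^sup>2 \<le> 4 * (1 / 4) ^ n * S\<close>.
\<close>

lemma l2_fast_Cauchy_imp_limit:
  fixes u :: "nat \<Rightarrow> 'a::euclidean_space \<Rightarrow> complex"
  assumes u: "\<And>n. sq_integrable (u n)"
    and step: "\<And>n. sq_norm (\<lambda>x. u (Suc n) x - u n x) \<le> ennreal (C * (1 / 16) ^ n)" and "0 \<le> C"
  obtains g where "sq_integrable g" "(\<lambda>n. sq_norm (\<lambda>x. u n x - g x)) \<longlonglongrightarrow> 0"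
proof -
  have [measurable]: "u n \<in> borel_measurable borel" for n
    using u by (auto simp: sq_integrable_def)
  define S where "S x = (\<Sum>n. ennreal (4 ^ n * (cmod (u (Suc n) x - u n x))\<^sup>2))" for x
  have [measurable]: "S \<in> borel_measurable borel"
    unfolding S_def[abs_def] by measurable
  have "(\<integral>\<^sup>+x. S x \<partial>lborel) = (\<Sum>n. \<integral>\<^sup>+x. ennreal (4 ^ n * (cmod (u (Suc n) x - u n x))\<^sup>2) \<partial>lborel)"
    unfolding S_def by (rule nn_integral_suminf) measurable
  also have "\<dots> \<le> (\<Sum>n. ennreal (C * (1 / 4) ^ n))"
  proof (intro suminf_le summableI)
    fix n
    have "(\<integral>\<^sup>+x. ennreal (4 ^ n * (cmod (u (Suc n) x - u n x))\<^sup>2) \<partial>lborel) = ennreal (4 ^ n) * sq_norm (\<lambda>x. u (Suc n) x - u n x)"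
      unfolding sq_norm_def by (subst nn_integral_cmult[symmetric]) (auto simp: ennreal_mult)
    also have "\<dots> \<le> ennreal (4 ^ n) * ennreal (C * (1 / 16) ^ n)"
      by (intro mult_left_mono step) simp
    also have "\<dots> = ennreal (C * (1 / 4) ^ n)"
    proof -
      have "(4::real) ^ n * (1 / 16) ^ n = (1 / 4) ^ n"
        by (subst power_mult_distrib[symmetric]) simp
      then show ?thesis
        using \<open>0 \<le> C\<close> by (subst ennreal_mult[symmetric]) (auto simp: mult.left_commute)
    qed
    finally show "(\<integral>\<^sup>+x. ennreal (4 ^ n * (cmod (u (Suc n) x - u n x))\<^sup>2) \<partial>lborel) \<le> ennreal (C * (1 / 4) ^ n)" .
  qed
  also have "\<dots> = ennreal (\<Sum>n. C * (1 / 4) ^ n)"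
    using \<open>0 \<le> C\<close> by (intro suminf_ennreal2 summable_mult summable_geometric) auto
  also have "\<dots> < \<infinity>"
    by simp
  finally have S_fin: "(\<integral>\<^sup>+x. S x \<partial>lborel) < \<infinity>" .
  then have "AE x in lborel. S x \<noteq> \<infinity>"
    by (intro nn_integral_noteq_infinite) auto
  define g where "g x = lim (\<lambda>n. u n x)" for x
  have [measurable]: "g \<in> borel_measurable borel"
    unfolding g_def[abs_def] by measurable
  have pt: "ennreal ((cmod (u n x - g x))\<^sup>2) \<le> ennreal (4 * (1 / 4) ^ n) * S x" if fin: "S x \<noteq> \<infinity>" for n x
  proof -
    obtain s where s: "S x = ennreal s" "0 \<le> s"
      using fin by (cases "S x") auto
    have "cmod (u (Suc k) x - u k x) \<le> sqrt s / 2 ^ k" for k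
    proof -
      have "ennreal (4 ^ k * (cmod (u (Suc k) x - u k x))\<^sup>2) \<le> S x"
        unfolding S_def by (rule sum_le_suminf[of _ "{k}", simplified]) auto
      then have "4 ^ k * (cmod (u (Suc k) x - u k x))\<^sup>2 \<le> s"
        using s by simp
      moreover have "(4::real) ^ k = (2 ^ k)\<^sup>2"
        using power_mult_distrib[of "2::real" 2 k] by (simp add: power2_eq_square)
      ultimately have "(2 ^ k * cmod (u (Suc k) x - u k x))\<^sup>2 \<le> s"
        by (simp add: power_mult_distrib)
      then have "2 ^ k * cmod (u (Suc k) x - u k x) \<le> sqrt s"
        by (rule real_le_rsqrt)
      then show ?thesis
        by (simp add: field_simps)
    qed
    then have "norm (lim (\<lambda>n. u n x) - u n x) \<le> 2 * sqrt s / 2 ^ n"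
      by (rule fast_Cauchy_imp_limit(2))
    then have "(cmod (u n x - g x))\<^sup>2 \<le> (2 * sqrt s / 2 ^ n)\<^sup>2"
      by (intro power_mono) (auto simp: g_def norm_minus_commute)
    also have "\<dots> = 4 * (1 / 4) ^ n * s"
      using s(2) power_mult_distrib[of "2::real" 2 n]
      by (simp add: power_mult_distrib power_divide power_one_over power2_eq_square)
    finally show ?thesis
      using s by (simp add: ennreal_mult[symmetric] ennreal_leI)
  qed
  have le: "sq_norm (\<lambda>x. u n x - g x) \<le> ennreal (4 * (1 / 4) ^ n) * (\<integral>\<^sup>+x. S x \<partial>lborel)" for n
  proof -
    have "sq_norm (\<lambda>x. u n x - g x) \<le> (\<integral>\<^sup>+x. ennreal (4 * (1 / 4) ^ n) * S x \<partial>lborel)"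
      unfolding sq_norm_def using \<open>AE x in lborel. S x \<noteq> \<infinity>\<close>
      by (intro nn_integral_mono_AE) (auto elim!: eventually_mono intro: pt)
    then show ?thesis
      by (simp add: nn_integral_cmult)
  qed
  obtain c where c: "(\<integral>\<^sup>+x. S x \<partial>lborel) = ennreal c" "0 \<le> c"
    using S_fin by (cases "\<integral>\<^sup>+x. S x \<partial>lborel") auto
  have "(\<lambda>n. ennreal (4 * (1 / 4) ^ n * c)) \<longlonglongrightarrow> ennreal (4 * 0 * c)"
    by (intro tendsto_ennrealI tendsto_intros LIMSEQ_power_zero) simp
  then have bound_lim: "(\<lambda>n. ennreal (4 * (1 / 4) ^ n) * (\<integral>\<^sup>+x. S x \<partial>lborel)) \<longlonglongrightarrow> 0"
    by (simp add: c ennreal_mult)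
  have lim: "(\<lambda>n. sq_norm (\<lambda>x. u n x - g x)) \<longlonglongrightarrow> 0"
    by (rule tendsto_sandwich[OF _ _ tendsto_const bound_lim]) (intro always_eventually allI le zero_le)+
  have "sq_norm (\<lambda>x. u 0 x - g x) < \<infinity>"
    using le[of 0] S_fin by (auto simp: ennreal_mult_less_top intro: le_less_trans)
  then have "sq_integrable (\<lambda>x. u 0 x - g x)"
    by (simp add: sq_integrable_def)
  from sq_integrable_diff[OF u[of 0] this] have "sq_integrable g"
    by simp
  then show ?thesis
    using lim by (rule that)
qed

lemma l2_approx_integrable:
  fixes F :: "'a::euclidean_space \<Rightarrow> complex"
  assumes F: "sq_integrable F"
  obtains h where "\<And>n. integrable lborel (h n)" "\<And>n. sq_integrable (h n)"
    "(\<lambda>n::nat. sq_norm (\<lambda>x. h n x - F x)) \<longlonglongrightarrow> 0"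
proof -
  have [measurable]: "F \<in> borel_measurable borel"
    using F by (auto simp: sq_integrable_def)
  define \<rho> where "\<rho> n x = (indicator (ball 0 (real n)) x :: complex)" for n and x :: 'a
  define h where "h n x = F x * \<rho> n x" for n x
  have \<rho>_sq: "(cmod (\<rho> n x))\<^sup>2 = indicator (ball 0 (real n)) x" for n x
    by (simp add: \<rho>_def indicator_def)
  have [measurable]: "\<rho> n \<in> borel_measurable borel" for n
    unfolding \<rho>_def[abs_def] by (intro borel_measurable_indicator) auto
  have \<rho>: "sq_integrable (\<rho> n)" for n
    using emeasure_bounded_finite[OF bounded_ball, of "0::'a" "real n"]
    by (simp add: sq_integrable_def sq_norm_def \<rho>_sq ennreal_indicator)
  have 1: "integrable lborel (h n)" for n
    unfolding h_def by (rule integrable_mult_sq_integrable[OF F \<rho>])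
  have le: "ennreal ((cmod (h n x - F x))\<^sup>2) \<le> ennreal ((cmod (F x))\<^sup>2)"
    "ennreal ((cmod (h n x))\<^sup>2) \<le> ennreal ((cmod (F x))\<^sup>2)" for n x
    by (auto simp: h_def \<rho>_def indicator_def)
  have "sq_norm (h n) \<le> sq_norm F" for n
    unfolding sq_norm_def by (intro nn_integral_mono le)
  then have 2: "sq_integrable (h n)" for n
    using F 1[of n] by (auto simp: sq_integrable_def intro: le_less_trans)
  have [measurable]: "h n \<in> borel_measurable borel" for n
    using 2 by (simp add: sq_integrable_def)
  have "(\<lambda>n. \<integral>\<^sup>+x. ennreal ((cmod (h n x - F x))\<^sup>2) \<partial>lborel) \<longlonglongrightarrow> (\<integral>\<^sup>+x. 0 \<partial>(lborel::'a measure))"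
  proof (rule nn_integral_dominated_convergence)
    show "AE x in lborel. (\<lambda>n. ennreal ((cmod (h n x - F x))\<^sup>2)) \<longlonglongrightarrow> 0"
    proof (intro AE_I2 tendsto_eventually)
      fix x :: 'a
      obtain N where "norm x < real N"
        using reals_Archimedean2 by blast
      then show "eventually (\<lambda>n. ennreal ((cmod (h n x - F x))\<^sup>2) = 0) sequentially"
        by (intro eventually_sequentiallyI[of N]) (auto simp: h_def \<rho>_def indicator_def)
    qed
    show "(\<integral>\<^sup>+x. ennreal ((cmod (F x))\<^sup>2) \<partial>lborel) < \<infinity>"
      using F by (simp add: sq_integrable_def sq_norm_def)
    show "AE x in lborel. ennreal ((cmod (h n x - F x))\<^sup>2) \<le> ennreal ((cmod (F x))\<^sup>2)" for n
      using le by (intro AE_I2)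
  qed measurable
  then have 3: "(\<lambda>n. sq_norm (\<lambda>x. h n x - F x)) \<longlonglongrightarrow> 0"
    by (simp add: sq_norm_def)
  show ?thesis
    using 1 2 3 by (rule that)
qed

text \<open>
  By Plancherel the transforms of truncations of \<open>F\<close> form a Cauchy sequence; passing to a fast
  subsequence makes the preceding completeness lemma applicable.
\<close>

theorem l2_fourier_exists:
  fixes F :: "'a::euclidean_space \<Rightarrow> complex"
  assumes F: "sq_integrable F"
  shows "\<exists>G. l2_fourier F G"
proof -
  obtain h0 where h0: "\<And>n. integrable lborel (h0 n)" "\<And>n. sq_integrable (h0 n)"
    "(\<lambda>n::nat. sq_norm (\<lambda>x. h0 n x - F x)) \<longlonglongrightarrow> 0"
    using l2_approx_integrable[OF F] by blast
  have "\<exists>m. sq_norm (\<lambda>x. h0 m x - F x) \<le> ennreal ((1 / 16) ^ k)" for k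
  proof -
    have "eventually (\<lambda>m. sq_norm (\<lambda>x. h0 m x - F x) < ennreal ((1 / 16) ^ k)) sequentially"
      using h0(3) by (rule order_tendstoD) simp
    then show ?thesis
      by (auto simp: eventually_sequentially intro: less_imp_le)
  qed
  then obtain r where r: "\<And>k. sq_norm (\<lambda>x. h0 (r k) x - F x) \<le> ennreal ((1 / 16) ^ k)"
    by metis
  define h where "h k = h0 (r k)" for k
  have h: "\<And>n. integrable lborel (h n)" "\<And>n. sq_integrable (h n)"
    by (simp_all add: h_def h0)
  have h_le: "sq_norm (\<lambda>x. h k x - F x) \<le> ennreal ((1 / 16) ^ k)" for k
    by (simp add: h_def r)
  have "(\<lambda>k. ennreal ((1 / 16) ^ k)) \<longlonglongrightarrow> ennreal 0"
    by (intro tendsto_ennrealI LIMSEQ_power_zero) simp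
  then have lim0: "(\<lambda>k. ennreal ((1 / 16) ^ k)) \<longlonglongrightarrow> 0"
    by simp
  have h_lim: "(\<lambda>k. sq_norm (\<lambda>x. h k x - F x)) \<longlonglongrightarrow> 0"
    by (rule tendsto_sandwich[OF _ _ tendsto_const lim0]) (use h_le in auto)
  have "sq_norm (\<lambda>x. fourier (h (Suc n)) x - fourier (h n) x) \<le> ennreal (4 * (2 * pi) ^ DIM('a) * (1 / 16) ^ n)" for n
  proof -
    have [measurable]: "F \<in> borel_measurable borel" "h k \<in> borel_measurable borel" for k
      using F h by (auto simp: sq_integrable_def)
    have "(\<lambda>x. h (Suc n) x - h n x) = (\<lambda>x. (h (Suc n) x - F x) - (h n x - F x))"
      by auto
    then have "sq_norm (\<lambda>x. h (Suc n) x - h n x) \<le> 2 * sq_norm (\<lambda>x. h (Suc n) x - F x) + 2 * sq_norm (\<lambda>x. h n x - F x)"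
      by (simp only:) (intro sq_norm_diff_le; measurable)
    also have "\<dots> \<le> 2 * ennreal ((1 / 16) ^ n) + 2 * ennreal ((1 / 16) ^ n)"
    proof (intro add_mono mult_left_mono h_le)
      have "ennreal ((1 / 16) ^ Suc n) \<le> ennreal ((1 / 16) ^ n)"
        by (intro ennreal_leI power_decreasing) auto
      then show "sq_norm (\<lambda>x. h (Suc n) x - F x) \<le> ennreal ((1 / 16) ^ n)"
        using h_le[of "Suc n"] by (rule order_trans[rotated])
    qed auto
    also have "\<dots> = ennreal (4 * (1 / 16) ^ n)"
      by (simp add: ennreal_mult distrib_right[symmetric])
    finally have diff_le: "sq_norm (\<lambda>x. h (Suc n) x - h n x) \<le> ennreal (4 * (1 / 16) ^ n)" .
    have "fourier (h (Suc n)) x - fourier (h n) x = fourier (\<lambda>x. h (Suc n) x - h n x) x" for x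
      unfolding fourier_def left_diff_distrib
      by (intro Bochner_Integration.integral_diff[symmetric] integrable_bounded_mult[where B=1] h) auto
    then have "sq_norm (\<lambda>x. fourier (h (Suc n)) x - fourier (h n) x) = sq_norm (fourier (\<lambda>x. h (Suc n) x - h n x))"
      by simp
    also have "\<dots> \<le> ennreal ((2 * pi) ^ DIM('a)) * sq_norm (\<lambda>x. h (Suc n) x - h n x)"
      by (intro sq_norm_fourier_le Bochner_Integration.integrable_diff h)
    also have "\<dots> \<le> ennreal ((2 * pi) ^ DIM('a)) * ennreal (4 * (1 / 16) ^ n)"
      by (intro mult_left_mono diff_le) simp
    also have "\<dots> = ennreal (4 * (2 * pi) ^ DIM('a) * (1 / 16) ^ n)"
      by (subst ennreal_mult[symmetric]) (auto simp: mult_ac)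
    finally show ?thesis .
  qed
  then obtain G where G: "sq_integrable G" "(\<lambda>n. sq_norm (\<lambda>x. fourier (h n) x - G x)) \<longlonglongrightarrow> 0"
    using l2_fast_Cauchy_imp_limit[of "\<lambda>n. fourier (h n)" "4 * (2 * pi) ^ DIM('a)"] sq_integrable_fourier[OF h]
    by auto
  show ?thesis
    unfolding l2_fourier_def using F G h h_lim by blast
qed

section \<open>Reflections and dilations\<close>

lemma fourier_cnj_reflect:
  assumes [measurable]: "F \<in> borel_measurable borel"
  shows "fourier (\<lambda>x. cnj (F (- x))) \<omega> = cnj (fourier F \<omega>)"
  unfolding fourier_def
  by (subst integral_lborel_affine[where c="-1" and t=0])
     (auto simp: cis_cnj simp flip: Bochner_Integration.integral_cnj)

lemma sq_norm_cnj_reflect: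
  assumes [measurable]: "F \<in> borel_measurable borel"
  shows "sq_norm (\<lambda>x. cnj (F (- x))) = sq_norm F"
  using sq_norm_reflect_shift[OF assms, of 0] by (simp add: sq_norm_def)

lemma l2_fourier_cnj_reflect:
  assumes "l2_fourier F G"
  shows "l2_fourier (\<lambda>x. cnj (F (- x))) (\<lambda>\<omega>. cnj (G \<omega>))"
proof -
  obtain h where F: "sq_integrable F" and G: "sq_integrable G"
    and h: "\<And>n. integrable lborel (h n)" "\<And>n. sq_integrable (h n)"
    and lim: "(\<lambda>n. sq_norm (\<lambda>x. h n x - F x)) \<longlonglongrightarrow> 0" "(\<lambda>n. sq_norm (\<lambda>\<omega>. fourier (h n) \<omega> - G \<omega>)) \<longlonglongrightarrow> 0"
    using assms by (auto simp: l2_fourier_def)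
  have [measurable]: "F \<in> borel_measurable borel" "G \<in> borel_measurable borel" "h n \<in> borel_measurable borel" for n
    using F G h by (auto simp: sq_integrable_def)
  have "sq_integrable (\<lambda>x. cnj (F (- x)))" "sq_integrable (\<lambda>x. cnj (h n (- x)))" for n
    using F h(2)[of n] by (auto simp: sq_integrable_def sq_norm_cnj_reflect)
  moreover have "sq_integrable (\<lambda>\<omega>. cnj (G \<omega>))"
    using G by (auto simp: sq_integrable_def sq_norm_def)
  moreover have "integrable lborel (\<lambda>x. cnj (h n (- x)))" for n
    using h(1)[of n] nn_integral_lborel_shift(2)[where f="\<lambda>x. ennreal (cmod (h n x))" and t=0]
    by (auto simp: integrable_iff_bounded)
  moreover have "sq_norm (\<lambda>x. cnj (h n (- x)) - cnj (F (- x))) = sq_norm (\<lambda>x. h n x - F x)" for n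
    using sq_norm_cnj_reflect[of "\<lambda>x. h n x - F x"] by simp
  moreover have "sq_norm (\<lambda>\<omega>. fourier (\<lambda>x. cnj (h n (- x))) \<omega> - cnj (G \<omega>)) = sq_norm (\<lambda>\<omega>. fourier (h n) \<omega> - G \<omega>)" for n
    by (simp add: fourier_cnj_reflect sq_norm_def flip: complex_cnj_diff)
  ultimately show ?thesis
    unfolding l2_fourier_def using lim by (auto intro!: exI[of _ "\<lambda>n x. cnj (h n (- x))"])
qed

text \<open>
  Componentwise products carry both the wavelet dilations and the frequency scaling
  \<open>l\<^sup>2 / sin \<alpha>\<close> of the fractional transform.
\<close>

definition vec_times :: "real ^ 'n \<Rightarrow> real ^ 'n \<Rightarrow> real ^ 'n" where
  "vec_times d x = (\<chi> k. d $ k * x $ k)"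

definition vec_inverse :: "real ^ 'n \<Rightarrow> real ^ 'n" where
  "vec_inverse d = (\<chi> k. 1 / d $ k)"

lemma mod_prod_nonneg [simp]: "0 \<le> mod_prod d"
  by (simp add: mod_prod_def)

lemma mod_prod_nz_iff: "mod_prod d \<noteq> 0 \<longleftrightarrow> (\<forall>k. d $ k \<noteq> 0)"
  by (simp add: mod_prod_def)

lemma mod_prod_inverse: "mod_prod (vec_inverse d) = 1 / mod_prod d"
  by (simp add: mod_prod_def vec_inverse_def prod_dividef)

lemma mod_prod_times: "mod_prod (vec_times d x) = mod_prod d * mod_prod x"
  by (simp add: mod_prod_def vec_times_def prod.distrib abs_mult)

lemma vec_times_inverse:
  assumes "mod_prod d \<noteq> 0"
  shows "vec_times d (vec_times (vec_inverse d) x) = x" "vec_times (vec_inverse d) (vec_times d x) = x"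
  using assms by (simp_all add: mod_prod_nz_iff vec_times_def vec_inverse_def vec_eq_iff)

lemma vec_times_commute: "vec_times d x = vec_times x d"
  by (simp add: vec_times_def mult.commute)

lemma vec_times_left_commute: "vec_times a (vec_times d x) = vec_times d (vec_times a x)"
  by (simp add: vec_times_def mult.left_commute)

lemma inner_vec_times: "vec_times d x \<bullet> y = x \<bullet> vec_times d y"
  by (simp add: inner_vec_def vec_times_def mult_ac)

lemma continuous_vec_times: "continuous_on UNIV (\<lambda>p. vec_times (fst p) (snd p))"
  unfolding vec_times_def by (intro continuous_intros)

lemma borel_measurable_vec_times [measurable]:
  assumes "f \<in> borel_measurable M" "g \<in> borel_measurable M"
  shows "(\<lambda>x. vec_times (f x) (g x)) \<in> borel_measurable M"
  by (rule borel_measurable_continuous_Pair[OF assms continuous_vec_times])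

lemma Basis_vec_real: "(Basis :: (real ^ 'n) set) = range (\<lambda>k. axis k 1)"
  by (auto simp: Basis_vec_def)

text \<open>
  The change of variables for diagonal maps; all dilation lemmas derive from it.
\<close>

lemma lborel_vec_times:
  fixes d :: "real ^ 'n"
  assumes d: "mod_prod d \<noteq> 0"
  shows "(lborel :: (real ^ 'n) measure) = density (distr lborel borel (vec_times d)) (\<lambda>_. ennreal (mod_prod d))"
proof -
  have dk: "d $ k \<noteq> 0" for k
    using d by (simp add: mod_prod_nz_iff)
  have T: "0 + (\<Sum>j\<in>Basis. ((d \<bullet> j) * (x \<bullet> j)) *\<^sub>R j) = vec_times d x" for x :: "real ^ 'n"
  proof (rule euclidean_eqI)
    fix b :: "real ^ 'n"
    assume b: "b \<in> Basis"
    then obtain k where "b = axis k 1"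
      by (auto simp: Basis_vec_real)
    then show "(0 + (\<Sum>j\<in>Basis. ((d \<bullet> j) * (x \<bullet> j)) *\<^sub>R j)) \<bullet> b = vec_times d x \<bullet> b"
      using inner_sum_left_Basis[OF b, of "\<lambda>j. (d \<bullet> j) * (x \<bullet> j)"] by (simp add: inner_axis vec_times_def)
  qed
  have P: "(\<Prod>j\<in>Basis. \<bar>d \<bullet> j\<bar>) = mod_prod d"
    unfolding Basis_vec_real mod_prod_def
    by (subst prod.reindex) (auto simp: inj_on_def axis_eq_axis inner_axis abs_prod)
  have "d \<bullet> j \<noteq> 0" if "j \<in> Basis" for j
    using that dk by (auto simp: Basis_vec_real inner_axis)
  from lborel_affine_euclidean[of "\<lambda>j. d \<bullet> j" "0 :: real ^ 'n", OF this] show ?thesis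
    unfolding T P by simp
qed

lemma nn_integral_vec_times:
  fixes d :: "real ^ 'n"
  assumes [measurable]: "f \<in> borel_measurable borel" and d: "mod_prod d \<noteq> 0"
  shows "(\<integral>\<^sup>+x. f x \<partial>lborel) = ennreal (mod_prod d) * (\<integral>\<^sup>+x. f (vec_times d x) \<partial>lborel)"
  by (subst lborel_vec_times[OF d]) (simp add: nn_integral_density nn_integral_distr nn_integral_cmult)

lemma integral_vec_times:
  fixes d :: "real ^ 'n" and f :: "_ \<Rightarrow> complex"
  assumes [measurable]: "f \<in> borel_measurable borel" and d: "mod_prod d \<noteq> 0"
  shows "(\<integral>x. f x \<partial>lborel) = complex_of_real (mod_prod d) * (\<integral>x. f (vec_times d x) \<partial>lborel)"
  by (subst lborel_vec_times[OF d]) (simp add: integral_density integral_distr scaleR_conv_of_real)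

lemma AE_vec_times:
  fixes d :: "real ^ 'n"
  assumes "AE x in lborel. P x" and d: "mod_prod d \<noteq> 0"
  shows "AE x in lborel. P (vec_times d x)"
proof -
  obtain N where N: "{x. \<not> P x} \<subseteq> N" "N \<in> null_sets lborel"
    using assms(1) by (auto simp: eventually_ae_filter)
  then have [measurable]: "N \<in> sets borel" by auto
  have "0 = (\<integral>\<^sup>+x. indicator N x \<partial>(lborel::(real^'n) measure))"
    using N by auto
  also have "\<dots> = ennreal (mod_prod d) * (\<integral>\<^sup>+x. indicator N (vec_times d x) \<partial>lborel)"
    by (rule nn_integral_vec_times) (use d in auto)
  finally have "(\<integral>\<^sup>+x. indicator N (vec_times d x) \<partial>(lborel::(real^'n) measure)) = 0"
    using d mod_prod_nonneg[of d] by (auto simp: ennreal_eq_0_iff less_le simp del: mod_prod_nonneg)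
  then have "AE x in lborel. indicator N (vec_times d x) = (0::ennreal)"
    by (subst (asm) nn_integral_0_iff_AE) auto
  then show ?thesis
    using N(1) by (auto elim!: eventually_mono simp: indicator_def split: if_splits)
qed

lemma sq_norm_vec_times:
  fixes d :: "real ^ 'n"
  assumes [measurable]: "f \<in> borel_measurable borel" and d: "mod_prod d \<noteq> 0"
  shows "sq_norm (\<lambda>x. f (vec_times d x)) = ennreal (1 / mod_prod d) * sq_norm f"
proof -
  have "sq_norm f = ennreal (mod_prod d) * sq_norm (\<lambda>x. f (vec_times d x))"
    unfolding sq_norm_def by (rule nn_integral_vec_times) (use d in auto)
  then show ?thesis
    using d by (simp add: mult.assoc[symmetric] ennreal_mult[symmetric])
qed

lemma sq_norm_cmult:
  assumes [measurable]: "f \<in> borel_measurable borel"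
  shows "sq_norm (\<lambda>x. c * f x) = ennreal ((cmod c)\<^sup>2) * sq_norm f"
  unfolding sq_norm_def
  by (subst nn_integral_cmult[symmetric]) (auto simp: norm_mult power_mult_distrib ennreal_mult)

lemma fourier_vec_times:
  fixes d :: "real ^ 'n"
  assumes [measurable]: "h \<in> borel_measurable borel" and d: "mod_prod d \<noteq> 0"
  shows "fourier (\<lambda>x. h (vec_times d x)) \<omega> = complex_of_real (1 / mod_prod d) * fourier h (vec_times (vec_inverse d) \<omega>)"
proof -
  have "fourier h (vec_times (vec_inverse d) \<omega>)
    = complex_of_real (mod_prod d) * (\<integral>x. h (vec_times d x) * cis (- (vec_times d x \<bullet> vec_times (vec_inverse d) \<omega>)) \<partial>lborel)"
    unfolding fourier_def by (rule integral_vec_times) (use d in auto)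
  also have "\<dots> = complex_of_real (mod_prod d) * fourier (\<lambda>x. h (vec_times d x)) \<omega>"
    using d by (simp add: fourier_def inner_vec_times vec_times_inverse)
  finally show ?thesis
    using d by simp
qed

lemma tendsto_0_ennreal_cmult:
  fixes f :: "nat \<Rightarrow> ennreal"
  assumes "f \<longlonglongrightarrow> 0"
  shows "(\<lambda>n. ennreal c * f n) \<longlonglongrightarrow> 0"
  using tendsto_mult_ennreal[OF tendsto_const assms, of "ennreal c"] by simp

lemma ennreal_mult_less_top_I: "a < \<infinity> \<Longrightarrow> b < \<infinity> \<Longrightarrow> a * b < (\<infinity>::ennreal)"
  by (simp add: ennreal_mult_less_top)

lemma l2_fourier_vec_times:
  fixes d :: "real ^ 'n"
  assumes FG: "l2_fourier F G" and d: "mod_prod d \<noteq> 0"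
  shows "l2_fourier (\<lambda>x. F (vec_times d x)) (\<lambda>\<omega>. complex_of_real (1 / mod_prod d) * G (vec_times (vec_inverse d) \<omega>))"
proof -
  obtain h where F: "sq_integrable F" and G: "sq_integrable G"
    and h: "\<And>n. integrable lborel (h n)" "\<And>n. sq_integrable (h n)"
    and lim: "(\<lambda>n. sq_norm (\<lambda>x. h n x - F x)) \<longlonglongrightarrow> 0" "(\<lambda>n. sq_norm (\<lambda>\<omega>. fourier (h n) \<omega> - G \<omega>)) \<longlonglongrightarrow> 0"
    using FG by (auto simp: l2_fourier_def)
  have [measurable]: "F \<in> borel_measurable borel" "G \<in> borel_measurable borel" "h n \<in> borel_measurable borel" for n
    using F G h by (auto simp: sq_integrable_def)
  have inv: "mod_prod (vec_inverse d) \<noteq> 0"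
    using d by (simp add: mod_prod_inverse)
  have sq: "sq_integrable (\<lambda>x. f (vec_times d x))" if "sq_integrable f" for f
    using that d by (auto simp: sq_integrable_def sq_norm_vec_times ennreal_mult_less_top)
  have "sq_integrable (\<lambda>\<omega>. complex_of_real (1 / mod_prod d) * G (vec_times (vec_inverse d) \<omega>))"
  proof -
    have "sq_norm (\<lambda>\<omega>. complex_of_real (1 / mod_prod d) * G (vec_times (vec_inverse d) \<omega>))
      = ennreal ((cmod (complex_of_real (1 / mod_prod d)))\<^sup>2) * (ennreal (1 / mod_prod (vec_inverse d)) * sq_norm G)"
      by (subst sq_norm_cmult, measurable, subst sq_norm_vec_times[OF \<open>G \<in> _\<close> inv], rule refl)
    also have "\<dots> < \<infinity>"
      using G unfolding sq_integrable_def by (intro ennreal_mult_less_top_I) auto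
    finally show ?thesis
      unfolding sq_integrable_def by (intro conjI) measurable
  qed
  moreover have "integrable lborel (\<lambda>x. h n (vec_times d x))" for n
  proof -
    have "(\<integral>\<^sup>+x. ennreal (cmod (h n x)) \<partial>lborel) = ennreal (mod_prod d) * (\<integral>\<^sup>+x. ennreal (cmod (h n (vec_times d x))) \<partial>lborel)"
      by (rule nn_integral_vec_times) (use d in auto)
    moreover have "(\<integral>\<^sup>+x. ennreal (cmod (h n x)) \<partial>lborel) < \<infinity>"
      using h(1)[of n] by (simp add: integrable_iff_bounded)
    ultimately show ?thesis
      using d by (intro integrableI_bounded) (auto simp: ennreal_mult_less_top less_le)
  qed
  moreover have "(\<lambda>n. sq_norm (\<lambda>x. h n (vec_times d x) - F (vec_times d x))) \<longlonglongrightarrow> 0"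
    using tendsto_0_ennreal_cmult[OF lim(1)] d
    by (subst sq_norm_vec_times[of "\<lambda>x. h _ x - F x"]) auto
  moreover have "(\<lambda>n. sq_norm (\<lambda>\<omega>. fourier (\<lambda>x. h n (vec_times d x)) \<omega> - complex_of_real (1 / mod_prod d) * G (vec_times (vec_inverse d) \<omega>))) \<longlonglongrightarrow> 0"
  proof -
    have "sq_norm (\<lambda>\<omega>. fourier (\<lambda>x. h n (vec_times d x)) \<omega> - complex_of_real (1 / mod_prod d) * G (vec_times (vec_inverse d) \<omega>))
      = ennreal ((cmod (complex_of_real (1 / mod_prod d)))\<^sup>2) * (ennreal (1 / mod_prod (vec_inverse d)) * sq_norm (\<lambda>\<omega>. fourier (h n) \<omega> - G \<omega>))" for n
      unfolding fourier_vec_times[OF \<open>h n \<in> _\<close> d] right_diff_distrib[symmetric]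
      by (subst sq_norm_cmult, measurable, subst sq_norm_vec_times[of "\<lambda>\<omega>. fourier (h n) \<omega> - G \<omega>", OF _ inv]) auto
    then show ?thesis
      by (simp only: tendsto_0_ennreal_cmult[OF tendsto_0_ennreal_cmult[OF lim(2)]])
  qed
  ultimately show ?thesis
    unfolding l2_fourier_def using sq[OF F] sq[OF h(2)] by (auto intro!: exI[of _ "\<lambda>n x. h n (vec_times d x)"])
qed

section \<open>The fractional Fourier transform\<close>

lemma L2_norm_eq: "L2_norm f = ennreal_powr (sq_norm f) (1 / 2)"
  by (simp add: L2_norm_def sq_norm_def nn_integral_completion)

lemma ennreal_powr_half_power2: "(ennreal_powr x (1 / 2))\<^sup>2 = x"
proof (cases x)
  case (real r)
  have "(r powr (1 / 2))\<^sup>2 = r"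
    using real by (simp add: powr_half_sqrt)
  then show ?thesis
    using real by (simp add: ennreal_powr_def ennreal_power)
qed (simp add: ennreal_powr_def power2_eq_square)

lemma ennreal_powr_half_tendsto_0_iff:
  fixes x :: "nat \<Rightarrow> ennreal"
  shows "(\<lambda>n. ennreal_powr (x n) (1 / 2)) \<longlonglongrightarrow> 0 \<longleftrightarrow> x \<longlonglongrightarrow> 0"
proof
  assume y: "(\<lambda>n. ennreal_powr (x n) (1 / 2)) \<longlonglongrightarrow> 0"
  have "(\<lambda>n. ennreal_powr (x n) (1 / 2) * ennreal_powr (x n) (1 / 2)) \<longlonglongrightarrow> 0 * 0"
    by (rule tendsto_mult_ennreal[OF y y]) simp
  then show "x \<longlonglongrightarrow> 0"
    by (simp add: ennreal_powr_half_power2 flip: power2_eq_square)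
next
  assume x: "x \<longlonglongrightarrow> 0"
  show "(\<lambda>n. ennreal_powr (x n) (1 / 2)) \<longlonglongrightarrow> 0"
  proof (rule order_tendstoI)
    fix e :: ennreal
    assume "0 < e"
    then have "0 < e\<^sup>2"
      by (simp add: power2_eq_square ennreal_zero_less_mult_iff)
    with x have "eventually (\<lambda>n. x n < e\<^sup>2) sequentially"
      by (rule order_tendstoD)
    then show "eventually (\<lambda>n. ennreal_powr (x n) (1 / 2) < e) sequentially"
    proof eventually_elim
      case (elim n)
      show ?case
      proof (rule ccontr)
        assume "\<not> ennreal_powr (x n) (1 / 2) < e"
        then have "e\<^sup>2 \<le> (ennreal_powr (x n) (1 / 2))\<^sup>2"
          by (intro power_mono) auto
        with elim show False
          by (simp add: ennreal_powr_half_power2)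
      qed
    qed
  qed simp
qed

lemma L2_norm_tendsto_0_iff: "(\<lambda>n::nat. L2_norm (f n)) \<longlonglongrightarrow> 0 \<longleftrightarrow> (\<lambda>n. sq_norm (f n)) \<longlonglongrightarrow> 0"
  unfolding L2_norm_eq by (rule ennreal_powr_half_tendsto_0_iff)

lemma sq_norm_cong_AE:
  assumes "AE x in lborel. cmod (f x) = cmod (g x)"
  shows "sq_norm f = sq_norm g"
  unfolding sq_norm_def using assms by (intro nn_integral_cong_AE) (auto elim!: eventually_mono)

text \<open>
  If \<open>f\<close> is only Lebesgue measurable, compositions such as \<open>f (x - y)\<close> need not be measurable for the
  product of the Borel sigma-algebras, and Fubini does not apply; Borel representatives avoid this.
\<close>

lemma lebesgue_complex_borel_representative:
  fixes f :: "'a::euclidean_space \<Rightarrow> complex"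
  assumes f: "f \<in> borel_measurable lebesgue"
  obtains f' where "f' \<in> borel_measurable borel" "AE x in lborel. f x = f' x"
proof -
  have "(\<lambda>x. Re (f x)) \<in> borel_measurable lebesgue" "(\<lambda>x. Im (f x)) \<in> borel_measurable lebesgue"
    using f by measurable
  then obtain r i where [measurable]: "r \<in> borel_measurable lborel" "i \<in> borel_measurable lborel"
    and "AE x in lborel. Re (f x) = r x" "AE x in lborel. Im (f x) = i x"
    by (auto dest!: completion_ex_borel_measurable_real)
  then have "AE x in lborel. f x = Complex (r x) (i x)"
    by (auto simp: complex_eq_iff)
  moreover have "(\<lambda>x. Complex (r x) (i x)) \<in> borel_measurable borel"
    unfolding Complex_eq by measurable
  ultimately show ?thesis
    by (rule that[rotated])
qed

lemma lebesgue_measurable_AE_eq: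
  fixes f :: "'a::euclidean_space \<Rightarrow> complex"
  assumes "f' \<in> borel_measurable borel" "AE x in lborel. f x = f' x"
  shows "f \<in> borel_measurable lebesgue"
  using assms by (intro borel_measurable_AE[of f' f])
    (auto simp: AE_completion_iff intro: measurable_completion elim!: eventually_mono)

lemma L2_fun_imp_sq_integrable:
  assumes "L2_fun f" and [measurable]: "f' \<in> borel_measurable borel" and "AE x in lborel. f x = f' x"
  shows "sq_integrable f'"
proof -
  have "sq_norm f' = sq_norm f"
    using assms(3) by (intro sq_norm_cong_AE) (auto elim!: eventually_mono)
  also have "\<dots> < \<infinity>"
    using assms(1) by (auto simp: L2_fun_def integrable_iff_bounded sq_norm_def nn_integral_completion)
  finally show ?thesis
    using assms(2) by (simp add: sq_integrable_def)
qed

lemma sq_integrable_imp_L2_fun: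
  assumes "sq_integrable f"
  shows "L2_fun f"
proof -
  have [measurable]: "f \<in> borel_measurable borel"
    using assms by (simp add: sq_integrable_def)
  have "integrable lborel (\<lambda>x. (cmod (f x))\<^sup>2)"
    using assms by (intro integrableI_bounded) (auto simp: sq_integrable_def sq_norm_def)
  then show ?thesis
    unfolding L2_fun_def by (auto simp: integrable_completion intro: measurable_completion)
qed

lemma cmod_chirp [simp]: "cmod (chirp \<alpha> s x) = 1"
  unfolding chirp_def by (rule norm_exp_i_times)

lemma chirp_nz [simp]: "chirp \<alpha> s x \<noteq> 0"
  by (simp add: chirp_def)

lemma cnj_chirp: "cnj (chirp \<alpha> s x) = chirp \<alpha> (- s) x"
  by (simp add: chirp_def exp_cnj)

lemma chirp_mult_cnj: "chirp \<alpha> s x * cnj (chirp \<alpha> s x) = 1" "cnj (chirp \<alpha> s x) * chirp \<alpha> s x = 1"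
  using complex_norm_square[of "chirp \<alpha> s x"] by (simp_all add: mult.commute)

lemma borel_measurable_chirp [measurable]: "chirp \<alpha> s \<in> borel_measurable borel"
  unfolding chirp_def by (intro borel_measurable_continuous_onI continuous_intros)

definition frft_scale :: "real ^ 'n \<Rightarrow> real \<Rightarrow> real ^ 'n" where
  "frft_scale \<alpha> l = (\<chi> k. l\<^sup>2 / sin (\<alpha> $ k))"

definition frft_const :: "real ^ 'n \<Rightarrow> complex" where
  "frft_const \<alpha> = frft_c_prod \<alpha> / complex_of_real (sqrt (2 * pi) ^ CARD('n))"

text \<open>
  The fractional transform is a classical one: multiply by a chirp, transform, rescale the frequency
  and multiply by a chirp again.
\<close>

lemma frft_kernel_eq:
  "frft_kernel \<alpha> l x \<xi> = frft_const \<alpha> * chirp \<alpha> (l\<^sup>2) \<xi> * (chirp \<alpha> (l\<^sup>2) x * cis (- (x \<bullet> vec_times (frft_scale \<alpha> l) \<xi>)))"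
proof -
  have "l\<^sup>2 * (\<Sum>k\<in>UNIV. x $ k * \<xi> $ k / sin (\<alpha> $ k)) = x \<bullet> vec_times (frft_scale \<alpha> l) \<xi>"
    by (simp add: inner_vec_def vec_times_def frft_scale_def sum_distrib_left mult_ac)
  then show ?thesis
    by (simp add: frft_kernel_def frft_const_def cis_conv_exp mult_ac)
qed

lemma frft_integral_eq_fourier:
  assumes h: "h \<in> borel_measurable lebesgue" and [measurable]: "h' \<in> borel_measurable borel"
    and eq: "AE x in lborel. h x = h' x"
  shows "frft_integral \<alpha> l h \<xi> = frft_const \<alpha> * chirp \<alpha> (l\<^sup>2) \<xi> *
    fourier (\<lambda>x. h' x * chirp \<alpha> (l\<^sup>2) x) (vec_times (frft_scale \<alpha> l) \<xi>)"
proof -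
  have K: "(\<lambda>x. frft_kernel \<alpha> l x \<xi>) \<in> borel_measurable borel"
    unfolding frft_kernel_eq by measurable
  then have "(\<lambda>x. frft_kernel \<alpha> l x \<xi>) \<in> borel_measurable lebesgue" "h' \<in> borel_measurable lebesgue"
    by (auto intro: measurable_completion)
  then have "frft_integral \<alpha> l h \<xi> = (\<integral>x. h' x * frft_kernel \<alpha> l x \<xi> \<partial>lebesgue)"
    unfolding frft_integral_def using AE_completion[OF eq] h
    by (intro integral_cong_AE) (auto elim!: eventually_mono)
  also have "\<dots> = (\<integral>x. h' x * frft_kernel \<alpha> l x \<xi> \<partial>lborel)"
    using K by (intro integral_completion) auto
  also have "\<dots> = (\<integral>x. frft_const \<alpha> * chirp \<alpha> (l\<^sup>2) \<xi> * (h' x * chirp \<alpha> (l\<^sup>2) x * cis (- (x \<bullet> vec_times (frft_scale \<alpha> l) \<xi>))) \<partial>lborel)"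
    unfolding frft_kernel_eq by (intro Bochner_Integration.integral_cong) (auto simp: mult_ac)
  finally show ?thesis
    by (simp only: fourier_def integral_mult_right_zero)
qed

locale frft_parameters =
  fixes \<alpha> :: "real ^ 'n" and l :: real
  assumes l_nz: "l \<noteq> 0" and angle: "\<And>k. \<alpha> $ k \<in> {-pi<..<pi} - {0}"
begin

lemma sin_nz: "sin (\<alpha> $ k) \<noteq> 0"
  using angle[of k] sin_gt_zero[of "\<alpha> $ k"] sin_gt_zero[of "- (\<alpha> $ k)"] by (cases "\<alpha> $ k > 0") auto

lemma scale_nz: "mod_prod (frft_scale \<alpha> l) \<noteq> 0"
  using l_nz sin_nz by (simp add: mod_prod_nz_iff frft_scale_def)

lemma c_prod_nz: "frft_c_prod \<alpha> \<noteq> 0"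
proof -
  have "frft_c t \<noteq> 0" for t
  proof -
    have "1 - \<i> * complex_of_real (cot t) \<noteq> 0"
      by (simp add: complex_eq_iff)
    then show ?thesis
      unfolding frft_c_def csqrt_eq_0 .
  qed
  then show ?thesis
    by (simp add: frft_c_prod_def)
qed

lemma const_nz: "frft_const \<alpha> \<noteq> 0"
  using c_prod_nz by (simp add: frft_const_def)

abbreviation (input) "\<kappa> \<equiv> chirp \<alpha> (l\<^sup>2)"
abbreviation (input) "D \<equiv> frft_scale \<alpha> l"

text \<open>
  The inverse of the passage from a classical to a fractional transform: remove the constant and the
  chirp, then undo the frequency scaling.
\<close>

definition demod :: "(real ^ 'n \<Rightarrow> complex) \<Rightarrow> real ^ 'n \<Rightarrow> complex" where
  "demod g \<omega> = g (vec_times (vec_inverse D) \<omega>) / (frft_const \<alpha> * \<kappa> (vec_times (vec_inverse D) \<omega>))"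

lemma cmod_demod_scale: "cmod (demod g (vec_times D \<eta>)) = cmod (g \<eta>) / cmod (frft_const \<alpha>)"
  by (simp add: demod_def vec_times_inverse scale_nz norm_divide norm_mult)

lemma borel_measurable_demod [measurable]:
  assumes [measurable]: "g \<in> borel_measurable borel"
  shows "demod g \<in> borel_measurable borel"
  unfolding demod_def[abs_def] by measurable

text \<open>
  Demodulation changes \<open>L\<^sup>2\<close> distances by a constant factor, so it preserves the convergence in the
  definition of the transform.
\<close>

lemma sq_norm_demod_diff:
  assumes [measurable]: "g \<in> borel_measurable borel" "u \<in> borel_measurable borel"
    and u: "\<And>\<xi>. v \<xi> = frft_const \<alpha> * \<kappa> \<xi> * u (vec_times D \<xi>)"
  shows "sq_norm (\<lambda>\<omega>. u \<omega> - demod g \<omega>)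
    = ennreal (mod_prod D / (cmod (frft_const \<alpha>))\<^sup>2) * sq_norm (\<lambda>\<xi>. v \<xi> - g \<xi>)"
proof -
  have [measurable]: "v \<in> borel_measurable borel"
    unfolding u[abs_def] by measurable
  have "cmod (u (vec_times D \<xi>) - demod g (vec_times D \<xi>)) = cmod (1 / frft_const \<alpha> * (v \<xi> - g \<xi>))" for \<xi>
  proof -
    have "u (vec_times D \<xi>) - demod g (vec_times D \<xi>) = (1 / \<kappa> \<xi>) * (1 / frft_const \<alpha> * (v \<xi> - g \<xi>))"
      using const_nz by (simp add: demod_def u vec_times_inverse scale_nz field_simps)
    then show ?thesis
      by (simp add: norm_mult norm_divide)
  qed
  then have "sq_norm (\<lambda>\<xi>. u (vec_times D \<xi>) - demod g (vec_times D \<xi>)) = sq_norm (\<lambda>\<xi>. 1 / frft_const \<alpha> * (v \<xi> - g \<xi>))"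
    by (simp add: sq_norm_def)
  also have "\<dots> = ennreal ((cmod (1 / frft_const \<alpha>))\<^sup>2) * sq_norm (\<lambda>\<xi>. v \<xi> - g \<xi>)"
    by (rule sq_norm_cmult) measurable
  finally have "ennreal (1 / mod_prod D) * sq_norm (\<lambda>\<omega>. u \<omega> - demod g \<omega>) = ennreal ((cmod (1 / frft_const \<alpha>))\<^sup>2) * sq_norm (\<lambda>\<xi>. v \<xi> - g \<xi>)"
    by (subst (asm) sq_norm_vec_times[of "\<lambda>\<omega>. u \<omega> - demod g \<omega>", OF _ scale_nz]) auto
  then have "ennreal (mod_prod D) * (ennreal (1 / mod_prod D) * sq_norm (\<lambda>\<omega>. u \<omega> - demod g \<omega>))
     = ennreal (mod_prod D) * (ennreal ((cmod (1 / frft_const \<alpha>))\<^sup>2) * sq_norm (\<lambda>\<xi>. v \<xi> - g \<xi>))"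
    by simp
  then show ?thesis
    using scale_nz by (simp add: mult.assoc[symmetric] ennreal_mult[symmetric] norm_divide power_divide)
qed

lemma is_mfrft_imp_l2_fourier:
  assumes m: "is_mfrft \<alpha> l f g" and f: "L2_fun f"
    and f': "f' \<in> borel_measurable borel" "AE x in lborel. f x = f' x"
    and g': "g' \<in> borel_measurable borel" "AE x in lborel. g x = g' x"
  shows "l2_fourier (\<lambda>x. f' x * \<kappa> x) (demod g')"
proof -
  note [measurable] = f'(1) g'(1)
  obtain h where g: "L2_fun g" and h: "\<And>n::nat. integrable lebesgue (h n)" "\<And>n. L2_fun (h n)"
    and lim: "(\<lambda>n. sq_norm (\<lambda>x. h n x - f x)) \<longlonglongrightarrow> 0"
      "(\<lambda>n. sq_norm (\<lambda>\<xi>. frft_integral \<alpha> l (h n) \<xi> - g \<xi>)) \<longlonglongrightarrow> 0"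
    using m by (auto simp: is_mfrft_def L2_norm_tendsto_0_iff)
  have "\<exists>h'. h' \<in> borel_measurable borel \<and> (AE x in lborel. h n x = h' x)" for n
    using lebesgue_complex_borel_representative[of "h n"] h(2)[of n] unfolding L2_fun_def by blast
  then obtain h' where h'm [measurable]: "\<And>n. h' n \<in> borel_measurable borel" and h': "\<And>n. AE x in lborel. h n x = h' n x"
    by metis
  have chirp_sq: "sq_norm (\<lambda>x. q x * \<kappa> x) = sq_norm q" for q
    by (simp add: sq_norm_def norm_mult)
  have sq: "sq_integrable (\<lambda>x. q x * \<kappa> x)" if "sq_integrable q" for q
    using that by (auto simp: sq_integrable_def chirp_sq)
  have F: "sq_integrable (\<lambda>x. f' x * \<kappa> x)" "\<And>n. sq_integrable (\<lambda>x. h' n x * \<kappa> x)"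
    using L2_fun_imp_sq_integrable[OF f f'] L2_fun_imp_sq_integrable[OF h(2) h'm h'] by (auto intro: sq)
  have hL: "\<And>n. h n \<in> borel_measurable lebesgue"
    using h by (auto simp: L2_fun_def)
  have int: "integrable lborel (\<lambda>x. h' n x * \<kappa> x)" for n
  proof -
    have "(\<integral>\<^sup>+x. ennreal (cmod (h' n x * \<kappa> x)) \<partial>lborel) = (\<integral>\<^sup>+x. ennreal (cmod (h n x)) \<partial>lebesgue)"
      unfolding nn_integral_completion using h'[of n]
      by (intro nn_integral_cong_AE) (auto elim!: eventually_mono simp: norm_mult)
    also have "\<dots> < \<infinity>"
      using h(1)[of n] by (simp add: integrable_iff_bounded)
    finally show ?thesis
      by (intro integrableI_bounded) auto
  qed
  have "sq_norm (\<lambda>x. h' n x * \<kappa> x - f' x * \<kappa> x) = sq_norm (\<lambda>x. h n x - f x)" for n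
  proof -
    have "sq_norm (\<lambda>x. h' n x * \<kappa> x - f' x * \<kappa> x) = sq_norm (\<lambda>x. (h' n x - f' x) * \<kappa> x)"
      by (simp only: left_diff_distrib)
    also have "\<dots> = sq_norm (\<lambda>x. h n x - f x)"
      unfolding chirp_sq using h'[of n] f'(2) by (intro sq_norm_cong_AE) (auto elim!: eventually_elim2)
    finally show ?thesis .
  qed
  then have lim1: "(\<lambda>n. sq_norm (\<lambda>x. h' n x * \<kappa> x - f' x * \<kappa> x)) \<longlonglongrightarrow> 0"
    using lim(1) by simp
  have "sq_norm (\<lambda>\<omega>. fourier (\<lambda>x. h' n x * \<kappa> x) \<omega> - demod g' \<omega>)
      = ennreal (mod_prod D / (cmod (frft_const \<alpha>))\<^sup>2) * sq_norm (\<lambda>\<xi>. frft_integral \<alpha> l (h n) \<xi> - g' \<xi>)" for n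
    by (rule sq_norm_demod_diff) (auto intro: frft_integral_eq_fourier hL h')
  moreover have "sq_norm (\<lambda>\<xi>. frft_integral \<alpha> l (h n) \<xi> - g' \<xi>) = sq_norm (\<lambda>\<xi>. frft_integral \<alpha> l (h n) \<xi> - g \<xi>)" for n
    using g'(2) by (intro sq_norm_cong_AE) (auto elim!: eventually_mono)
  ultimately have lim2: "(\<lambda>n. sq_norm (\<lambda>\<omega>. fourier (\<lambda>x. h' n x * \<kappa> x) \<omega> - demod g' \<omega>)) \<longlonglongrightarrow> 0"
    using tendsto_0_ennreal_cmult[OF lim(2)] by simp
  have "sq_norm (\<lambda>\<omega>. 0 - demod g' \<omega>) = ennreal (mod_prod D / (cmod (frft_const \<alpha>))\<^sup>2) * sq_norm (\<lambda>\<xi>. 0 - g' \<xi>)"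
    by (rule sq_norm_demod_diff) auto
  then have "sq_integrable (demod g')"
    using L2_fun_imp_sq_integrable[OF g g'] by (auto simp: sq_integrable_def sq_norm_def ennreal_mult_less_top)
  then show ?thesis
    unfolding l2_fourier_def using F int lim1 lim2 by (auto intro!: exI[of _ "\<lambda>n x. h' n x * \<kappa> x"])
qed

text \<open>
  Existence matters: \<open>mfrft\<close> is a choice, about which nothing is known unless some transform
  exists.
\<close>

lemma is_mfrft_exists:
  assumes f: "L2_fun f"
  shows "\<exists>g. is_mfrft \<alpha> l f g"
proof -
  obtain f' where f' [measurable]: "f' \<in> borel_measurable borel" and ff': "AE x in lborel. f x = f' x"
    using f lebesgue_complex_borel_representative unfolding L2_fun_def by blast
  have chirp_sq: "sq_norm (\<lambda>x. q x * \<kappa> x) = sq_norm q" "sq_norm (\<lambda>x. q x * cnj (\<kappa> x)) = sq_norm q" for q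
    by (simp_all add: sq_norm_def norm_mult)
  have "sq_integrable (\<lambda>x. f' x * \<kappa> x)"
    using L2_fun_imp_sq_integrable[OF f f' ff'] by (auto simp: sq_integrable_def chirp_sq)
  then obtain G where "l2_fourier (\<lambda>x. f' x * \<kappa> x) G"
    using l2_fourier_exists by blast
  then obtain h where G: "sq_integrable G"
    and h: "\<And>n. integrable lborel (h n)" "\<And>n. sq_integrable (h n)"
    and lim: "(\<lambda>n. sq_norm (\<lambda>x. h n x - f' x * \<kappa> x)) \<longlonglongrightarrow> 0" "(\<lambda>n. sq_norm (\<lambda>\<omega>. fourier (h n) \<omega> - G \<omega>)) \<longlonglongrightarrow> 0"
    by (auto simp: l2_fourier_def)
  have [measurable]: "G \<in> borel_measurable borel" "h n \<in> borel_measurable borel" for n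
    using G h by (auto simp: sq_integrable_def)
  define g where "g \<xi> = frft_const \<alpha> * \<kappa> \<xi> * G (vec_times D \<xi>)" for \<xi>
  define k where "k n x = h n x * cnj (\<kappa> x)" for n x
  have [measurable]: "k n \<in> borel_measurable borel" for n
    unfolding k_def[abs_def] by measurable
  have [measurable]: "g \<in> borel_measurable borel"
    unfolding g_def[abs_def] by measurable
  have k: "integrable lborel (k n)" "sq_integrable (k n)" for n
    unfolding k_def using h(1)[of n] h(2)[of n]
    by (auto intro!: integrable_bounded_mult[where B=1] simp: sq_integrable_def chirp_sq)
  have norm_const: "sq_norm (\<lambda>\<xi>. frft_const \<alpha> * \<kappa> \<xi> * q (vec_times D \<xi>))
    = ennreal ((cmod (frft_const \<alpha>))\<^sup>2) * (ennreal (1 / mod_prod D) * sq_norm q)"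
    if [measurable]: "q \<in> borel_measurable borel" for q
  proof -
    have "sq_norm (\<lambda>\<xi>. frft_const \<alpha> * \<kappa> \<xi> * q (vec_times D \<xi>)) = sq_norm (\<lambda>\<xi>. frft_const \<alpha> * q (vec_times D \<xi>))"
      by (simp add: sq_norm_def norm_mult)
    also have "\<dots> = ennreal ((cmod (frft_const \<alpha>))\<^sup>2) * sq_norm (\<lambda>\<xi>. q (vec_times D \<xi>))"
      by (rule sq_norm_cmult) measurable
    finally show ?thesis
      by (simp only: sq_norm_vec_times[OF that scale_nz])
  qed
  have "sq_integrable g"
    unfolding sq_integrable_def g_def using G
    by (subst norm_const) (auto simp: sq_integrable_def ennreal_mult_less_top)
  then have g: "L2_fun g"
    by (rule sq_integrable_imp_L2_fun)
  have "sq_norm (\<lambda>x. k n x - f x) = sq_norm (\<lambda>x. h n x - f' x * \<kappa> x)" for n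
  proof -
    have "cmod (k n x - f' x) = cmod (h n x - f' x * \<kappa> x)" for x
    proof -
      have "k n x - f' x = (h n x - f' x * \<kappa> x) * cnj (\<kappa> x)"
        by (simp add: k_def left_diff_distrib mult.assoc chirp_mult_cnj)
      then show ?thesis by (simp add: norm_mult)
    qed
    then show ?thesis
      using ff' by (intro sq_norm_cong_AE) (auto elim!: eventually_mono)
  qed
  then have lim1: "(\<lambda>n. sq_norm (\<lambda>x. k n x - f x)) \<longlonglongrightarrow> 0"
    using lim(1) by simp
  have "sq_norm (\<lambda>\<xi>. frft_integral \<alpha> l (k n) \<xi> - g \<xi>)
    = ennreal ((cmod (frft_const \<alpha>))\<^sup>2) * (ennreal (1 / mod_prod D) * sq_norm (\<lambda>\<omega>. fourier (h n) \<omega> - G \<omega>))" for n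
  proof -
    have "(\<lambda>x. k n x * \<kappa> x) = h n"
      by (simp add: k_def fun_eq_iff mult.assoc chirp_mult_cnj)
    then have "frft_integral \<alpha> l (k n) \<xi> - g \<xi> = frft_const \<alpha> * \<kappa> \<xi> * (\<lambda>\<omega>. fourier (h n) \<omega> - G \<omega>) (vec_times D \<xi>)" for \<xi>
      using frft_integral_eq_fourier[of "k n" "k n" \<alpha> l \<xi>]
      by (simp add: g_def measurable_completion right_diff_distrib)
    then show ?thesis
      by (simp only:) (rule norm_const, measurable)
  qed
  then have lim2: "(\<lambda>n. sq_norm (\<lambda>\<xi>. frft_integral \<alpha> l (k n) \<xi> - g \<xi>)) \<longlonglongrightarrow> 0"
    using tendsto_0_ennreal_cmult[OF tendsto_0_ennreal_cmult[OF lim(2)]] by simp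
  have "integrable lebesgue (k n)" "L2_fun (k n)" for n
    using k by (auto simp: integrable_completion intro: sq_integrable_imp_L2_fun)
  then show ?thesis
    unfolding is_mfrft_def L2_norm_tendsto_0_iff using g lim1 lim2 by blast
qed

lemma is_mfrft_mfrft: "L2_fun f \<Longrightarrow> is_mfrft \<alpha> l f (mfrft \<alpha> l f)"
  unfolding mfrft_def by (rule someI_ex[OF is_mfrft_exists])

lemma L2_fun_mfrft: "L2_fun f \<Longrightarrow> L2_fun (mfrft \<alpha> l f)"
  using is_mfrft_mfrft by (auto simp: is_mfrft_def)

lemma mfrft_eq_0_imp:
  assumes f: "L2_fun f" and 0: "AE \<xi> in lborel. mfrft \<alpha> l f \<xi> = 0"
  shows "AE x in lborel. f x = 0"
proof -
  obtain f' where f' [measurable]: "f' \<in> borel_measurable borel" and ff': "AE x in lborel. f x = f' x"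
    using f lebesgue_complex_borel_representative unfolding L2_fun_def by blast
  have "l2_fourier (\<lambda>x. f' x * \<kappa> x) (demod (\<lambda>_. 0))"
    by (rule is_mfrft_imp_l2_fourier[OF is_mfrft_mfrft[OF f] f f' ff' _ 0]) simp
  then have "AE x in lborel. f' x * \<kappa> x = 0"
    by (rule l2_fourier_inject) (simp add: demod_def)
  then show ?thesis
    using ff' by eventually_elim simp
qed

section \<open>The fractional wavelet transform in the frequency domain\<close>

text \<open>
  For fixed \<open>a\<close> the wavelet transform is, up to a unimodular chirp and a constant, the convolution
  of the chirped signal with the reflected, conjugated and dilated chirped wavelet.
\<close>

lemma mfrwt_eq_convolution:
  assumes f: "L2_fun f" "f' \<in> borel_measurable borel" "AE x in lborel. f x = f' x"
    and \<psi>: "L2_fun \<psi>" "\<psi>' \<in> borel_measurable borel" "AE x in lborel. \<psi> x = \<psi>' x"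
    and a: "mod_prod a \<noteq> 0"
  shows "mfrwt \<alpha> l \<psi> f a b = frft_c_prod \<alpha> * cnj (\<kappa> b) * complex_of_real (1 / sqrt (mod_prod a)) *
    (\<integral>t. (f' t * \<kappa> t) * cnj ((\<lambda>s. \<psi>' s * \<kappa> s) (- (vec_times (vec_inverse a) (b - t)))) \<partial>lborel)"
proof -
  note [measurable] = f(2) \<psi>(2)
  have ia: "mod_prod (vec_inverse a) \<noteq> 0"
    using a by (simp add: mod_prod_inverse)
  have div: "vec_divide (t - b) a = vec_times (vec_inverse a) (t - b)"
     "- (vec_times (vec_inverse a) (b - t)) = vec_times (vec_inverse a) (t - b)" for t
    by (simp_all add: vec_divide_def vec_times_def vec_inverse_def vec_eq_iff diff_divide_distrib)
  let ?C = "frft_c_prod \<alpha> * cnj (\<kappa> b) * complex_of_real (1 / sqrt (mod_prod a))"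
  let ?k = "\<lambda>t. ?C * ((f' t * \<kappa> t) * cnj ((\<lambda>s. \<psi>' s * \<kappa> s) (vec_times (vec_inverse a) (t - b))))"
  have [measurable]: "?k \<in> borel_measurable borel"
    by measurable
  have "AE t in lborel. \<psi> (vec_times (vec_inverse a) (t - b)) = \<psi>' (vec_times (vec_inverse a) (t - b))"
    by (rule AE_lborel_shift[OF AE_vec_times[OF \<psi>(3) ia]])
  then have eq: "AE t in lborel. f t * cnj (daughter_wavelet \<alpha> l \<psi> a b t) = ?k t"
    using f(3) by eventually_elim
      (simp add: daughter_wavelet_def wavelet_tilde_def div cnj_chirp mult_ac)
  then have "(\<lambda>t. f t * cnj (daughter_wavelet \<alpha> l \<psi> a b t)) \<in> borel_measurable lebesgue"
    by (rule lebesgue_measurable_AE_eq[rotated]) measurable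
  then have "mfrwt \<alpha> l \<psi> f a b = (\<integral>t. ?k t \<partial>lebesgue)"
    unfolding mfrwt_def using AE_completion[OF eq] by (intro integral_cong_AE) (auto intro: measurable_completion)
  also have "\<dots> = (\<integral>t. ?k t \<partial>lborel)"
    by (rule integral_completion) measurable
  also have "\<dots> = ?C * (\<integral>t. (f' t * \<kappa> t) * cnj ((\<lambda>s. \<psi>' s * \<kappa> s) (vec_times (vec_inverse a) (t - b))) \<partial>lborel)"
    by (rule integral_mult_right_zero)
  finally show ?thesis
    by (simp only: div)
qed

text \<open>
  The heart of the matter.  In the frequency domain the wavelet transform at scale \<open>a\<close> multiplies the
  transform of \<open>f\<close> by that of the dilated wavelet, and a Fourier transform is bounded by the \<open>L\<^sup>1\<close> norm.
  Only moduli are compared, so all chirps drop out.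
\<close>

lemma mfrft_product_le_mfrwt:
  assumes f: "L2_fun f" and \<psi>: "L2_fun \<psi>" and a: "mod_prod a \<noteq> 0"
    and g: "g \<in> borel_measurable borel" "AE \<eta> in lborel. mfrft \<alpha> l f \<eta> = g \<eta>"
    and p: "p \<in> borel_measurable borel" "AE \<eta> in lborel. mfrft \<alpha> l \<psi> \<eta> = p \<eta>"
  shows "AE \<eta> in lborel. ennreal ((2 * pi) ^ CARD('n) / cmod (frft_c_prod \<alpha>) * sqrt (mod_prod a) * (cmod (g \<eta>) * cmod (p (vec_times a \<eta>))))
     \<le> (\<integral>\<^sup>+b. ennreal (cmod (mfrwt \<alpha> l \<psi> f a b)) \<partial>lborel)"
proof -
  obtain f' where f' [measurable]: "f' \<in> borel_measurable borel" and ff': "AE x in lborel. f x = f' x"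
    using f lebesgue_complex_borel_representative unfolding L2_fun_def by blast
  obtain \<psi>' where \<psi>' [measurable]: "\<psi>' \<in> borel_measurable borel" and \<psi>\<psi>': "AE x in lborel. \<psi> x = \<psi>' x"
    using \<psi> lebesgue_complex_borel_representative unfolding L2_fun_def by blast
  let ?F = "\<lambda>x. f' x * \<kappa> x" and ?P = "\<lambda>s. \<psi>' s * \<kappa> s"
  have F: "l2_fourier ?F (demod g)"
    by (rule is_mfrft_imp_l2_fourier[OF is_mfrft_mfrft[OF f] f f' ff' g])
  have "l2_fourier ?P (demod p)"
    by (rule is_mfrft_imp_l2_fourier[OF is_mfrft_mfrft[OF \<psi>] \<psi> \<psi>' \<psi>\<psi>' p])
  moreover have ia: "mod_prod (vec_inverse a) \<noteq> 0" "vec_inverse (vec_inverse a) = a"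
    using a by (simp add: mod_prod_inverse) (simp add: vec_inverse_def)
  ultimately have P: "l2_fourier (\<lambda>x. cnj (?P (- (vec_times (vec_inverse a) x)))) (\<lambda>\<omega>. complex_of_real (mod_prod a) * cnj (demod p (vec_times a \<omega>)))"
    using l2_fourier_vec_times[OF l2_fourier_cnj_reflect, of ?P "demod p" "vec_inverse a"] by (simp add: mod_prod_inverse)
  let ?V = "\<lambda>b. \<integral>t. ?F t * cnj (?P (- (vec_times (vec_inverse a) (b - t)))) \<partial>lborel"
  have [measurable]: "?V \<in> borel_measurable borel"
    by measurable
  let ?w = "cmod (frft_c_prod \<alpha>) / sqrt (mod_prod a)"
  have w: "0 \<le> ?w" by simp
  have W: "cmod (mfrwt \<alpha> l \<psi> f a b) = ?w * cmod (?V b)" for b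
    by (simp add: mfrwt_eq_convolution[OF f f' ff' \<psi> \<psi>' \<psi>\<psi>' a] norm_mult norm_divide)
  have "AE \<omega> in lborel. ennreal (cmod (demod g \<omega> * (complex_of_real (mod_prod a) * cnj (demod p (vec_times a \<omega>)))))
     \<le> (\<integral>\<^sup>+b. ennreal (cmod (?V b)) \<partial>lborel)"
    by (rule l2_fourier_convolution_bound[OF F P])
  from AE_vec_times[OF this scale_nz] show ?thesis
  proof eventually_elim
    case (elim \<eta>)
    let ?N = "cmod (frft_const \<alpha>)"
    have N: "?N\<^sup>2 = (cmod (frft_c_prod \<alpha>))\<^sup>2 / (2 * pi) ^ CARD('n)" "?N > 0"
      using const_nz by (simp_all add: frft_const_def norm_divide norm_power power_divide power_mult[symmetric] mult.commute[of _ 2] power_mult)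
    have "?w * cmod (demod g (vec_times D \<eta>) * (complex_of_real (mod_prod a) * cnj (demod p (vec_times a (vec_times D \<eta>)))))
      = ?w * mod_prod a * (cmod (g \<eta>) * cmod (p (vec_times a \<eta>))) / ?N\<^sup>2"
      unfolding vec_times_left_commute[of a] norm_mult complex_mod_cnj cmod_demod_scale
      by (simp add: power2_eq_square)
    also have "\<dots> = (2 * pi) ^ CARD('n) / cmod (frft_c_prod \<alpha>) * sqrt (mod_prod a) * (cmod (g \<eta>) * cmod (p (vec_times a \<eta>)))"
    proof -
      define r where "r = sqrt (mod_prod a)"
      have m: "mod_prod a = r * r" and r: "r \<noteq> 0"
        using a by (simp_all add: r_def)
      show ?thesis
        unfolding N(1) r_def[symmetric] m using c_prod_nz r by (simp add: power2_eq_square field_simps)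
    qed
    finally have pt: "?w * cmod (demod g (vec_times D \<eta>) * (complex_of_real (mod_prod a) * cnj (demod p (vec_times a (vec_times D \<eta>)))))
      = (2 * pi) ^ CARD('n) / cmod (frft_c_prod \<alpha>) * sqrt (mod_prod a) * (cmod (g \<eta>) * cmod (p (vec_times a \<eta>)))" .
    have "ennreal ((2 * pi) ^ CARD('n) / cmod (frft_c_prod \<alpha>) * sqrt (mod_prod a) * (cmod (g \<eta>) * cmod (p (vec_times a \<eta>))))
      = ennreal ?w * ennreal (cmod (demod g (vec_times D \<eta>) * (complex_of_real (mod_prod a) * cnj (demod p (vec_times a (vec_times D \<eta>))))))"
      unfolding pt[symmetric] by (rule ennreal_mult[OF w norm_ge_zero])
    also have "\<dots> \<le> ennreal ?w * (\<integral>\<^sup>+b. ennreal (cmod (?V b)) \<partial>lborel)"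
      by (intro mult_left_mono elim) simp
    also have "\<dots> = (\<integral>\<^sup>+b. ennreal (cmod (mfrwt \<alpha> l \<psi> f a b)) \<partial>lborel)"
      unfolding W ennreal_mult[OF w norm_ge_zero] by (rule nn_integral_cmult[symmetric]) measurable
    finally show ?case .
  qed
qed

end

section \<open>An interpolation bound for the absolute integral\<close>

lemma nn_integral_one_plus_abs_powr_finite:
  assumes "p > 1"
  shows "(\<integral>\<^sup>+t. ennreal ((1 + \<bar>t\<bar>) powr (- p)) \<partial>lborel) < \<infinity>"
proof -
  let ?f = "\<lambda>t::real. ennreal ((1 + \<bar>t\<bar>) powr (- p)) * indicator {0..} t"
  have "(\<integral>\<^sup>+t. ?f t \<partial>lborel) = ennreal (0 - - ((1 + 0) powr (1 - p)) / (p - 1))"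
  proof (rule nn_integral_FTC_atLeast)
    show "((\<lambda>t. - ((1 + t) powr (1 - p)) / (p - 1)) \<longlongrightarrow> 0) at_top"
    proof -
      have "((\<lambda>t::real. (1 + t) powr (1 - p)) \<longlongrightarrow> 0) at_top"
        using assms by (intro tendsto_neg_powr filterlim_tendsto_add_at_top[OF tendsto_const] filterlim_ident) auto
      from tendsto_divide[OF tendsto_minus[OF this] tendsto_const, of "p - 1"] show ?thesis
        using assms by simp
    qed
    show "DERIV (\<lambda>t. - ((1 + t) powr (1 - p)) / (p - 1)) t :> (1 + \<bar>t\<bar>) powr (- p)" if "0 \<le> t" for t
    proof -
      have "((\<lambda>t. (1 + t) powr (1 - p)) has_real_derivative (1 - p) * (1 + t) powr (1 - p - 1)) (at t)"
        using that by (auto intro!: derivative_eq_intros)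
      from DERIV_cdivide[OF DERIV_minus[OF this], of "p - 1"]
      have "((\<lambda>t. - ((1 + t) powr (1 - p)) / (p - 1)) has_real_derivative - ((1 - p) * (1 + t) powr - p) / (p - 1)) (at t)"
        by simp
      moreover have "- ((1 - p) * y) / (p - 1) = y" for y
      proof -
        have "- ((1 - p) * y) = (p - 1) * y"
          by (simp add: algebra_simps)
        then show ?thesis
          using assms by simp
      qed
      ultimately show ?thesis
        using that by simp
    qed
  qed auto
  also have "\<dots> < \<infinity>"
    by simp
  finally have half: "(\<integral>\<^sup>+t. ?f t \<partial>lborel) < \<infinity>" .
  have "(\<integral>\<^sup>+t. ennreal ((1 + \<bar>t\<bar>) powr (- p)) \<partial>lborel) \<le> (\<integral>\<^sup>+t. ?f t + ?f (0 - t) \<partial>lborel)"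
    by (intro nn_integral_mono) (auto simp: indicator_def)
  also have "\<dots> = (\<integral>\<^sup>+t. ?f t \<partial>lborel) + (\<integral>\<^sup>+t. ?f (0 - t) \<partial>lborel)"
    by (rule nn_integral_add) measurable
  also have "(\<integral>\<^sup>+t. ?f (0 - t) \<partial>lborel) = (\<integral>\<^sup>+t. ?f t \<partial>lborel)"
    by (rule nn_integral_lborel_shift(2)) measurable
  finally show ?thesis
    using half by (auto intro: le_less_trans)
qed

text \<open>
  Since \<open>2 * \<theta> > N\<close>, the weight is dominated by a product of one-dimensional weights with exponent
  \<open>p = 2 * \<theta> / N > 1\<close>.  This is where the lower bound on \<open>\<theta>\<close> enters.
\<close>

lemma nn_integral_weight_finite:
  fixes \<theta> :: real
  assumes "\<theta> > real DIM('a::euclidean_space) / 2"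
  shows "(\<integral>\<^sup>+x. ennreal (1 / (1 + norm x powr (2 * \<theta>))) \<partial>(lborel :: 'a measure)) < \<infinity>"
proof -
  define p where "p = 2 * \<theta> / real DIM('a)"
  have p: "p > 1" "p * real DIM('a) = 2 * \<theta>"
    using assms by (simp_all add: p_def field_simps)
  have \<theta>: "\<theta> > 0"
    using assms by (rule le_less_trans[rotated]) simp
  have le: "1 / (1 + norm x powr (2 * \<theta>)) \<le> 2 powr (2 * \<theta>) * (\<Prod>b\<in>Basis. (1 + \<bar>x \<bullet> b\<bar>) powr (- p))" for x :: 'a
  proof -
    have "(\<Prod>b\<in>Basis. (1 + \<bar>x \<bullet> b\<bar>) powr p) \<le> (\<Prod>b\<in>(Basis::'a set). (1 + norm x) powr p)"
      using p by (intro prod_mono conjI powr_mono2) (auto simp: Basis_le_norm)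
    also have "\<dots> = (1 + norm x) powr (2 * \<theta>)"
    proof -
      have "(\<Prod>b\<in>(Basis::'a set). (1 + norm x) powr p) = ((1 + norm x) powr p) powr real DIM('a)"
        by (subst powr_realpow) (auto simp: add_nonneg_eq_0_iff)
      then show ?thesis
        by (simp add: powr_powr p(2))
    qed
    also have "\<dots> \<le> (2 * max 1 (norm x)) powr (2 * \<theta>)"
      using \<theta> by (intro powr_mono2) auto
    also have "\<dots> = 2 powr (2 * \<theta>) * max 1 (norm x) powr (2 * \<theta>)"
      by (simp add: powr_mult)
    also have "max 1 (norm x) powr (2 * \<theta>) \<le> 1 + norm x powr (2 * \<theta>)"
      by (simp add: max_def)
    finally have "(\<Prod>b\<in>Basis. (1 + \<bar>x \<bullet> b\<bar>) powr p) \<le> 2 powr (2 * \<theta>) * (1 + norm x powr (2 * \<theta>))"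
      by simp
    moreover have "(\<Prod>b\<in>Basis. (1 + \<bar>x \<bullet> b\<bar>) powr p) > 0"
      by (intro prod_pos) auto
    moreover have "1 + norm x powr (2 * \<theta>) > 0"
      by (simp add: add_pos_nonneg)
    moreover have "(\<Prod>b\<in>Basis. (1 + \<bar>x \<bullet> b\<bar>) powr (- p)) = 1 / (\<Prod>b\<in>Basis. (1 + \<bar>x \<bullet> b\<bar>) powr p)"
      by (simp add: powr_minus_divide prod_dividef)
    ultimately show ?thesis
      by (simp add: pos_divide_le_eq pos_le_divide_eq mult.commute)
  qed
  have "(\<integral>\<^sup>+x. ennreal (1 / (1 + norm x powr (2 * \<theta>))) \<partial>(lborel :: 'a measure))
    \<le> (\<integral>\<^sup>+x. ennreal (2 powr (2 * \<theta>)) * (\<Prod>b\<in>Basis. ennreal ((1 + \<bar>x \<bullet> b\<bar>) powr (- p))) \<partial>(lborel :: 'a measure))"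
    using le by (intro nn_integral_mono) (simp add: prod_ennreal ennreal_mult[symmetric] prod_nonneg ennreal_leI)
  also have "\<dots> = ennreal (2 powr (2 * \<theta>)) * (\<integral>\<^sup>+x. (\<Prod>b\<in>Basis. ennreal ((1 + \<bar>x \<bullet> b\<bar>) powr (- p))) \<partial>(lborel :: 'a measure))"
    by (rule nn_integral_cmult) measurable
  also have "(\<integral>\<^sup>+x. (\<Prod>b\<in>Basis. ennreal ((1 + \<bar>x \<bullet> b\<bar>) powr (- p))) \<partial>(lborel :: 'a measure))
     = (\<Prod>b\<in>(Basis::'a set). \<integral>\<^sup>+t. ennreal ((1 + \<bar>t\<bar>) powr (- p)) \<partial>lborel)"
    by (rule nn_integral_lborel_prod[where f="\<lambda>_ t. ennreal ((1 + \<bar>t\<bar>) powr (- p))"]) auto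
  also have "ennreal (2 powr (2 * \<theta>)) * \<dots> < \<infinity>"
    using nn_integral_one_plus_abs_powr_finite[OF p(1)]
    by (auto simp: ennreal_mult_less_top power_less_top_ennreal)
  finally show ?thesis .
qed

text \<open>
  Cauchy-Schwarz with the weight \<open>1 + (norm x / r) powr (2 * \<theta>)\<close>; the scale \<open>r\<close> is free and will
  be optimised.
\<close>

lemma L1_le_L2_weighted_scaled:
  fixes w :: "'a::euclidean_space \<Rightarrow> complex"
  assumes [measurable]: "w \<in> borel_measurable borel" and r: "r > 0"
  shows "(\<integral>\<^sup>+x. ennreal (cmod (w x)) \<partial>lborel)\<^sup>2
    \<le> (sq_norm w + ennreal (r powr (- 2 * \<theta>)) * sq_norm (\<lambda>x. complex_of_real (norm x powr \<theta>) * w x))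
      * (ennreal (r ^ DIM('a)) * (\<integral>\<^sup>+x. ennreal (1 / (1 + norm x powr (2 * \<theta>))) \<partial>(lborel :: 'a measure)))"
proof -
  let ?m = "\<lambda>x::'a. 1 + (norm x / r) powr (2 * \<theta>)"
  have m: "?m x > 0" for x
    by (simp add: add_pos_nonneg)
  have "(\<integral>\<^sup>+x. ennreal (cmod (w x)) \<partial>lborel) = (\<integral>\<^sup>+x. ennreal (cmod (w x) * sqrt (?m x)) * ennreal (1 / sqrt (?m x)) \<partial>lborel)"
  proof (intro nn_integral_cong)
    fix x :: 'a
    have "sqrt (?m x) > 0"
      using m[of x] by simp
    then show "ennreal (cmod (w x)) = ennreal (cmod (w x) * sqrt (?m x)) * ennreal (1 / sqrt (?m x))"
      by (subst ennreal_mult[symmetric]) auto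
  qed
  then have "(\<integral>\<^sup>+x. ennreal (cmod (w x)) \<partial>lborel)\<^sup>2 \<le>
     (\<integral>\<^sup>+x. (ennreal (cmod (w x) * sqrt (?m x)))\<^sup>2 \<partial>lborel) * (\<integral>\<^sup>+x. (ennreal (1 / sqrt (?m x)))\<^sup>2 \<partial>lborel)"
    by (simp only:) (rule Cauchy_Schwarz_nn_integral; measurable)
  also have "(\<integral>\<^sup>+x. (ennreal (cmod (w x) * sqrt (?m x)))\<^sup>2 \<partial>lborel)
    = (\<integral>\<^sup>+x. ennreal ((cmod (w x))\<^sup>2) + ennreal (r powr (- 2 * \<theta>)) * ennreal ((cmod (complex_of_real (norm x powr \<theta>) * w x))\<^sup>2) \<partial>lborel)"
  proof (intro nn_integral_cong)
    fix x :: 'a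
    have "(norm x / r) powr (2 * \<theta>) = r powr (- 2 * \<theta>) * (norm x powr \<theta>)\<^sup>2"
    proof -
      have "(norm x powr \<theta>)\<^sup>2 = norm x powr (2 * \<theta>)"
        by (simp add: power2_eq_square powr_add[symmetric])
      then show ?thesis
        using r by (simp add: powr_divide powr_minus field_simps)
    qed
    then have "(cmod (w x) * sqrt (?m x))\<^sup>2 = (cmod (w x))\<^sup>2 + r powr (- 2 * \<theta>) * (cmod (complex_of_real (norm x powr \<theta>) * w x))\<^sup>2"
      using m[of x] by (simp add: power_mult_distrib norm_mult algebra_simps)
    moreover have "0 \<le> cmod (w x) * sqrt (?m x)"
      using m[of x] by simp
    ultimately show "(ennreal (cmod (w x) * sqrt (?m x)))\<^sup>2
      = ennreal ((cmod (w x))\<^sup>2) + ennreal (r powr (- 2 * \<theta>)) * ennreal ((cmod (complex_of_real (norm x powr \<theta>) * w x))\<^sup>2)"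
      by (simp only: ennreal_power) (simp add: ennreal_mult)
  qed
  also have "\<dots> = sq_norm w + ennreal (r powr (- 2 * \<theta>)) * sq_norm (\<lambda>x. complex_of_real (norm x powr \<theta>) * w x)"
    unfolding sq_norm_def by (subst nn_integral_add, measurable, subst nn_integral_cmult, measurable)
  also have "(\<integral>\<^sup>+x. (ennreal (1 / sqrt (?m x)))\<^sup>2 \<partial>(lborel::'a measure)) = (\<integral>\<^sup>+x. ennreal (1 / ?m x) \<partial>(lborel::'a measure))"
  proof (intro nn_integral_cong)
    fix x :: 'a
    have "(ennreal (1 / sqrt (?m x)))\<^sup>2 = ennreal ((1 / sqrt (?m x))\<^sup>2)"
      using m[of x] by (intro ennreal_power) simp
    also have "(1 / sqrt (?m x))\<^sup>2 = 1 / ?m x"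
      using m[of x] by (simp add: power_divide)
    finally show "(ennreal (1 / sqrt (?m x)))\<^sup>2 = ennreal (1 / ?m x)" .
  qed
  also have "\<dots> = ennreal (r ^ DIM('a)) * (\<integral>\<^sup>+x. ennreal (1 / (1 + norm x powr (2 * \<theta>))) \<partial>(lborel :: 'a measure))"
    using r by (subst nn_integral_lborel_affine[where c=r and t=0]) auto
  finally show ?thesis .
qed

lemma ennreal_powr_pos: "x \<noteq> 0 \<Longrightarrow> ennreal_powr x p \<noteq> 0"
  by (cases x) (auto simp: ennreal_powr_def)

lemma ennreal_powr_ennreal: "0 \<le> x \<Longrightarrow> ennreal_powr (ennreal x) p = ennreal (x powr p)"
  by (simp add: ennreal_powr_def)

lemma ennreal_powr_top: "ennreal_powr \<infinity> p = \<infinity>"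
  by (simp add: ennreal_powr_def)

lemma sq_norm_eq_0D:
  assumes [measurable]: "f \<in> borel_measurable borel" and "sq_norm f = 0"
  shows "AE x in lborel. f x = 0"
proof -
  have "AE x in lborel. ennreal ((cmod (f x))\<^sup>2) = 0"
    using assms(2) unfolding sq_norm_def by (subst (asm) nn_integral_0_iff_AE) auto
  then show ?thesis
    by (auto elim!: eventually_mono)
qed

text \<open>
  The scale \<open>r = (Y / X) powr (1 / \<theta>)\<close>, where \<open>X\<close> and \<open>Y\<close> are the plain and the weighted norm,
  balances the two terms of \<open>L1_le_L2_weighted_scaled\<close>.  The degenerate cases need care in the extended
  reals: a vanishing norm forces \<open>w = 0\<close>, and otherwise an infinite norm makes the right-hand side
  infinite.
\<close>

lemma L1_le_L2_weighted:
  fixes \<theta> :: real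
  assumes \<theta>: "\<theta> > real CARD('n) / 2"
  shows "\<exists>C>0. \<forall>w :: real ^ 'n \<Rightarrow> complex. w \<in> borel_measurable borel \<longrightarrow>
    (\<integral>\<^sup>+x. ennreal (cmod (w x)) \<partial>lborel)\<^sup>2 \<le> ennreal C * (ennreal_powr (L2_norm w) (2 - real CARD('n) / \<theta>)
      * ennreal_powr (L2_norm (\<lambda>x. complex_of_real (norm x powr \<theta>) * w x)) (real CARD('n) / \<theta>))"
proof -
  let ?N = "CARD('n)"
  let ?I = "\<integral>\<^sup>+x. ennreal (1 / (1 + norm x powr (2 * \<theta>))) \<partial>(lborel :: (real ^ 'n) measure)"
  obtain \<kappa> where \<kappa>: "?I = ennreal \<kappa>" "0 \<le> \<kappa>"
    using nn_integral_weight_finite[where 'a="real ^ 'n", of \<theta>] \<theta> by (cases ?I) auto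
  have \<theta>0: "\<theta> > 0"
    using \<theta> by (rule le_less_trans[rotated]) simp
  have "(\<integral>\<^sup>+x. ennreal (cmod (w x)) \<partial>lborel)\<^sup>2 \<le> ennreal (2 * \<kappa> + 1) * (ennreal_powr (L2_norm w) (2 - ?N / \<theta>)
      * ennreal_powr (L2_norm (\<lambda>x. complex_of_real (norm x powr \<theta>) * w x)) (?N / \<theta>))"
    if [measurable]: "w \<in> borel_measurable borel" for w :: "real ^ 'n \<Rightarrow> complex"
  proof -
    let ?v = "\<lambda>x. complex_of_real (norm x powr \<theta>) * w x"
    have w0: ?thesis if "AE x in lborel. w x = 0"
    proof -
      have "(\<integral>\<^sup>+x. ennreal (cmod (w x)) \<partial>lborel) = 0"
        using that by (subst nn_integral_0_iff_AE) (auto elim!: eventually_mono)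
      then show ?thesis by simp
    qed
    show ?thesis
    proof (cases "sq_norm w = 0 \<or> sq_norm ?v = 0")
      case True
      have "AE x in lborel. w x = 0"
      proof (cases "sq_norm w = 0")
        case True
        then show ?thesis by (intro sq_norm_eq_0D) auto
      next
        case False
        with \<open>_ \<or> _\<close> have "AE x in lborel. ?v x = 0"
          by (intro sq_norm_eq_0D) auto
        then show ?thesis
          using AE_lborel_singleton[of "0 :: real ^ 'n"] by eventually_elim auto
      qed
      then show ?thesis by (rule w0)
    next
      case False
      have nz: "ennreal_powr (L2_norm w) p \<noteq> 0" "ennreal_powr (L2_norm ?v) p \<noteq> 0" for p
        using False unfolding L2_norm_eq by (auto intro!: ennreal_powr_pos)
      show ?thesis
      proof (cases "sq_norm w = \<infinity> \<or> sq_norm ?v = \<infinity>")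
        case True
        then have "L2_norm w = \<infinity> \<or> L2_norm ?v = \<infinity>"
          unfolding L2_norm_eq by (auto simp: ennreal_powr_top[simplified])
        then have "ennreal_powr (L2_norm w) (2 - ?N / \<theta>) * ennreal_powr (L2_norm ?v) (?N / \<theta>) = \<infinity>"
          using nz by (auto simp: ennreal_powr_top[simplified] ennreal_mult_eq_top_iff)
        then show ?thesis
          using \<kappa>(2) by (auto simp: ennreal_mult_eq_top_iff)
      next
        case fin: False
        define X where "X = l2norm w"
        define Y where "Y = l2norm ?v"
        have sq: "sq_integrable w" "sq_integrable ?v"
          using fin by (auto simp: sq_integrable_def top.not_eq_extremum)
        then have S: "sq_norm w = ennreal (X\<^sup>2)" "sq_norm ?v = ennreal (Y\<^sup>2)"
          unfolding X_def Y_def by (auto intro: sq_norm_eq_l2norm)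
        have XY: "X > 0" "Y > 0"
          using False l2norm_nonneg[of w] l2norm_nonneg[of ?v] unfolding S
          by (auto simp: X_def[symmetric] Y_def[symmetric] less_le)
        have L: "L2_norm w = ennreal X" "L2_norm ?v = ennreal Y"
          unfolding L2_norm_eq S using XY by (simp_all add: ennreal_powr_ennreal powr_half_sqrt)
        define r where "r = (Y / X) powr (1 / \<theta>)"
        have r: "r > 0"
          using XY by (simp add: r_def)
        have r1: "r powr (- 2 * \<theta>) * Y\<^sup>2 = X\<^sup>2"
        proof -
          have "r powr (- 2 * \<theta>) = (Y / X) powr (- 2)"
            using \<theta>0 by (simp add: r_def powr_powr)
          also have "\<dots> = (X / Y)\<^sup>2"
            using XY by (simp add: powr_minus powr_numeral power_divide)
          finally show ?thesis
            using XY by (simp add: power_divide)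
        qed
        have r2: "X\<^sup>2 * r ^ ?N = X powr (2 - ?N / \<theta>) * Y powr (?N / \<theta>)"
        proof -
          have "r ^ ?N = (Y / X) powr (?N / \<theta>)"
            using r by (simp add: powr_realpow[symmetric]) (simp add: r_def powr_powr)
          moreover have "X powr (2 - ?N / \<theta>) = X\<^sup>2 / X powr (?N / \<theta>)"
            using XY by (simp add: powr_diff powr_numeral)
          ultimately show ?thesis
            using XY by (simp add: powr_divide)
        qed
        have "(\<integral>\<^sup>+x. ennreal (cmod (w x)) \<partial>lborel)\<^sup>2
          \<le> (sq_norm w + ennreal (r powr (- 2 * \<theta>)) * sq_norm ?v) * (ennreal (r ^ DIM(real ^ 'n)) * ?I)"
          by (rule L1_le_L2_weighted_scaled[OF that r])
        also have "\<dots> = ennreal (2 * X\<^sup>2 * (r ^ ?N * \<kappa>))"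
        proof -
          have "ennreal (r powr (- 2 * \<theta>)) * ennreal (Y\<^sup>2) = ennreal (X\<^sup>2)"
            by (subst ennreal_mult[symmetric]) (simp_all only: r1 powr_ge_zero zero_le_power2)
          moreover have "ennreal (r ^ ?N) * ennreal \<kappa> = ennreal (r ^ ?N * \<kappa>)"
            using r \<kappa>(2) by (intro ennreal_mult[symmetric]) auto
          ultimately show ?thesis
            using r \<kappa>(2) unfolding S \<kappa>(1)
            by (simp add: ennreal_mult[symmetric] ennreal_plus[symmetric] del: ennreal_plus)
        qed
        also have "2 * X\<^sup>2 * (r ^ ?N * \<kappa>) = 2 * \<kappa> * (X powr (2 - ?N / \<theta>) * Y powr (?N / \<theta>))"
          unfolding r2[symmetric] by (simp add: mult_ac)
        also have "ennreal (2 * \<kappa> * (X powr (2 - ?N / \<theta>) * Y powr (?N / \<theta>))) \<le> ennreal ((2 * \<kappa> + 1) * (X powr (2 - ?N / \<theta>) * Y powr (?N / \<theta>)))"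
          by (intro ennreal_leI mult_right_mono) auto
        also have "\<dots> = ennreal (2 * \<kappa> + 1) * (ennreal_powr (L2_norm w) (2 - ?N / \<theta>) * ennreal_powr (L2_norm ?v) (?N / \<theta>))"
          unfolding L using XY \<kappa>(2) by (subst ennreal_mult) (auto simp: ennreal_mult ennreal_powr_ennreal)
        finally show ?thesis .
      qed
    qed
  qed
  then show ?thesis
    using \<kappa>(2) by (intro exI[of _ "2 * \<kappa> + 1"]) auto
qed

lemma borel_measurable_mod_prod [measurable]: "mod_prod \<in> borel_measurable borel"
  unfolding mod_prod_def by (intro borel_measurable_continuous_onI continuous_intros)

lemma borel_measurable_vec_inverse [measurable]: "vec_inverse \<in> borel_measurable borel"
  unfolding vec_inverse_def by (subst borel_measurable_euclidean_space) (auto simp: Basis_vec_real inner_axis)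

lemma borel_measurable_ennreal_powr [measurable]:
  assumes [measurable]: "f \<in> borel_measurable M"
  shows "(\<lambda>x. ennreal_powr (f x) p) \<in> borel_measurable M"
  unfolding ennreal_powr_def by measurable

lemma AE_mod_prod_nz: "AE x in lborel. mod_prod (x :: real ^ 'n) \<noteq> 0"
proof -
  have "AE x in lborel. (x :: real ^ 'n) $ k \<noteq> 0" for k
  proof -
    have "negligible {x :: real ^ 'n. x \<bullet> axis k 1 = 0}"
      by (rule negligible_standard_hyperplane) (auto simp: Basis_vec_real)
    then have "AE x in lebesgue. x \<notin> {x :: real ^ 'n. x \<bullet> axis k 1 = 0}"
      by (intro AE_not_in) (simp add: negligible_iff_null_sets)
    then show ?thesis
      by (simp add: AE_completion_iff inner_axis)
  qed
  then show ?thesis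
    by (simp add: mod_prod_nz_iff AE_all_countable)
qed

context frft_parameters
begin

section \<open>The local uncertainty inequality\<close>

text \<open>
  Joint measurability is what lets constants, \<open>|K| = \<infinity>\<close> included, be taken out of the integral over
  the scales.
\<close>

lemma mfrwt_measurable_pair:
  assumes f: "L2_fun f" and \<psi>: "L2_fun \<psi>"
  obtains W where "(\<lambda>(a, b). W a b) \<in> borel_measurable (borel \<Otimes>\<^sub>M borel)"
    "\<And>a b. mod_prod a \<noteq> 0 \<Longrightarrow> mfrwt \<alpha> l \<psi> f a b = W a b"
proof -
  obtain f' where f' [measurable]: "f' \<in> borel_measurable borel" and ff': "AE x in lborel. f x = f' x"
    using f lebesgue_complex_borel_representative unfolding L2_fun_def by blast
  obtain \<psi>' where \<psi>' [measurable]: "\<psi>' \<in> borel_measurable borel" and \<psi>\<psi>': "AE x in lborel. \<psi> x = \<psi>' x"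
    using \<psi> lebesgue_complex_borel_representative unfolding L2_fun_def by blast
  define W where "W a b = frft_c_prod \<alpha> * cnj (\<kappa> b) * complex_of_real (1 / sqrt (mod_prod a)) *
    (\<integral>t. (f' t * \<kappa> t) * cnj ((\<lambda>s. \<psi>' s * \<kappa> s) (- (vec_times (vec_inverse a) (b - t)))) \<partial>lborel)" for a b
  have "(\<lambda>(a, b). W a b) \<in> borel_measurable (borel \<Otimes>\<^sub>M borel)"
    unfolding W_def by measurable
  moreover have "mfrwt \<alpha> l \<psi> f a b = W a b" if "mod_prod a \<noteq> 0" for a b
    unfolding W_def by (rule mfrwt_eq_convolution[OF f f' ff' \<psi> \<psi>' \<psi>\<psi>' that])
  ultimately show ?thesis
    by (rule that)
qed

end

text \<open>
  The measure \<open>da / |a|\<close> is invariant under dilation.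
\<close>

lemma wavelet_integral_dilate:
  fixes p :: "real ^ 'n \<Rightarrow> complex"
  assumes [measurable]: "p \<in> borel_measurable borel" and \<eta>: "mod_prod \<eta> \<noteq> 0"
  shows "(\<integral>\<^sup>+a. ennreal ((cmod (p (vec_times a \<eta>)))\<^sup>2 / mod_prod a) * indicator nonzero_coords a \<partial>lborel)
    = (\<integral>\<^sup>+u. ennreal ((cmod (p u))\<^sup>2 / mod_prod u) * indicator nonzero_coords u \<partial>lborel)"
proof -
  have [measurable]: "(nonzero_coords :: (real ^ 'n) set) \<in> sets borel"
    unfolding nonzero_coords_def by measurable
  have pos: "mod_prod \<eta> > 0"
    using \<eta> mod_prod_nonneg[of \<eta>] by linarith
  have "(\<integral>\<^sup>+u. ennreal ((cmod (p u))\<^sup>2 / mod_prod u) * indicator nonzero_coords u \<partial>lborel)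
    = ennreal (mod_prod \<eta>) * (\<integral>\<^sup>+a. ennreal ((cmod (p (vec_times \<eta> a)))\<^sup>2 / mod_prod (vec_times \<eta> a)) * indicator nonzero_coords (vec_times \<eta> a) \<partial>lborel)"
    by (rule nn_integral_vec_times) (use \<eta> in auto)
  also have "\<dots> = (\<integral>\<^sup>+a. ennreal (mod_prod \<eta>) * (ennreal ((cmod (p (vec_times \<eta> a)))\<^sup>2 / mod_prod (vec_times \<eta> a)) * indicator nonzero_coords (vec_times \<eta> a)) \<partial>lborel)"
    by (rule nn_integral_cmult[symmetric]) measurable
  also have "\<dots> = (\<integral>\<^sup>+a. ennreal ((cmod (p (vec_times a \<eta>)))\<^sup>2 / mod_prod a) * indicator nonzero_coords a \<partial>lborel)"
  proof (intro nn_integral_cong)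
    fix a :: "real ^ 'n"
    have "indicator nonzero_coords (vec_times \<eta> a) = (indicator nonzero_coords a :: ennreal)"
      using \<eta> by (simp add: indicator_def nonzero_coords_def mod_prod_times)
    then show "ennreal (mod_prod \<eta>) * (ennreal ((cmod (p (vec_times \<eta> a)))\<^sup>2 / mod_prod (vec_times \<eta> a)) * indicator nonzero_coords (vec_times \<eta> a))
      = ennreal ((cmod (p (vec_times a \<eta>)))\<^sup>2 / mod_prod a) * indicator nonzero_coords a"
      using pos by (simp add: mult.assoc[symmetric] ennreal_mult[symmetric] mod_prod_times vec_times_commute[of \<eta>])
  qed
  finally show ?thesis by simp
qed

theorem theorem4p4:
  fixes \<alpha> :: "real ^ 'n" and l \<theta> :: real and \<psi> :: "real ^ 'n \<Rightarrow> complex"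
  assumes "l \<noteq> 0"
    and "\<And>k. \<alpha> $ k \<in> {-pi<..<pi} - {0}"
    and "admissible_wavelet \<alpha> l \<psi>"
    and "\<theta> > real CARD('n) / 2"
  shows "\<forall>K \<in> sets lebesgue. \<exists>A::real. 0 \<le> A \<and> (\<forall>f. L2_fun f \<longrightarrow>
    (\<integral>\<^sup>+ \<eta>\<in>K. ennreal ((cmod (mfrft \<alpha> l f \<eta>))\<^sup>2) \<partial>lebesgue)
    \<le> ennreal ((cmod (frft_c_prod \<alpha>))\<^sup>2) / wavelet_const \<alpha> l \<psi> * ennreal A
       * ennreal (mod_prod (sin_vec \<alpha>) / (l\<^sup>2) ^ CARD('n)) * emeasure lebesgue K
       * (\<integral>\<^sup>+ a\<in>nonzero_coords.
            ennreal_powr (L2_norm (\<lambda>b. mfrwt \<alpha> l \<psi> f a b)) (2 - real CARD('n) / \<theta>)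
            * ennreal_powr (L2_norm (\<lambda>b. complex_of_real (norm b powr \<theta>) * mfrwt \<alpha> l \<psi> f a b))
                (real CARD('n) / \<theta>)
            * ennreal (1 / (mod_prod a)\<^sup>2) \<partial>lebesgue))"
proof -
  interpret frft_parameters \<alpha> l
    using assms(1,2) by unfold_locales
  let ?R = "nonzero_coords :: (real ^ 'n) set"
  have R [measurable]: "?R \<in> sets borel"
    unfolding nonzero_coords_def by measurable
  have \<psi>: "L2_fun \<psi>" and \<psi>_nz: "\<not> (AE x in lborel. \<psi> x = 0)" and fin: "wavelet_integral \<alpha> l \<psi> < \<infinity>"
    using assms(3) by (simp_all add: admissible_wavelet_def AE_completion_iff)
  obtain p where p [measurable]: "p \<in> borel_measurable borel" and pp: "AE u in lborel. mfrft \<alpha> l \<psi> u = p u"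
    using L2_fun_mfrft[OF \<psi>] lebesgue_complex_borel_representative unfolding L2_fun_def by blast
  have WI: "wavelet_integral \<alpha> l \<psi> = (\<integral>\<^sup>+u. ennreal ((cmod (p u))\<^sup>2 / mod_prod u) * indicator ?R u \<partial>lborel)"
    unfolding wavelet_integral_def nn_integral_completion using pp
    by (intro nn_integral_cong_AE) (auto elim!: eventually_mono)
  have "wavelet_integral \<alpha> l \<psi> \<noteq> 0"
  proof
    assume "wavelet_integral \<alpha> l \<psi> = 0"
    then have "AE u in lborel. ennreal ((cmod (p u))\<^sup>2 / mod_prod u) * indicator ?R u = 0"
      unfolding WI by (subst (asm) nn_integral_0_iff_AE) auto
    with pp AE_mod_prod_nz have "AE u in lborel. mfrft \<alpha> l \<psi> u = 0"
    proof eventually_elim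
      case (elim u)
      moreover have "mod_prod u > 0"
        using elim mod_prod_nonneg[of u] by linarith
      ultimately show ?case
        by (auto simp: nonzero_coords_def indicator_def divide_le_0_iff)
    qed
    then show False
      using mfrft_eq_0_imp[OF \<psi>] \<psi>_nz by blast
  qed
  then obtain w where w: "wavelet_integral \<alpha> l \<psi> = ennreal w" "w > 0"
    using fin by (cases "wavelet_integral \<alpha> l \<psi>") (auto simp: less_le)
  obtain C where C: "C > 0" and interp: "\<And>v :: real ^ 'n \<Rightarrow> complex. v \<in> borel_measurable borel \<Longrightarrow>
    (\<integral>\<^sup>+x. ennreal (cmod (v x)) \<partial>lborel)\<^sup>2 \<le> ennreal C * (ennreal_powr (L2_norm v) (2 - real CARD('n) / \<theta>)
      * ennreal_powr (L2_norm (\<lambda>x. complex_of_real (norm x powr \<theta>) * v x)) (real CARD('n) / \<theta>))"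
    using L1_le_L2_weighted[OF assms(4)] by blast
  define c where "c = cmod (frft_c_prod \<alpha>)"
  have c: "c > 0"
    using c_prod_nz by (simp add: c_def)
  define B where "B = (2 * pi) ^ CARD('n) / c"
  have B: "B > 0"
    using c by (simp add: B_def)
  define \<sigma> where "\<sigma> = mod_prod (sin_vec \<alpha>) / (l\<^sup>2) ^ CARD('n)"
  have \<sigma>: "\<sigma> > 0"
  proof -
    have "mod_prod (sin_vec \<alpha>) \<noteq> 0"
      using sin_nz by (simp add: mod_prod_nz_iff sin_vec_def)
    then show ?thesis
      using l_nz mod_prod_nonneg[of "sin_vec \<alpha>"] by (simp add: \<sigma>_def less_le)
  qed
  \<comment> \<open>Chosen such that all constants of the statement combine to \<open>C / B\<^sup>2 / w\<close>.\<close>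
  define A where "A = C * (2 * pi) ^ CARD('n) / (B\<^sup>2 * c\<^sup>2 * \<sigma>)"
  have A: "A \<ge> 0"
    using C \<sigma> by (simp add: A_def)
  have A_eq: "ennreal (c\<^sup>2) / wavelet_const \<alpha> l \<psi> * ennreal A * ennreal \<sigma> = ennreal (C / B\<^sup>2) * ennreal (1 / w)"
  proof -
    have "ennreal (c\<^sup>2) / wavelet_const \<alpha> l \<psi> = ennreal (c\<^sup>2 / ((2 * pi) ^ CARD('n) * w))"
      unfolding wavelet_const_def w(1) using w(2)
      by (simp only: ennreal_mult[symmetric] less_imp_le zero_le_power pi_ge_zero mult_nonneg_nonneg zero_le_numeral)
         (subst divide_ennreal, auto)
    moreover have "c\<^sup>2 / ((2 * pi) ^ CARD('n) * w) * A * \<sigma> = C / B\<^sup>2 * (1 / w)"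
      using c \<sigma> B w(2) by (simp add: A_def)
    ultimately show ?thesis
      using A \<sigma> C w(2) by (simp add: ennreal_mult[symmetric])
  qed
  have main: "(\<integral>\<^sup>+ \<eta>\<in>K. ennreal ((cmod (mfrft \<alpha> l f \<eta>))\<^sup>2) \<partial>lebesgue)
    \<le> ennreal (c\<^sup>2) / wavelet_const \<alpha> l \<psi> * ennreal A * ennreal \<sigma> * emeasure lebesgue K
       * (\<integral>\<^sup>+ a\<in>?R. ennreal_powr (L2_norm (\<lambda>b. mfrwt \<alpha> l \<psi> f a b)) (2 - real CARD('n) / \<theta>)
            * ennreal_powr (L2_norm (\<lambda>b. complex_of_real (norm b powr \<theta>) * mfrwt \<alpha> l \<psi> f a b)) (real CARD('n) / \<theta>)
            * ennreal (1 / (mod_prod a)\<^sup>2) \<partial>lebesgue)" (is "?L \<le> _ * ?K * ?I")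
    if K: "K \<in> sets lebesgue" and f: "L2_fun f" for K f
  proof -
    obtain g where g [measurable]: "g \<in> borel_measurable borel" and gg: "AE \<eta> in lborel. mfrft \<alpha> l f \<eta> = g \<eta>"
      using L2_fun_mfrft[OF f] lebesgue_complex_borel_representative unfolding L2_fun_def by blast
    have "(indicator K :: _ \<Rightarrow> ennreal) \<in> borel_measurable lebesgue"
      using K by simp
    then obtain k where "k \<in> borel_measurable lborel" and kk: "AE \<eta> in lborel. indicator K \<eta> = (k \<eta> :: ennreal)"
      using completion_ex_borel_measurable by blast
    then have [measurable]: "k \<in> borel_measurable borel"
      by simp
    obtain W where W_meas [measurable]: "(\<lambda>(a, b). W a b) \<in> borel_measurable (borel \<Otimes>\<^sub>M borel)"
      and W: "\<And>a b. mod_prod a \<noteq> 0 \<Longrightarrow> mfrwt \<alpha> l \<psi> f a b = W a b"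
      using mfrwt_measurable_pair[OF f \<psi>] by blast
    have W': "mfrwt \<alpha> l \<psi> f a = W a" if "mod_prod a \<noteq> 0" for a
      using W[OF that] by (rule ext)
    define Q where "Q a = ennreal_powr (L2_norm (W a)) (2 - real CARD('n) / \<theta>)
            * ennreal_powr (L2_norm (\<lambda>b. complex_of_real (norm b powr \<theta>) * W a b)) (real CARD('n) / \<theta>)
            * ennreal (1 / (mod_prod a)\<^sup>2) * indicator ?R a" for a
    have [measurable]: "Q \<in> borel_measurable borel"
      unfolding Q_def L2_norm_eq sq_norm_def by measurable
    have I: "?I = (\<integral>\<^sup>+a. Q a \<partial>lborel)"
      unfolding nn_integral_completion Q_def
      by (intro nn_integral_cong) (auto simp: indicator_def nonzero_coords_def W W')
    have K_eq: "?K = (\<integral>\<^sup>+\<eta>. k \<eta> \<partial>lborel)"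
    proof -
      have "?K = (\<integral>\<^sup>+\<eta>. indicator K \<eta> \<partial>lebesgue)"
        using K by simp
      also have "\<dots> = (\<integral>\<^sup>+\<eta>. k \<eta> \<partial>lborel)"
        unfolding nn_integral_completion using kk by (intro nn_integral_cong_AE)
      finally show ?thesis .
    qed
    have L: "?L = (\<integral>\<^sup>+\<eta>. ennreal ((cmod (g \<eta>))\<^sup>2) * k \<eta> \<partial>lborel)"
      unfolding nn_integral_completion using gg kk
      by (intro nn_integral_cong_AE) (auto elim!: eventually_elim2)
    let ?h = "\<lambda>\<eta> a. ennreal ((cmod (g \<eta>))\<^sup>2) * k \<eta> * (ennreal ((cmod (p (vec_times a \<eta>)))\<^sup>2 / mod_prod a) * indicator ?R a)"
    \<comment> \<open>Multiply by the wavelet integral, dilate it to the frequency \<open>\<eta>\<close>, and exchange the integrals.\<close>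
    have "?L * ennreal w = (\<integral>\<^sup>+\<eta>. ennreal ((cmod (g \<eta>))\<^sup>2) * k \<eta> * ennreal w \<partial>lborel)"
      unfolding L by (rule nn_integral_multc[symmetric]) measurable
    also have "\<dots> = (\<integral>\<^sup>+\<eta>. (\<integral>\<^sup>+a. ?h \<eta> a \<partial>lborel) \<partial>lborel)"
    proof (rule nn_integral_cong_AE)
      show "AE \<eta> in lborel. ennreal ((cmod (g \<eta>))\<^sup>2) * k \<eta> * ennreal w = (\<integral>\<^sup>+a. ?h \<eta> a \<partial>lborel)"
        using AE_mod_prod_nz
      proof eventually_elim
        case (elim \<eta>)
        have "ennreal w = (\<integral>\<^sup>+a. ennreal ((cmod (p (vec_times a \<eta>)))\<^sup>2 / mod_prod a) * indicator ?R a \<partial>lborel)"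
          unfolding w(1)[symmetric] WI by (rule wavelet_integral_dilate[OF p elim, symmetric])
        then show ?case
          by (simp only:) (rule nn_integral_cmult[symmetric], measurable)
      qed
    qed
    also have "\<dots> = (\<integral>\<^sup>+a. (\<integral>\<^sup>+\<eta>. ?h \<eta> a \<partial>lborel) \<partial>lborel)"
      by (rule lborel_pair.Fubini'[symmetric]) measurable
    also have "\<dots> \<le> (\<integral>\<^sup>+a. ennreal (C / B\<^sup>2) * (\<integral>\<^sup>+\<eta>. k \<eta> \<partial>lborel) * Q a \<partial>lborel)"
    proof (rule nn_integral_mono)
      fix a :: "real ^ 'n"
      show "(\<integral>\<^sup>+\<eta>. ?h \<eta> a \<partial>lborel) \<le> ennreal (C / B\<^sup>2) * (\<integral>\<^sup>+\<eta>. k \<eta> \<partial>lborel) * Q a"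
      proof (cases "mod_prod a = 0")
        case True
        then show ?thesis by (simp add: nonzero_coords_def)
      next
        case a: False
        then have a_pos: "mod_prod a > 0"
          using mod_prod_nonneg[of a] by linarith
        have ind: "indicator ?R a = (1 :: ennreal)"
          using a by (simp add: nonzero_coords_def)
        define T where "T = (\<integral>\<^sup>+b. ennreal (cmod (W a b)) \<partial>lborel)"
        have T: "T\<^sup>2 \<le> ennreal C * (ennreal_powr (L2_norm (W a)) (2 - real CARD('n) / \<theta>)
            * ennreal_powr (L2_norm (\<lambda>b. complex_of_real (norm b powr \<theta>) * W a b)) (real CARD('n) / \<theta>))"
          unfolding T_def by (rule interp) measurable
        have "AE \<eta> in lborel. ennreal (B * sqrt (mod_prod a) * (cmod (g \<eta>) * cmod (p (vec_times a \<eta>)))) \<le> T"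
          using mfrft_product_le_mfrwt[OF f \<psi> a g gg p pp] by (simp add: B_def c_def T_def W[OF a])
        then have "(\<integral>\<^sup>+\<eta>. ?h \<eta> a \<partial>lborel) \<le> (\<integral>\<^sup>+\<eta>. ennreal (1 / B\<^sup>2 * (1 / (mod_prod a)\<^sup>2)) * T\<^sup>2 * k \<eta> \<partial>lborel)"
        proof (intro nn_integral_mono_AE, eventually_elim)
          case (elim \<eta>)
          let ?x = "B * sqrt (mod_prod a) * (cmod (g \<eta>) * cmod (p (vec_times a \<eta>)))"
          have x: "0 \<le> ?x"
            using B by simp
          have "(ennreal ?x)\<^sup>2 \<le> T\<^sup>2"
            by (intro power_mono elim) simp
          then have "ennreal (1 / B\<^sup>2 * (1 / (mod_prod a)\<^sup>2)) * ennreal (?x\<^sup>2) \<le> ennreal (1 / B\<^sup>2 * (1 / (mod_prod a)\<^sup>2)) * T\<^sup>2"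
            unfolding ennreal_power[OF x] by (rule mult_left_mono) simp
          moreover have "1 / B\<^sup>2 * (1 / (mod_prod a)\<^sup>2) * ?x\<^sup>2 = (cmod (g \<eta>))\<^sup>2 * ((cmod (p (vec_times a \<eta>)))\<^sup>2 / mod_prod a)"
            using B a_pos by (simp add: power_mult_distrib field_simps power2_eq_square)
          ultimately have "ennreal ((cmod (g \<eta>))\<^sup>2) * ennreal ((cmod (p (vec_times a \<eta>)))\<^sup>2 / mod_prod a)
              \<le> ennreal (1 / B\<^sup>2 * (1 / (mod_prod a)\<^sup>2)) * T\<^sup>2"
            by (simp add: ennreal_mult[symmetric] del: power_mult_distrib)
          then have "ennreal ((cmod (g \<eta>))\<^sup>2) * ennreal ((cmod (p (vec_times a \<eta>)))\<^sup>2 / mod_prod a) * k \<eta>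
              \<le> ennreal (1 / B\<^sup>2 * (1 / (mod_prod a)\<^sup>2)) * T\<^sup>2 * k \<eta>"
            by (rule mult_right_mono) simp
          then show ?case
            by (simp add: ind mult_ac)
        qed
        also have "\<dots> = ennreal (1 / B\<^sup>2 * (1 / (mod_prod a)\<^sup>2)) * T\<^sup>2 * (\<integral>\<^sup>+\<eta>. k \<eta> \<partial>lborel)"
          by (rule nn_integral_cmult) measurable
        also have "\<dots> \<le> ennreal (1 / B\<^sup>2 * (1 / (mod_prod a)\<^sup>2)) * (ennreal C * (ennreal_powr (L2_norm (W a)) (2 - real CARD('n) / \<theta>)
            * ennreal_powr (L2_norm (\<lambda>b. complex_of_real (norm b powr \<theta>) * W a b)) (real CARD('n) / \<theta>))) * (\<integral>\<^sup>+\<eta>. k \<eta> \<partial>lborel)"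
          by (intro mult_right_mono mult_left_mono T) auto
        also have "ennreal (1 / B\<^sup>2 * (1 / (mod_prod a)\<^sup>2)) = ennreal (1 / B\<^sup>2) * ennreal (1 / (mod_prod a)\<^sup>2)"
          by (rule ennreal_mult) auto
        also have "ennreal (1 / B\<^sup>2) * ennreal (1 / (mod_prod a)\<^sup>2) * (ennreal C * (ennreal_powr (L2_norm (W a)) (2 - real CARD('n) / \<theta>)
            * ennreal_powr (L2_norm (\<lambda>b. complex_of_real (norm b powr \<theta>) * W a b)) (real CARD('n) / \<theta>))) * (\<integral>\<^sup>+\<eta>. k \<eta> \<partial>lborel)
          = (ennreal C * ennreal (1 / B\<^sup>2)) * (\<integral>\<^sup>+\<eta>. k \<eta> \<partial>lborel) * Q a"
          unfolding Q_def ind by (simp only: mult_ac mult_1_right mult_1)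
        also have "ennreal C * ennreal (1 / B\<^sup>2) = ennreal (C / B\<^sup>2)"
          using C by (subst ennreal_mult[symmetric]) auto
        finally show ?thesis .
      qed
    qed
    also have "\<dots> = ennreal (C / B\<^sup>2) * ?K * ?I"
      unfolding I K_eq by (rule nn_integral_cmult) measurable
    finally have "?L * ennreal w * ennreal (1 / w) \<le> ennreal (C / B\<^sup>2) * ?K * ?I * ennreal (1 / w)"
      by (rule mult_right_mono) simp
    moreover have "?L * ennreal w * ennreal (1 / w) = ?L"
      using w(2) by (simp add: mult.assoc ennreal_mult[symmetric])
    ultimately show ?thesis
      unfolding A_eq by (simp only: mult_ac)
  qed
  show ?thesis
    using main[unfolded c_def \<sigma>_def] A by blast
qed

end
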